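(* Let $(N,M,L)\in\mathbb Z_{\ge0}^3\setminus\{(0,0,0)\}$ and let $\lambda$ be a partition. The quantum corner polynomial $$\mathfrak{QC}_\lambda(x_1,\dots,x_N;x_{N+1},\dots,x_{N+M};x_{N+M+1},\dots,x_{N+M+L};q,t)$$ is partially symmetric with respect to the index sets $I_1=\{1,\dots,N\}$, $I_2=\{N+1,\dots,N+M\}$, $I_3=\{N+M+1,\dots,N+M+L\}$; that is, it is invariant under $x_i\mapsto x_{\sigma(i)}$ for every permutation $\sigma$ of $\{1,\dots,N+M+L\}$ with $\sigma(I_r)=I_r$ for $r=1,2,3$.
   Context: $q,t$ are nonzero complex numbers such that $q^at^b=1$ with $a,b\in\mathbb Z$ only if $a=b=0$. Empty sums are $0$, empty products are $1$. **Partitions.** A partition $\lambda=(\lambda_1\ge\lambda_2\ge\cdots)$ has $\ell(\lambda)$ nonzero parts; it is identified with its Young diagram ($\lambda_i$ boxes in row $i$). $\lambda'$ is the transpose; for a box $s=(i,j)$, $a_\lambda(s)=\lambda_i-j$, $\ell_\lambda(s)=\lambda'_j-i$. **Tritableaux.** A reverse semi-standard Young tritableau of type $(N,M,L)$ and shape $\lambda$ is a filling of the boxes of $\lambda$ by elements of $\{1,\dots,N+M+L\}$ (ordinary numbers: $1,\dots,N$; super: $N+1,\dots,N+M$; hyper: $N+M+1,\dots,N+M+L$) such that entries weakly decrease left to right in rows and top to bottom in columns, ordinary numbers strictly decrease down each column, and super numbers strictly decrease along each row. The set of these is $\mathrm{RSSYTT}(N,M,L;\lambda)$. $T_0,T_1,T_2$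 are the subdiagrams of $T$ of ordinary, super, hyper entries; $\mathrm{sh}$ denotes shape, $|\cdot|$ number of boxes; $\mathrm{sh}(T_2)$ and $\mathrm{sh}(T_1\sqcup T_2)$ are partitions. $\theta_{\alpha,\beta}$ is the number of boxes in row $\alpha$ of $T$ with entry $\beta$; $\ell(T_2)$ is the number of rows of $T_2$. For $N+M+1\le d\le N+M+L$, $T^{(d)}$ is the partition formed by boxes of $T$ with entries $\ge d$, $T^{(d)}_\zeta$ its $\zeta$-th part, and $T^{(N+M+L+1)}=\emptyset$. **Weights.** $f_{q,t}(u)=(tu;q)_\infty/(qu;q)_\infty$, $(x;q)_\infty=\prod_{i\ge0}(1-xq^i)$; only ratios $f_{q,t}(q^nu)/f_{q,t}(u)=\prod_{i=0}^{n-1}\frac{1-q^{i+1}u}{1-tq^iu}$ ($n\ge0$) occur, and they are read as these finite products. For $\mu\subseteq\lambda$, $$\mathfrak C_{\lambda/\mu}(q,t)=\prod_{1\le i\le j\le\ell(\mu)}\frac{f_{q,t}(t^{j-i}q^{\mu_i-\mu_j})f_{q,t}(t^{j-i}q^{\lambda_i-\mu_{j+1}})}{f_{q,t}(t^{j-i}q^{\lambda_i-\mu_j})f_{q,t}(t^{j-i}q^{\mu_i-\mu_{j+1}})},\quad \psi_{\lambda/\mu}(q,t)=\prod_{1\le i\le j\le\ell(\mu)}\frac{f_{q,t}(q^{\mu_i-\mu_j}t^{j-i})f_{q,t}(q^{\lambda_i-\lambda_{j+1}}t^{j-i})}{f_{q,t}(q^{\lambda_i-\mu_j}t^{j-i})f_{q,t}(q^{\mu_i-\lambda_{j+1}}t^{j-i})}.$$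 $\psi_{T_0}(q,t)=\prod_{k=1}^N\psi_{\nu^{(k)}/\nu^{(k+1)}}(q,t)$, where $\nu^{(k)}$ is the partition of boxes of $T$ with entry $\ge k$; $\psi_{T_1'}(t,q)=\prod_{k=N+1}^{N+M}\psi_{(\nu^{(k)})'/(\nu^{(k+1)})'}(t,q)$ (roles of $q$ and $t$ interchanged in $\psi$). $H(\mu,q,t)=\prod_{s\in\mu}(q^{a_\mu(s)+1}-t^{\ell_\mu(s)})$. $$\mathcal A_2(T;q,t)=\prod_{d=N+M+1}^{N+M+L}\mathfrak C_{T^{(d)}/T^{(d+1)}}(q,t)\prod_{\zeta=1}^{\ell(T_2)}\prod_{d=N+M+1}^{N+M+L}\prod_{j=1}^{\theta_{\zeta,d}-1}\frac{(1-qt^{-1}q^j)(1-t)}{(1-qt^{-1})(1-tq^j)}$$ $$\times\prod_{d=N+M+1}^{N+M+L}\prod_{\zeta=1}^{\ell(T_2)}\prod_{\tau=\zeta+1}^{\ell(T_2)}\prod_{\alpha=0}^{\theta_{\zeta,d}-1}\frac{(1-t^{\tau-\zeta+1}q^{T^{(d+1)}_\zeta+\alpha-T^{(d)}_\tau})(1-t^{\tau-\zeta}q^{T^{(d+1)}_\zeta+\alpha-T^{(d+1)}_\tau})}{(1-t^{\tau-\zeta}q^{T^{(d+1)}_\zeta+\alpha-T^{(d)}_\tau})(1-t^{\tau-\zeta+1}q^{T^{(d+1)}_\zeta+\alpha-T^{(d+1)}_\tau})}.$$ $$R_T(q,t)=\mathcal A_2(T;q,t)\,\psi_{T_1'}(t,q)\,\psi_{T_0}(q,t)\,\frac{H(\mathrm{sh}(T_1\sqcup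 T_2),q,t^{-1})}{H(\mathrm{sh}(T_1\sqcup T_2)',t^{-1},q)}\prod_{\square\in\mathrm{sh}(T_2)}\frac{(t^{-1})^{\ell_{\mathrm{sh}(T_2)}(\square)+1}-q^{a_{\mathrm{sh}(T_2)}(\square)}}{q^{a_{\mathrm{sh}(T_2)}(\square)+1}-(t^{-1})^{\ell_{\mathrm{sh}(T_2)}(\square)}}\Big(\frac{q^{-1}t-1}{t^{-1}-1}\Big)^{|T_2|}.$$ **Quantum corner polynomial.** $\mathfrak{QC}_\lambda(x_1,\dots,x_N;x_{N+1},\dots,x_{N+M};x_{N+M+1},\dots,x_{N+M+L};q,t)=\sum_{T\in\mathrm{RSSYTT}(N,M,L;\lambda)}R_T(q,t)\,x_T$, where $x_T$ is the product over all boxes of $T$ of $x_{\text{entry}}$. *)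

theory Defs
  imports
    Complex_Main
    "HOL-Library.FuncSet"
    "HOL-Library.Poly_Mapping"
    "HOL-Combinatorics.Permutations"
begin

definition generic_parameters :: "complex \<Rightarrow> complex \<Rightarrow> bool" where
  "generic_parameters q t \<longleftrightarrow> q \<noteq> 0 \<and> t \<noteq> 0 \<and>
     (\<forall>a b :: int. q powi a * t powi b = 1 \<longrightarrow> a = 0 \<and> b = 0)"


section \<open>Partitions\<close>

text \<open>
  A partition is given by its sequence of parts, \<open>p i\<close> being the \<open>i\<close>-th part for \<open>i \<ge> 1\<close>.
  The value \<open>p 0\<close> has no meaning and is never used.
\<close>

type_synonym parts = "nat \<Rightarrow> nat"

definition is_partition :: "parts \<Rightarrow> bool" where
  "is_partition p \<longleftrightarrow> (\<forall>i j. 1 \<le> i \<and> i \<le> j \<longrightarrow> p j \<le> p i) \<and> finite {i. 1 \<le> i \<and> p i \<noteq> 0}"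

definition len :: "parts \<Rightarrow> nat" where
  "len p = card {i. 1 \<le> i \<and> p i \<noteq> 0}"

definition diagram :: "parts \<Rightarrow> (nat \<times> nat) set" where
  "diagram p = {(i, j). 1 \<le> i \<and> 1 \<le> j \<and> j \<le> p i}"

definition conj_part :: "parts \<Rightarrow> parts" where
  "conj_part p j = card {i. (i, j) \<in> diagram p}"

definition arm :: "parts \<Rightarrow> nat \<times> nat \<Rightarrow> nat" where
  "arm p s = p (fst s) - snd s"

definition leg :: "parts \<Rightarrow> nat \<times> nat \<Rightarrow> nat" where
  "leg p s = conj_part p (snd s) - fst s"


section \<open>Reverse semi-standard Young tritableaux\<close>

text \<open>
  A tableau of shape \<open>lam\<close> is a function on boxes that is \<open>undefined\<close> outside the diagram, so
  that there are only finitely many of them.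
\<close>

type_synonym filling = "nat \<times> nat \<Rightarrow> nat"

definition RSSYTT :: "nat \<Rightarrow> nat \<Rightarrow> nat \<Rightarrow> parts \<Rightarrow> filling set" where
  "RSSYTT N M L lam =
     {T \<in> diagram lam \<rightarrow>\<^sub>E {1..N + M + L}.
        (\<forall>i j j'. (i, j) \<in> diagram lam \<and> (i, j') \<in> diagram lam \<and> j < j' \<longrightarrow>
            T (i, j') \<le> T (i, j)) \<and>
        (\<forall>i i' j. (i, j) \<in> diagram lam \<and> (i', j) \<in> diagram lam \<and> i < i' \<longrightarrow>
            T (i', j) \<le> T (i, j)) \<and>
        (\<forall>i i' j. (i, j) \<in> diagram lam \<and> (i', j) \<in> diagram lam \<and> i < i' \<and>
            T (i, j) \<in> {1..N} \<and> T (i', j) \<in> {1..N} \<longrightarrow> T (i', j) < T (i, j)) \<and>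
        (\<forall>i j j'. (i, j) \<in> diagram lam \<and> (i, j') \<in> diagram lam \<and> j < j' \<and>
            T (i, j) \<in> {N + 1..N + M} \<and> T (i, j') \<in> {N + 1..N + M} \<longrightarrow>
            T (i, j') < T (i, j))}"

text \<open>
  \<open>shape_ge lam T k\<close> is the partition formed by the boxes with entry at least \<open>k\<close>. It is both
  \<open>\<nu>\<^sup>(\<^sup>k\<^sup>)\<close> and \<open>T\<^sup>(\<^sup>k\<^sup>)\<close>; in particular the shape of the hyper part \<open>T\<^sub>2\<close> is the one for
  \<open>k = N + M + 1\<close>, and that of \<open>T\<^sub>1 \<squnion> T\<^sub>2\<close> is the one for \<open>k = N + 1\<close>.
\<close>

definition shape_ge :: "parts \<Rightarrow> filling \<Rightarrow> nat \<Rightarrow> parts" where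
  "shape_ge lam T k i = card {j. (i, j) \<in> diagram lam \<and> k \<le> T (i, j)}"

definition theta :: "parts \<Rightarrow> filling \<Rightarrow> nat \<Rightarrow> nat \<Rightarrow> nat" where
  "theta lam T \<alpha> \<beta> = card {j. (\<alpha>, j) \<in> diagram lam \<and> T (\<alpha>, j) = \<beta>}"


section \<open>Weights\<close>

text \<open>
  \<open>f_ratio q t n u\<close> is the finite product that stands for \<open>f(q\<^sup>n u) / f(u)\<close>, where
  \<open>f(u) = (t u; q)\<^sub>\<infinity> / (q u; q)\<^sub>\<infinity>\<close>.
\<close>

definition f_ratio :: "complex \<Rightarrow> complex \<Rightarrow> nat \<Rightarrow> complex \<Rightarrow> complex" where
  "f_ratio q t n u = (\<Prod>i<n. (1 - q ^ (i + 1) * u) / (1 - t * q ^ i * u))"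

text \<open>
  The factors of \<open>\<CC>\<close> and \<open>\<psi>\<close> are quotients of the form
  \<open>f(\<mu>\<^sub>i - \<mu>\<^sub>j) f(\<lambda>\<^sub>i - b) / (f(\<lambda>\<^sub>i - \<mu>\<^sub>j) f(\<mu>\<^sub>i - b))\<close>, where \<open>f(m)\<close> abbreviates \<open>f(q\<^sup>m t\<^sup>j\<^sup>-\<^sup>i)\<close>,
  and \<open>b\<close> is \<open>\<mu>\<^sub>j\<^sub>+\<^sub>1\<close> for \<open>\<CC>\<close> and \<open>\<lambda>\<^sub>j\<^sub>+\<^sub>1\<close> for \<open>\<psi>\<close>. They are read as
  \<open>(f(\<lambda>\<^sub>i - b) / f(\<mu>\<^sub>i - b)) / (f(\<lambda>\<^sub>i - \<mu>\<^sub>j) / f(\<mu>\<^sub>i - \<mu>\<^sub>j))\<close>: in both inner ratios the arguments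
  differ by the factor \<open>q\<^sup>n\<close> with \<open>n = \<lambda>\<^sub>i - \<mu>\<^sub>i \<ge> 0\<close>.
\<close>

definition fC :: "complex \<Rightarrow> complex \<Rightarrow> parts \<Rightarrow> parts \<Rightarrow> complex" where
  "fC q t lam mu =
     (\<Prod>j = 1..len mu. \<Prod>i = 1..j.
        f_ratio q t (lam i - mu i) (q powi (int (mu i) - int (mu (j + 1))) * t ^ (j - i)) /
        f_ratio q t (lam i - mu i) (q powi (int (mu i) - int (mu j)) * t ^ (j - i)))"

definition psi :: "complex \<Rightarrow> complex \<Rightarrow> parts \<Rightarrow> parts \<Rightarrow> complex" where
  "psi q t lam mu =
     (\<Prod>j = 1..len mu. \<Prod>i = 1..j.
        f_ratio q t (lam i - mu i) (q powi (int (mu i) - int (lam (j + 1))) * t ^ (j - i)) /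
        f_ratio q t (lam i - mu i) (q powi (int (mu i) - int (mu j)) * t ^ (j - i)))"

definition psi_T0 :: "nat \<Rightarrow> complex \<Rightarrow> complex \<Rightarrow> parts \<Rightarrow> filling \<Rightarrow> complex" where
  "psi_T0 N q t lam T = (\<Prod>k = 1..N. psi q t (shape_ge lam T k) (shape_ge lam T (k + 1)))"

definition psi_T1' :: "nat \<Rightarrow> nat \<Rightarrow> complex \<Rightarrow> complex \<Rightarrow> parts \<Rightarrow> filling \<Rightarrow> complex" where
  "psi_T1' N M t q lam T =
     (\<Prod>k = N + 1..N + M.
        psi t q (conj_part (shape_ge lam T k)) (conj_part (shape_ge lam T (k + 1))))"

definition H :: "parts \<Rightarrow> complex \<Rightarrow> complex \<Rightarrow> complex" where
  "H mu q t = (\<Prod>s \<in> diagram mu. q ^ (arm mu s + 1) - t ^ leg mu s)"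

text \<open>In the middle product the range \<open>1..\<theta> - 1\<close> is empty also for \<open>\<theta> = 0\<close>, as it should be.\<close>

definition A2 ::
  "nat \<Rightarrow> nat \<Rightarrow> nat \<Rightarrow> complex \<Rightarrow> complex \<Rightarrow> parts \<Rightarrow> filling \<Rightarrow> complex" where
  "A2 N M L q t lam T =
     (let S = shape_ge lam T; r = len (S (N + M + 1)); D = {N + M + 1..N + M + L};
          e = (\<lambda>d d' \<zeta> \<tau> \<alpha>. int (S d \<zeta>) + int \<alpha> - int (S d' \<tau>))
      in (\<Prod>d\<in>D. fC q t (S d) (S (d + 1))) *
         (\<Prod>\<zeta> = 1..r. \<Prod>d\<in>D. \<Prod>j = 1..theta lam T \<zeta> d - 1.
            ((1 - q * inverse t * q ^ j) * (1 - t)) /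
            ((1 - q * inverse t) * (1 - t * q ^ j))) *
         (\<Prod>d\<in>D. \<Prod>\<zeta> = 1..r. \<Prod>\<tau> = \<zeta> + 1..r. \<Prod>\<alpha><theta lam T \<zeta> d.
            ((1 - t ^ (\<tau> - \<zeta> + 1) * q powi e (d + 1) d \<zeta> \<tau> \<alpha>) *
             (1 - t ^ (\<tau> - \<zeta>) * q powi e (d + 1) (d + 1) \<zeta> \<tau> \<alpha>)) /
            ((1 - t ^ (\<tau> - \<zeta>) * q powi e (d + 1) d \<zeta> \<tau> \<alpha>) *
             (1 - t ^ (\<tau> - \<zeta> + 1) * q powi e (d + 1) (d + 1) \<zeta> \<tau> \<alpha>))))"

definition R_weight ::
  "nat \<Rightarrow> nat \<Rightarrow> nat \<Rightarrow> complex \<Rightarrow> complex \<Rightarrow> parts \<Rightarrow> filling \<Rightarrow> complex" where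
  "R_weight N M L q t lam T =
     (let sh12 = shape_ge lam T (N + 1); sh2 = shape_ge lam T (N + M + 1)
      in A2 N M L q t lam T * psi_T1' N M t q lam T * psi_T0 N q t lam T *
         (H sh12 q (inverse t) / H (conj_part sh12) (inverse t) q) *
         (\<Prod>s \<in> diagram sh2.
            (inverse t ^ (leg sh2 s + 1) - q ^ arm sh2 s) /
            (q ^ (arm sh2 s + 1) - inverse t ^ leg sh2 s)) *
         ((inverse q * t - 1) / (inverse t - 1)) ^ card (diagram sh2))"


section \<open>The quantum corner polynomial\<close>

text \<open>
  Polynomials over the complex numbers in the variables \<open>x\<^sub>0, x\<^sub>1, x\<^sub>2, \<dots>\<close>: finitely supported
  maps from exponent vectors to coefficients, with the convolution product of
  \<^theory>\<open>HOL-Library.Poly_Mapping\<close>.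
\<close>

type_synonym cpoly = "(nat \<Rightarrow>\<^sub>0 nat) \<Rightarrow>\<^sub>0 complex"

definition const :: "complex \<Rightarrow> cpoly" where
  "const c = Poly_Mapping.single 0 c"

definition var :: "nat \<Rightarrow> cpoly" where
  "var i = Poly_Mapping.single (Poly_Mapping.single i 1) 1"

definition QC :: "nat \<Rightarrow> nat \<Rightarrow> nat \<Rightarrow> parts \<Rightarrow> complex \<Rightarrow> complex \<Rightarrow> cpoly" where
  "QC N M L lam q t =
     (\<Sum>T \<in> RSSYTT N M L lam.
        const (R_weight N M L q t lam T) * (\<Prod>s \<in> diagram lam. var (T s)))"

text \<open>The substitution of \<open>x\<^bsub>\<sigma>(i)\<^esub>\<close> for \<open>x\<^sub>i\<close>, for all \<open>i\<close> simultaneously.\<close>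

definition subst_vars :: "(nat \<Rightarrow> nat) \<Rightarrow> cpoly \<Rightarrow> cpoly" where
  "subst_vars \<sigma> p =
     (\<Sum>m \<in> Poly_Mapping.keys p.
        const (Poly_Mapping.lookup p m) *
        (\<Prod>i \<in> Poly_Mapping.keys m. var (\<sigma> i) ^ Poly_Mapping.lookup m i))"

definition partially_symmetric :: "nat set set \<Rightarrow> cpoly \<Rightarrow> bool" where
  "partially_symmetric \<I> p \<longleftrightarrow>
     (\<forall>\<sigma>. \<sigma> permutes \<Union>\<I> \<and> (\<forall>I\<in>\<I>. \<sigma> ` I = I) \<longrightarrow> subst_vars \<sigma> p = p)"

end

theory Submission
  imports Defs "HOL-Computational_Algebra.Polynomial"
begin

text \<open>
  Adding the boxes of one entry to a tableau is a transfer operator on functions of partitions, and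
  the weight of a tableau is a product of such layers; the remaining factors of \<open>R\<^sub>T\<close> depend only
  on \<open>sh(T\<^sub>1 \<squnion> T\<^sub>2)\<close> and \<open>sh(T\<^sub>2)\<close> and can be distributed over the layers as coboundaries. So it
  suffices that the transfer operators of two entries of the same type commute.

  Up to cocycles, the ordinary and the hyper layer weight are the cases \<open>b = t / q\<close> and \<open>b = 1 / t\<close>
  of one product, and the super case is the ordinary one for transposed diagrams. For generic row
  parameters \<open>y\<^sub>i\<close> in place of \<open>t\<^sup>n\<^sup>-\<^sup>i\<close>, commutation of two layers is an instance of the following
  identity, with one point \<open>q\<^sup>k y\<^sub>i\<close> per box and \<open>a = q\<close>. Let
  \<open>Q(x, y) = (x - a y) (x - b y) / ((x - y) (x - a b y))\<close>. The sum of the products of the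
  \<open>Q(x\<^sub>i, x\<^sub>j)\<close> with \<open>i \<in> I\<close>, \<open>j \<notin> I\<close>, over all \<open>r\<close>-element subsets \<open>I\<close> of \<open>n\<close> indices, does not
  change when \<open>r\<close> is replaced by \<open>n - r\<close>: as functions of the last variable both sides are
  bounded at infinity and, by induction, have the same residues and the same value at \<open>0\<close>. When
  the \<open>y\<^sub>i\<close> tend to \<open>t\<^sup>n\<^sup>-\<^sup>i\<close>, exactly the terms that do not come from tableaux vanish.
\<close>

section \<open>A subset-sum identity\<close>

text \<open>The points cannot be specialised at once: for \<open>y_i = t^(n-i)\<close> two boxes in
  neighbouring rows can satisfy \<open>x = a b x'\<close>, a pole of Q. The layer weights remain
  continuous there, because their denominators do not contain \<open>b\<close>; hence the identity
  is rewritten in terms of layers before the limit is taken. The choice \<open>a = q\<close> does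
  two things. Along a row, Q is a quotient of consecutive values of one function, so a product over
  boxes depends only on the ends of the row. And \<open>Q(q x, x) = 0\<close> removes every subset
  that is not an initial piece of each row, so that subsets become intermediate shapes. The zero of
  \<open>x - b y\<close> between neighbouring rows does the rest: for \<open>b = t / q\<close> it
  enforces the interlacing of horizontal strips, for \<open>b = 1 / t\<close> only that the
  intermediate shape is a partition. Exchanging \<open>r\<close> and \<open>n - r\<close> is
  commutation read coefficientwise: the exponent of one variable counts the boxes of the inner layer
  in one order and of the outer layer in the other.\<close>

definition poly_fun :: "nat \<Rightarrow> (complex \<Rightarrow> complex) \<Rightarrow> bool" where
  "poly_fun d f \<longleftrightarrow> (\<exists>p. degree p \<le> d \<and> (\<forall>z. poly p z = f z))"

lemma poly_fun_linear: "poly_fun 1 (\<lambda>z. c * z + d)"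
  unfolding poly_fun_def by (rule exI[of _ "[:d, c:]"]) (auto simp: algebra_simps)

lemma poly_fun_linear': "poly_fun 1 (\<lambda>z. z - d)" "poly_fun 1 (\<lambda>z. d - z)" "poly_fun 1 (\<lambda>z. d - c * z)"
  using poly_fun_linear[of 1 "-d"] poly_fun_linear[of "-1" d] poly_fun_linear[of "-c" d]
  by (auto simp: algebra_simps)

lemma poly_fun_mult: "poly_fun d f \<Longrightarrow> poly_fun e g \<Longrightarrow> poly_fun (d + e) (\<lambda>z. f z * g z)"
  unfolding poly_fun_def
proof safe
  fix p r assume "degree p \<le> d" "degree r \<le> e" "\<forall>z. poly p z = f z" "\<forall>z. poly r z = g z"
  then show "\<exists>pa. degree pa \<le> d + e \<and> (\<forall>z. poly pa z = f z * g z)"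
    by (intro exI[of _ "p * r"]) (auto intro: degree_mult_le[THEN order_trans])
qed

lemma poly_fun_cmult: "poly_fun d f \<Longrightarrow> poly_fun d (\<lambda>z. c * f z)"
  unfolding poly_fun_def
  by (metis degree_smult_le dual_order.trans poly_smult)

lemma poly_fun_diff: "poly_fun d f \<Longrightarrow> poly_fun d g \<Longrightarrow> poly_fun d (\<lambda>z. f z - g z)"
  unfolding poly_fun_def by (metis degree_diff_le poly_diff)

lemma poly_fun_add: "poly_fun d f \<Longrightarrow> poly_fun d g \<Longrightarrow> poly_fun d (\<lambda>z. f z + g z)"
  unfolding poly_fun_def by (metis degree_add_le poly_add)

lemma poly_fun_sum: "(\<And>i. i \<in> A \<Longrightarrow> poly_fun d (f i)) \<Longrightarrow> poly_fun d (\<lambda>z. \<Sum>i\<in>A. f i z)"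
proof (induction A rule: infinite_finite_induct)
  case (insert x F) then show ?case by (auto intro!: poly_fun_add)
qed (auto simp: poly_fun_def intro!: exI[of _ 0])

lemma poly_fun_prod:
  "finite A \<Longrightarrow> (\<And>i. i \<in> A \<Longrightarrow> poly_fun d (f i)) \<Longrightarrow> poly_fun (d * card A) (\<lambda>z. \<Prod>i\<in>A. f i z)"
proof (induction A rule: finite_induct)
  case (insert x F) then show ?case by (auto intro!: poly_fun_mult)
qed (auto simp: poly_fun_def intro!: exI[of _ 1])

lemma poly_fun_eqI:
  assumes "poly_fun d f" "poly_fun d g" and "finite X" "d < card X" and "\<And>z. z \<in> X \<Longrightarrow> f z = g z"
  shows "f z = g z"
proof -
  obtain p where p: "degree p \<le> d" "\<And>z. poly p z = f z - g z"
    using poly_fun_diff[OF assms(1,2)] unfolding poly_fun_def by blast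
  have "p = 0"
  proof (rule ccontr)
    assume "p \<noteq> 0"
    then have "card X \<le> card {z. poly p z = 0}"
      using assms(5) p(2) by (intro card_mono poly_roots_finite) auto
    also have "\<dots> \<le> d" using card_poly_roots_bound[OF \<open>p \<noteq> 0\<close>] p(1) by linarith
    finally show False using assms(4) by simp
  qed
  then show ?thesis using p(2)[of z] by simp
qed

section \<open>Pair factors and sums over subsets of fixed cardinality\<close>

definition pair_factor :: "complex \<Rightarrow> complex \<Rightarrow> complex \<Rightarrow> complex \<Rightarrow> complex" where
  "pair_factor a b x y = (x - a * y) * (x - b * y) / ((x - y) * (x - a * b * y))"

definition cross_prod :: "('i \<Rightarrow> 'i \<Rightarrow> complex) \<Rightarrow> 'i set \<Rightarrow> 'i set \<Rightarrow> complex" where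
  "cross_prod F A I = (\<Prod>i\<in>I. \<Prod>j\<in>A - I. F i j)"

definition subset_sum :: "('i \<Rightarrow> 'i \<Rightarrow> complex) \<Rightarrow> 'i set \<Rightarrow> nat \<Rightarrow> complex" where
  "subset_sum F A r = (\<Sum>I | I \<subseteq> A \<and> card I = r. cross_prod F A I)"

lemma cross_prod_insert_in:
  assumes "finite A" "m \<notin> A" "I \<subseteq> A"
  shows "cross_prod F (insert m A) (insert m I) = cross_prod F A I * (\<Prod>j\<in>A - I. F m j)"
proof -
  have "insert m A - insert m I = A - I" using assms by auto
  moreover have "finite I" "m \<notin> I" using assms by (auto intro: finite_subset)
  ultimately show ?thesis by (simp add: cross_prod_def mult.commute)
qed

lemma cross_prod_insert_notin:
  assumes "finite A" "m \<notin> A" "I \<subseteq> A"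
  shows "cross_prod F (insert m A) I = cross_prod F A I * (\<Prod>i\<in>I. F i m)"
proof -
  have "insert m A - I = insert m (A - I)" using assms by auto
  moreover have "finite (A - I)" "m \<notin> A - I" using assms by auto
  ultimately show ?thesis by (simp add: cross_prod_def prod.distrib mult.commute)
qed

lemma sum_subsets_insert:
  fixes f :: "'i set \<Rightarrow> 'b :: comm_monoid_add"
  assumes "finite A" "m \<notin> A" "r \<ge> 1"
  shows "(\<Sum>I | I \<subseteq> insert m A \<and> card I = r. f I) =
    (\<Sum>I | I \<subseteq> A \<and> card I = r - 1. f (insert m I)) + (\<Sum>I | I \<subseteq> A \<and> card I = r. f I)"
proof -
  have fin: "finite I" if "I \<subseteq> A" for I using that assms(1) finite_subset by blast
  have eq: "{I. I \<subseteq> insert m A \<and> card I = r} =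
     insert m ` {I. I \<subseteq> A \<and> card I = r - 1} \<union> {I. I \<subseteq> A \<and> card I = r}" (is "?L = ?R")
  proof (rule set_eqI, rule iffI)
    fix I assume I: "I \<in> ?L"
    show "I \<in> ?R"
    proof (cases "m \<in> I")
      case True
      then have "I = insert m (I - {m})" "I - {m} \<subseteq> A" "card (I - {m}) = r - 1"
        using I by auto
      then show ?thesis by blast
    qed (use I in auto)
  next
    fix I assume "I \<in> ?R"
    moreover have "card (insert m J) = r" if "J \<subseteq> A" "card J = r - 1" for J
    proof -
      have "m \<notin> J" using that assms by auto
      then show ?thesis using that fin[of J] assms(3) by simp
    qed
    ultimately show "I \<in> ?L" by auto
  qed
  have "inj_on (insert m) {I. I \<subseteq> A \<and> card I = r - 1}"
  proof (rule inj_onI)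
    fix I J assume "I \<in> {I. I \<subseteq> A \<and> card I = r - 1}" "J \<in> {I. I \<subseteq> A \<and> card I = r - 1}"
      "insert m I = insert m J"
    then show "I = J" using assms(2) by (metis (no_types, lifting) insert_ident mem_Collect_eq subset_iff)
  qed
  moreover have "insert m ` {I. I \<subseteq> A \<and> card I = r - 1} \<inter> {I. I \<subseteq> A \<and> card I = r} = {}"
    using assms(2) by auto
  ultimately show ?thesis
    unfolding eq using assms(1) by (subst sum.union_disjoint) (auto simp: sum.reindex)
qed

lemma subset_sum_0: "finite A \<Longrightarrow> subset_sum F A 0 = 1"
proof -
  assume "finite A"
  then have "{I. I \<subseteq> A \<and> card I = 0} = {{}}" by (auto simp: card_eq_0_iff intro: finite_subset)
  then show ?thesis by (simp add: subset_sum_def cross_prod_def)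
qed

lemma subset_sum_card: "finite A \<Longrightarrow> subset_sum F A (card A) = 1"
proof -
  assume "finite A"
  then have "{I. I \<subseteq> A \<and> card I = card A} = {A}" using card_subset_eq[of A] by blast
  then show ?thesis by (simp add: subset_sum_def cross_prod_def)
qed

text \<open>The assumptions make the points 0, \<open>x m\<close>, \<open>a * b * x m\<close> and
  \<open>x m / (a * b)\<close> pairwise distinct, which are the interpolation nodes below;
  \<open>inj\<close> and \<open>xp\<close> also keep the denominators of the pair factors away from
  0.\<close>

locale generic_points =
  fixes a b :: complex and x :: "'i \<Rightarrow> complex" and A :: "'i set"
  assumes fin: "finite A" and p0: "a * b \<noteq> 0" and inj: "inj_on x A"
    and x0: "i \<in> A \<Longrightarrow> x i \<noteq> 0"
    and xp: "i \<in> A \<Longrightarrow> j \<in> A \<Longrightarrow> x i \<noteq> a * b * x j"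
    and xpp: "i \<in> A \<Longrightarrow> j \<in> A \<Longrightarrow> x i \<noteq> (a * b) * (a * b) * x j"
begin

definition "F i j = pair_factor a b (x i) (x j)"

text \<open>
  \<open>P z r\<close> is the subset sum for \<open>A\<close> and one further variable \<open>z\<close>, multiplied by its common
  denominator \<open>\<Prod>j\<in>A. D z j\<close>; the factors \<open>U\<close> belong to the subsets that contain the index of
  \<open>z\<close>, the factors \<open>V\<close> to the others.
\<close>

definition "D z j = (z - x j) * (z - a * b * x j) * (x j - a * b * z)"

definition "U z I j = (if j \<in> I then D z j else (z - a * x j) * (z - b * x j) * (x j - a * b * z))"
definition "V z I j = (if j \<in> I then (x j - a * z) * (x j - b * z) * (a * b * x j - z) else D z j)"

definition "P z r = (\<Sum>I | I \<subseteq> A \<and> card I = r - 1. cross_prod F A I * (\<Prod>j\<in>A. U z I j))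
   + (\<Sum>I | I \<subseteq> A \<and> card I = r. cross_prod F A I * (\<Prod>j\<in>A. V z I j))"

lemma poly_fun_U: "poly_fun 3 (\<lambda>z. U z I j)"
  unfolding U_def D_def
  using poly_fun_mult[OF poly_fun_mult[OF poly_fun_linear'(1) poly_fun_linear'(1)] poly_fun_linear'(3)]
  by (cases "j \<in> I") (simp_all add: numeral_3_eq_3)

lemma poly_fun_V: "poly_fun 3 (\<lambda>z. V z I j)"
  unfolding V_def D_def
  using poly_fun_mult[OF poly_fun_mult[OF poly_fun_linear'(1) poly_fun_linear'(1)] poly_fun_linear'(3)]
    poly_fun_mult[OF poly_fun_mult[OF poly_fun_linear'(3) poly_fun_linear'(3)] poly_fun_linear'(2)]
  by (cases "j \<in> I") (simp_all add: numeral_3_eq_3)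

lemma poly_fun_P: "poly_fun (3 * card A) (\<lambda>z. P z r)"
  unfolding P_def
  by (intro poly_fun_add poly_fun_sum poly_fun_cmult poly_fun_prod fin poly_fun_U poly_fun_V)

lemma U_eq: "D z j \<noteq> 0 \<Longrightarrow> U z I j = D z j * (if j \<in> I then 1 else pair_factor a b z (x j))"
  by (auto simp: U_def D_def pair_factor_def)

lemma V_eq: 
  assumes "D z j \<noteq> 0"
  shows "V z I j = D z j * (if j \<in> I then pair_factor a b (x j) z else 1)"
proof -
  have "x j - z \<noteq> 0" "x j - a * b * z \<noteq> 0" using assms by (auto simp: D_def)
  then show ?thesis
    by (simp add: V_def D_def pair_factor_def divide_simps) (simp add: algebra_simps)
qed

lemma prod_U:
  assumes "B \<subseteq> A" "\<And>j. j \<in> B \<Longrightarrow> D z j \<noteq> 0"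
  shows "(\<Prod>j\<in>B. U z I j) = (\<Prod>j\<in>B. D z j) * (\<Prod>j\<in>B - I. pair_factor a b z (x j))"
proof -
  have "finite B" using assms fin finite_subset by blast
  have "(\<Prod>j\<in>B. U z I j) = (\<Prod>j\<in>B. D z j * (if j \<in> I then 1 else pair_factor a b z (x j)))"
    using assms(2) by (intro prod.cong) (auto simp: U_eq)
  also have "\<dots> = (\<Prod>j\<in>B. D z j) * (\<Prod>j\<in>B. (if j \<in> - I then pair_factor a b z (x j) else 1))"
    unfolding prod.distrib[symmetric] by (intro prod.cong) auto
  also have "(\<Prod>j\<in>B. (if j \<in> - I then pair_factor a b z (x j) else 1)) = (\<Prod>j\<in>B - I. pair_factor a b z (x j))"
    using \<open>finite B\<close> by (subst prod.inter_restrict[symmetric]) (auto simp: Diff_eq)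
  finally show ?thesis .
qed

lemma prod_V:
  assumes "B \<subseteq> A" "\<And>j. j \<in> B \<Longrightarrow> D z j \<noteq> 0"
  shows "(\<Prod>j\<in>B. V z I j) = (\<Prod>j\<in>B. D z j) * (\<Prod>j\<in>B \<inter> I. pair_factor a b (x j) z)"
proof -
  have "finite B" using assms fin finite_subset by blast
  have "(\<Prod>j\<in>B. V z I j) = (\<Prod>j\<in>B. D z j * (if j \<in> I then pair_factor a b (x j) z else 1))"
    using assms(2) by (intro prod.cong) (auto simp: V_eq)
  also have "\<dots> = (\<Prod>j\<in>B. D z j) * (\<Prod>j\<in>B. (if j \<in> I then pair_factor a b (x j) z else 1))"
    by (simp add: prod.distrib)
  also have "(\<Prod>j\<in>B. (if j \<in> I then pair_factor a b (x j) z else 1)) = (\<Prod>j\<in>B \<inter> I. pair_factor a b (x j) z)"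
    using \<open>finite B\<close> by (subst prod.inter_restrict[symmetric]) auto
  finally show ?thesis .
qed

text \<open>A pair factor is 1 when one argument is 0 and the other is not. The new variable then
  only matters through its membership in the subset, which gives the two terms; replacing
  \<open>r\<close> by its complement interchanges them.\<close>

lemma P_0:
  assumes "1 \<le> r"
  shows "P 0 r = (\<Prod>j\<in>A. a * b * x j ^ 3) * (subset_sum F A (r - 1) + subset_sum F A r)"
proof -
  have "U 0 I j = a * b * x j ^ 3" "V 0 I j = a * b * x j ^ 3" for I j
    by (auto simp: U_def V_def D_def power3_eq_cube)
  then show ?thesis
    by (simp add: P_def subset_sum_def sum_distrib_left sum_distrib_right algebra_simps)
qed

text \<open>Crossing symmetry. At \<open>z = a * b * x m\<close> it turns the factors of
  \<open>z\<close> against the points outside the subset into factors of those points against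
  \<open>x m\<close>; together with the factors of the points inside, they form a product that no
  longer depends on the subset.\<close>

lemma pair_factor_shift_left: "a * b \<noteq> 0 \<Longrightarrow> pair_factor a b (a * b * w) y = pair_factor a b y w"
proof -
  assume "a * b \<noteq> 0"
  have 1: "(a * b * w - a * y) * (a * b * w - b * y) = (a * b) * ((y - a * w) * (y - b * w))"
    by (simp add: algebra_simps)
  have 2: "(a * b * w - y) * (a * b * w - a * b * y) = (a * b) * ((y - w) * (y - a * b * w))"
    by (simp add: algebra_simps)
  show ?thesis unfolding pair_factor_def 1 2 using \<open>a * b \<noteq> 0\<close> by simp
qed

lemma pair_factor_shift_right: "a * b \<noteq> 0 \<Longrightarrow> pair_factor a b y (w / (a * b)) = pair_factor a b w y"
  using pair_factor_shift_left[of "w / (a * b)" y] by simp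


lemma cross_prod_remove:
  assumes "m \<in> A" "I \<subseteq> A - {m}"
  shows "cross_prod F A I = cross_prod F (A - {m}) I * (\<Prod>i\<in>I. F i m)"
    "cross_prod F A (insert m I) = cross_prod F (A - {m}) I * (\<Prod>j\<in>A - {m} - I. F m j)"
  using cross_prod_insert_notin[of "A - {m}" m I F] cross_prod_insert_in[of "A - {m}" m I F] assms fin
  by (auto simp: insert_absorb)

lemma sum_subsets_remove:
  fixes f :: "'i set \<Rightarrow> complex"
  assumes "m \<in> A" "r \<ge> 1" 
  shows "(\<Sum>I | I \<subseteq> A \<and> card I = r. f I) =
    (\<Sum>I | I \<subseteq> A - {m} \<and> card I = r - 1. f (insert m I)) + (\<Sum>I | I \<subseteq> A - {m} \<and> card I = r. f I)"
  using sum_subsets_insert[of "A - {m}" m r f] assms fin by (simp add: insert_absorb)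

lemma sum_subsets_avoid:
  fixes f :: "'i set \<Rightarrow> complex"
  assumes "\<And>I. I \<subseteq> A \<Longrightarrow> m \<in> I \<Longrightarrow> f I = 0" 
  shows "(\<Sum>I | I \<subseteq> A \<and> card I = r. f I) = (\<Sum>I | I \<subseteq> A - {m} \<and> card I = r. f I)"
  by (rule sum.mono_neutral_right) (use fin assms in auto)

text \<open>At a zero of \<open>D z m\<close> a term vanishes when \<open>m\<close> and the index of
  \<open>z\<close> are both in the subset or both outside. The remaining terms contain exactly one
  of the two and are paired by the rest \<open>I\<close> of the subset.\<close>

lemma P_split:
  assumes m: "m \<in> A" and r: "r \<ge> 1" and D: "D z m = 0" 
  shows "P z r = (\<Sum>I | I \<subseteq> A - {m} \<and> card I = r - 1. 
       cross_prod F A I * (\<Prod>j\<in>A. U z I j) + cross_prod F A (insert m I) * (\<Prod>j\<in>A. V z (insert m I) j))"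
proof -
  have 1: "(\<Sum>I | I \<subseteq> A \<and> card I = r - 1. cross_prod F A I * (\<Prod>j\<in>A. U z I j)) =
     (\<Sum>I | I \<subseteq> A - {m} \<and> card I = r - 1. cross_prod F A I * (\<Prod>j\<in>A. U z I j))"
  proof (rule sum_subsets_avoid)
    fix I assume "I \<subseteq> A" "m \<in> I"
    then have "U z I m = 0" using D by (simp add: U_def)
    then show "cross_prod F A I * (\<Prod>j\<in>A. U z I j) = 0" using m fin by auto
  qed
  have "(\<Sum>I | I \<subseteq> A - {m} \<and> card I = r. cross_prod F A I * (\<Prod>j\<in>A. V z I j)) = 0"
  proof (rule sum.neutral, safe)
    fix I assume "I \<subseteq> A - {m}"
    then have "V z I m = 0" using D by (auto simp: V_def)
    then show "cross_prod F A I * (\<Prod>j\<in>A. V z I j) = 0" using m fin by auto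
  qed
  then show ?thesis unfolding P_def 1 by (simp add: sum_subsets_remove[OF m r] sum.distrib)
qed

lemma split_term:
  assumes m: "m \<in> A" and I: "I \<subseteq> A - {m}" and Dj: "\<forall>j\<in>A - {m}. D z j \<noteq> 0"
  shows "cross_prod F A I * (\<Prod>j\<in>A. U z I j) = cross_prod F (A - {m}) I * (\<Prod>j\<in>A - {m}. D z j) *
          (\<Prod>i\<in>I. F i m) * (\<Prod>j\<in>A - {m} - I. pair_factor a b z (x j)) * U z I m" (is ?A)
    and "cross_prod F A (insert m I) * (\<Prod>j\<in>A. V z (insert m I) j) = cross_prod F (A - {m}) I * (\<Prod>j\<in>A - {m}. D z j) *
          (\<Prod>i\<in>I. pair_factor a b (x i) z) * (\<Prod>j\<in>A - {m} - I. F m j) * V z (insert m I) m" (is ?B)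
proof -
  have *: "(A - {m}) \<inter> insert m I = I" using I by auto
  show ?A using prod_U[of "A - {m}" z I] Dj
    by (simp add: prod.remove[OF fin m] cross_prod_remove[OF m I])
  show ?B using prod_V[of "A - {m}" z "insert m I"] Dj
    by (simp add: prod.remove[OF fin m] cross_prod_remove[OF m I] *)
qed

lemma prod_split_Diff: "I \<subseteq> B \<Longrightarrow> finite B \<Longrightarrow> (\<Prod>i\<in>I. f i) * (\<Prod>i\<in>B - I. f i) = (\<Prod>i\<in>B. (f i :: complex))"
  by (simp add: prod.subset_diff mult.commute)

lemma D_nz:
  assumes "m \<in> A" "j \<in> A - {m}"
  shows "D (x m) j \<noteq> 0" "D (a * b * x m) j \<noteq> 0" "D (x m / (a * b)) j \<noteq> 0"
proof -
  have ne: "x j \<noteq> x m" "x m \<noteq> x j" using inj assms by (auto dest: inj_onD)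
  have jm: "j \<in> A" using assms by auto
  note g = xp[OF jm assms(1)] xp[OF assms(1) jm] xpp[OF jm assms(1)] xpp[OF assms(1) jm]
  show "D (x m) j \<noteq> 0" using ne g by (auto simp: D_def)
  show "D (a * b * x m) j \<noteq> 0" using ne g p0 by (auto simp: D_def)
  show "D (x m / (a * b)) j \<noteq> 0" using ne g p0 by (auto simp: D_def eq_divide_eq divide_eq_eq mult_ac)
qed

text \<open>The pole at \<open>z = x m\<close> is only apparent: interchanging the roles of
  \<open>m\<close> and of the index of \<open>z\<close> changes the sign of the residue, so the
  paired terms cancel.\<close>

lemma P_at_x:
  assumes m: "m \<in> A" and r: "r \<ge> 1"
  shows "P (x m) r = 0"
proof -
  have "D (x m) m = 0" by (simp add: D_def)
  note P_split[OF m r this]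
  also have "(\<Sum>I | I \<subseteq> A - {m} \<and> card I = r - 1. 
       cross_prod F A I * (\<Prod>j\<in>A. U (x m) I j) + cross_prod F A (insert m I) * (\<Prod>j\<in>A. V (x m) (insert m I) j)) = 0"
  proof (rule sum.neutral, safe)
    fix I assume I: "I \<subseteq> A - {m}"
    have Dj: "\<forall>j\<in>A - {m}. D (x m) j \<noteq> 0" using D_nz(1)[OF m] by blast
    have "U (x m) I m = - V (x m) (insert m I) m" using I by (auto simp: U_def V_def algebra_simps)
    then show "cross_prod F A I * (\<Prod>j\<in>A. U (x m) I j) + cross_prod F A (insert m I) * (\<Prod>j\<in>A. V (x m) (insert m I) j) = 0"
      unfolding split_term[OF m I Dj] by (simp add: F_def)
  qed
  finally show ?thesis .
qed

text \<open>The \<open>V\<close> term of each pair contains the factor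
  \<open>a * b * x m - z = 0\<close>. In the other one crossing symmetry makes everything except
  \<open>cross_prod F (A - {m}) I\<close> independent of \<open>I\<close>, so the value reduces to a
  subset sum with one point fewer.\<close>

lemma P_at_px:
  assumes m: "m \<in> A" and r: "r \<ge> 1"
  shows "P (a * b * x m) r = (\<Prod>j\<in>A - {m}. D (a * b * x m) j) * (\<Prod>i\<in>A - {m}. F i m) * U (a * b * x m) {} m
     * subset_sum F (A - {m}) (r - 1)"
proof -
  let ?z = "a * b * x m"
  have "D ?z m = 0" by (simp add: D_def)
  note P_split[OF m r this]
  also have "(\<Sum>I | I \<subseteq> A - {m} \<and> card I = r - 1. 
       cross_prod F A I * (\<Prod>j\<in>A. U ?z I j) + cross_prod F A (insert m I) * (\<Prod>j\<in>A. V ?z (insert m I) j)) = 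
      (\<Sum>I | I \<subseteq> A - {m} \<and> card I = r - 1. (\<Prod>j\<in>A - {m}. D ?z j) * (\<Prod>i\<in>A - {m}. F i m) * U ?z {} m * cross_prod F (A - {m}) I)"
  proof (rule sum.cong, rule refl, safe)
    fix I assume I: "I \<subseteq> A - {m}"
    have Dj: "\<forall>j\<in>A - {m}. D ?z j \<noteq> 0" using D_nz(2)[OF m] by blast
    have 1: "U ?z I m = U ?z {} m" using I by (auto simp: U_def)
    have 2: "V ?z (insert m I) m = 0" by (simp add: V_def)
    have 3: "pair_factor a b ?z (x j) = F j m" for j
      unfolding F_def by (rule pair_factor_shift_left[OF p0])
    have 4: "(\<Prod>i\<in>A - {m}. F i m) = (\<Prod>i\<in>I. F i m) * (\<Prod>i\<in>A - {m} - I. F i m)"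
      using I fin by (intro prod_split_Diff[symmetric]) auto
    show "cross_prod F A I * (\<Prod>j\<in>A. U ?z I j) + cross_prod F A (insert m I) * (\<Prod>j\<in>A. V ?z (insert m I) j) = 
       (\<Prod>j\<in>A - {m}. D ?z j) * (\<Prod>i\<in>A - {m}. F i m) * U ?z {} m * cross_prod F (A - {m}) I"
      unfolding split_term[OF m I Dj] by (simp add: 1 2 3 4)
  qed
  finally show ?thesis unfolding subset_sum_def by (simp add: sum_distrib_left)
qed

text \<open>The mirror image: here the \<open>U\<close> term vanishes, so \<open>m\<close> lies in
  the subset and the index of \<open>z\<close> outside.\<close>

lemma P_at_x_over_p:
  assumes m: "m \<in> A" and r: "r \<ge> 1"
  shows "P (x m / (a * b)) r = (\<Prod>j\<in>A - {m}. D (x m / (a * b)) j) * (\<Prod>j\<in>A - {m}. F m j) * V (x m / (a * b)) {m} m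
     * subset_sum F (A - {m}) (r - 1)"
proof -
  let ?z = "x m / (a * b)"
  have pz: "a * b * ?z = x m" using p0 by simp
  have "D ?z m = 0" using pz by (simp add: D_def)
  note P_split[OF m r this]
  also have "(\<Sum>I | I \<subseteq> A - {m} \<and> card I = r - 1. 
       cross_prod F A I * (\<Prod>j\<in>A. U ?z I j) + cross_prod F A (insert m I) * (\<Prod>j\<in>A. V ?z (insert m I) j)) = 
      (\<Sum>I | I \<subseteq> A - {m} \<and> card I = r - 1. (\<Prod>j\<in>A - {m}. D ?z j) * (\<Prod>j\<in>A - {m}. F m j) * V ?z {m} m * cross_prod F (A - {m}) I)"
  proof (rule sum.cong, rule refl, safe)
    fix I assume I: "I \<subseteq> A - {m}"
    have Dj: "\<forall>j\<in>A - {m}. D ?z j \<noteq> 0" using D_nz(3)[OF m] by blast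
    have 1: "V ?z (insert m I) m = V ?z {m} m" by (auto simp: V_def)
    have 2: "U ?z I m = 0" using I pz by (auto simp: U_def)
    have 3: "pair_factor a b (x j) ?z = F m j" for j
      unfolding F_def by (rule pair_factor_shift_right[OF p0])
    have 4: "(\<Prod>j\<in>A - {m}. F m j) = (\<Prod>j\<in>I. F m j) * (\<Prod>j\<in>A - {m} - I. F m j)"
      using I fin by (intro prod_split_Diff[symmetric]) auto
    show "cross_prod F A I * (\<Prod>j\<in>A. U ?z I j) + cross_prod F A (insert m I) * (\<Prod>j\<in>A. V ?z (insert m I) j) = 
       (\<Prod>j\<in>A - {m}. D ?z j) * (\<Prod>j\<in>A - {m}. F m j) * V ?z {m} m * cross_prod F (A - {m}) I"
      unfolding split_term[OF m I Dj] by (simp add: 1 2 3 4)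
  qed
  finally show ?thesis unfolding subset_sum_def by (simp add: sum_distrib_left)
qed

lemma generic_points_subset: "B \<subseteq> A \<Longrightarrow> generic_points a b x B"
proof unfold_locales
  assume B: "B \<subseteq> A"
  show "finite B" "a * b \<noteq> 0" "inj_on x B" using B fin p0 inj by (auto intro: finite_subset inj_on_subset)
  show "x i \<noteq> 0" if "i \<in> B" for i using x0 that B by blast
  show "x i \<noteq> a * b * x j" "x i \<noteq> (a * b) * (a * b) * x j" if "i \<in> B" "j \<in> B" for i j
    using xp xpp that B by blast+
qed

text \<open>One node more than the degree bound \<open>3 * card A\<close> of \<open>P\<close>. The
  nodes other than 0 are the possible poles before denominators are cleared; the node 0 fixes the
  remaining constant.\<close>

lemma card_nodes:
  "card ({0} \<union> x ` A \<union> (\<lambda>m. a * b * x m) ` A \<union> (\<lambda>m. x m / (a * b)) ` A) = 3 * card A + 1"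
proof -
  have i2: "inj_on (\<lambda>m. a * b * x m) A" and i3: "inj_on (\<lambda>m. x m / (a * b)) A"
    using inj p0 by (auto simp: inj_on_def)
  have 1: "({0} \<union> x ` A) \<inter> (\<lambda>m. a * b * x m) ` A = {}" using xp p0 x0 by auto
  have 2: "{0} \<inter> x ` A = {}" using x0 by auto
  have 4: "x j / (a * b) \<noteq> x i" "x j / (a * b) \<noteq> a * b * x i" if "i \<in> A" "j \<in> A" for i j
    using xp[OF that(2,1)] xpp[OF that(2,1)] p0 by (auto simp: divide_eq_eq mult_ac)
  have 3: "({0} \<union> x ` A \<union> (\<lambda>m. a * b * x m) ` A) \<inter> (\<lambda>m. x m / (a * b)) ` A = {}"
    using x0 p0 4 by auto
  show ?thesis using fin 1 2 3 by (simp add: card_Un_disjoint card_image inj i2 i3 del: Un_insert_left)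
qed

lemma subset_sum_insert:
  assumes n: "n \<notin> A" and r: "r \<ge> 1" and D: "\<And>j. j \<in> A \<Longrightarrow> D (x n) j \<noteq> 0"
  shows "(\<Prod>j\<in>A. D (x n) j) * subset_sum F (insert n A) r = P (x n) r"
proof -
  have "cross_prod F (insert n A) (insert n I) * (\<Prod>j\<in>A. D (x n) j) = cross_prod F A I * (\<Prod>j\<in>A. U (x n) I j)" 
    if "I \<subseteq> A" for I
    using that prod_U[of A "x n" I] D by (simp add: cross_prod_insert_in fin n F_def)
  moreover have "cross_prod F (insert n A) I * (\<Prod>j\<in>A. D (x n) j) = cross_prod F A I * (\<Prod>j\<in>A. V (x n) I j)" 
    if "I \<subseteq> A" for I
  proof -
    have "A \<inter> I = I" using that by auto
    then show ?thesis using that prod_V[of A "x n" I] D by (simp add: cross_prod_insert_notin fin n F_def)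
  qed
  ultimately show ?thesis unfolding subset_sum_def P_def sum_subsets_insert[OF fin n r]
    by (simp add: distrib_left sum_distrib_left mult.commute[of "\<Prod>j\<in>A. D (x n) j"])
qed

end

text \<open>The point \<open>x n\<close> is replaced by a variable \<open>z\<close>, and both sides
  are compared as polynomials in \<open>z\<close>. The induction is strong because the nodes
  \<open>a * b * x m\<close> and \<open>x m / (a * b)\<close> remove two points, \<open>n\<close>
  and \<open>m\<close>, at once.\<close>

theorem subset_sum_symmetric:
  assumes "generic_points a b x A" and "r \<le> card A"
  shows "subset_sum (\<lambda>i j. pair_factor a b (x i) (x j)) A r =
     subset_sum (\<lambda>i j. pair_factor a b (x i) (x j)) A (card A - r)"
  using assms
proof (induction "card A" arbitrary: A r rule: less_induct)
  case less
  let ?F = "\<lambda>i j. pair_factor a b (x i) (x j)"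
  interpret G: generic_points a b x A by fact
  note fin = G.fin
  consider "r = 0" | "r = card A" | "1 \<le> r" "r < card A" using less.prems(2) by linarith
  then show ?case
  proof cases
    case 3
    then obtain n where n: "n \<in> A" by fastforce
    define B where "B = A - {n}"
    have B: "finite B" "n \<notin> B" "A = insert n B" "card A = card B + 1" "B \<subseteq> A"
      using n fin card_Suc_Diff1[OF fin n] by (auto simp: B_def insert_absorb)
    interpret GB: generic_points a b x B using G.generic_points_subset[OF B(5)] .
    have F: "GB.F = ?F" by (simp add: GB.F_def fun_eq_iff)
    let ?s = "card A - r"
    have s: "1 \<le> ?s" "r \<le> card B" "?s \<le> card B" using 3 B by auto
    have eq: "GB.P z r = GB.P z ?s" for z
    proof (rule poly_fun_eqI[OF GB.poly_fun_P GB.poly_fun_P])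
      let ?X = "{0} \<union> x ` B \<union> (\<lambda>m. a * b * x m) ` B \<union> (\<lambda>m. x m / (a * b)) ` B"
      show "finite ?X" using B by simp
      show "3 * card B < card ?X" using GB.card_nodes by simp
      fix z assume "z \<in> ?X"
      then consider "z = 0" | m where "m \<in> B" "z = x m" | m where "m \<in> B" "z = a * b * x m" 
        | m where "m \<in> B" "z = x m / (a * b)" by blast
      then show "GB.P z r = GB.P z ?s"
      proof cases
        case 1
        have "subset_sum ?F B (r - 1) = subset_sum ?F B (card B - (r - 1))"
          by (rule less.hyps) (use B 3 GB.generic_points_axioms in auto)
        moreover have "card B - (r - 1) = ?s" using B 3 by simp
        moreover have "subset_sum ?F B r = subset_sum ?F B (card B - r)"
          by (rule less.hyps) (use B 3 GB.generic_points_axioms in auto)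
        moreover have "card B - r = ?s - 1" using B 3 by simp
        ultimately show ?thesis unfolding 1 GB.P_0[OF 3(1)] GB.P_0[OF s(1)] F by simp
      next
        case 2
        then show ?thesis using GB.P_at_x 3 s by simp
      next
        case (3 m)
        have "subset_sum ?F (B - {m}) (r - 1) = subset_sum ?F (B - {m}) (card (B - {m}) - (r - 1))"
          by (rule less.hyps) (use B \<open>m \<in> B\<close> \<open>1 \<le> r\<close> s GB.generic_points_subset in auto)
        moreover have "card (B - {m}) - (r - 1) = ?s - 1" using B \<open>m \<in> B\<close> \<open>1 \<le> r\<close> by simp
        ultimately show ?thesis unfolding 3 GB.P_at_px[OF 3(1) \<open>1 \<le> r\<close>] GB.P_at_px[OF 3(1) s(1)] F by simp
      next
        case (4 m)
        have "subset_sum ?F (B - {m}) (r - 1) = subset_sum ?F (B - {m}) (card (B - {m}) - (r - 1))"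
          by (rule less.hyps) (use B \<open>m \<in> B\<close> \<open>1 \<le> r\<close> s GB.generic_points_subset in auto)
        moreover have "card (B - {m}) - (r - 1) = ?s - 1" using B \<open>m \<in> B\<close> \<open>1 \<le> r\<close> by simp
        ultimately show ?thesis unfolding 4 GB.P_at_x_over_p[OF 4(1) \<open>1 \<le> r\<close>] GB.P_at_x_over_p[OF 4(1) s(1)] F by simp
      qed
    qed
    have D: "GB.D (x n) j \<noteq> 0" if "j \<in> B" for j 
      using G.D_nz(1)[OF n, of j] that by (simp add: B_def G.D_def GB.D_def)
    have "(\<Prod>j\<in>B. GB.D (x n) j) * subset_sum ?F A r = (\<Prod>j\<in>B. GB.D (x n) j) * subset_sum ?F A ?s"
      using GB.subset_sum_insert[OF B(2) 3(1) D] GB.subset_sum_insert[OF B(2) s(1) D] eq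
      unfolding F B(3)[symmetric] by simp
    moreover have "(\<Prod>j\<in>B. GB.D (x n) j) \<noteq> 0" using D B by simp
    ultimately show ?thesis by simp
  qed (auto simp: subset_sum_0 subset_sum_card fin)
qed

section \<open>Specialisation to rows of boxes\<close>

lemma prod_telescope_quot:
  fixes f :: "nat \<Rightarrow> complex"
  assumes "a \<le> c" "\<And>m. a \<le> m \<Longrightarrow> m \<le> c \<Longrightarrow> f m \<noteq> 0"
  shows "(\<Prod>m=a..<c. f (Suc m) / f m) = f c / f a" "(\<Prod>m=a..<c. f m / f (Suc m)) = f a / f c"
  using assms by (induction c rule: dec_induct) auto

text \<open>Each quotient on the left is a telescoping product over \<open>m\<close>. By shift
  invariance its factors are also quotients in the direction of \<open>k\<close>, and these
  telescope after the two products are interchanged. The corner \<open>m = c\<close>,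
  \<open>k = e\<close> is exempt from \<open>nz\<close>, since in the application \<open>g\<close>
  has a zero denominator there when the two rows coincide.\<close>

lemma prod_rectangle_exchange:
  fixes g :: "nat \<Rightarrow> nat \<Rightarrow> complex"
  assumes "a \<le> c" "e \<le> d" and shift: "\<And>m k. g (Suc m) (Suc k) = g m k"
    and nz: "\<And>m k. a \<le> m \<Longrightarrow> m \<le> c \<Longrightarrow> e \<le> k \<Longrightarrow> k \<le> d \<Longrightarrow> m < c \<or> e < k \<Longrightarrow> g m k \<noteq> 0"
  shows "(\<Prod>k=e..<d. g c (Suc k) / g a (Suc k)) = (\<Prod>m=a..<c. g m e / g m d)"
proof -
  have "(\<Prod>k=e..<d. g c (Suc k) / g a (Suc k)) = (\<Prod>k=e..<d. \<Prod>m=a..<c. g (Suc m) (Suc k) / g m (Suc k))"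
    by (intro prod.cong refl prod_telescope_quot(1)[symmetric] assms) auto
  also have "\<dots> = (\<Prod>m=a..<c. \<Prod>k=e..<d. g m k / g m (Suc k))"
    unfolding shift by (rule prod.swap)
  also have "\<dots> = (\<Prod>m=a..<c. g m e / g m d)"
    by (intro prod.cong refl prod_telescope_quot(2) assms) auto
  finally show ?thesis .
qed

lemma prod_Sigma_iterated:
  "finite A \<Longrightarrow> (\<And>i. i \<in> A \<Longrightarrow> finite (B i)) \<Longrightarrow> (\<Prod>s\<in>Sigma A B. f s) = (\<Prod>i\<in>A. \<Prod>k\<in>B i. f (i, k))"
  by (simp add: prod.Sigma split_def)

section \<open>Layer weights for arbitrary row parameters\<close>

locale rows =
  fixes q b :: complex and y :: "nat \<Rightarrow> complex" and n :: nat
begin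

text \<open>The telescoping potential of the pair factor: for \<open>X = q ^ k * y i\<close> and
  \<open>Y = q ^ m * y j\<close>, cancellation gives
  \<open>pair_factor q b X Y = g i j k m / g i j k (Suc m)\<close> where the denominators do not
  vanish.\<close>

definition g :: "nat \<Rightarrow> nat \<Rightarrow> nat \<Rightarrow> nat \<Rightarrow> complex" where
  "g i j k m = (q ^ k * y i - b * q ^ m * y j) / (q ^ k * y i - q ^ m * y j)"

text \<open>
  The layer weight for row parameters \<open>y\<close>. Only pairs of rows \<open>i \<le> j\<close> occur in it, but
  in a product of two layers the shift invariance of \<open>g\<close> turns the \<open>i \<le> j\<close> factors
  into the missing ones \<open>T j i\<close> of the cross product.
\<close>

definition layer :: "parts \<Rightarrow> parts \<Rightarrow> complex" where
  "layer la mu = (\<Prod>i=1..n. \<Prod>j=1..n.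
      (if i \<le> j then \<Prod>k=mu i..<la i. g j i (mu j) (Suc k) else 1) *
      (if i < j then \<Prod>k=mu i..<la i. g i j k (la j) else 1))"

text \<open>The boxes of \<open>nu / mu\<close> in row \<open>i\<close> against those of
  \<open>la / nu\<close> in row \<open>j\<close>, with the product along row \<open>j\<close>
  already telescoped.\<close>

definition T :: "parts \<Rightarrow> parts \<Rightarrow> parts \<Rightarrow> nat \<Rightarrow> nat \<Rightarrow> complex" where
  "T la mu nu i j = (\<Prod>k=mu i..<nu i. g i j k (nu j) / g i j k (la j))"

definition size_rows :: "parts \<Rightarrow> nat" where
  "size_rows p = (\<Sum>i=1..n. p i)"

text \<open>Columns are counted from 0 here, so the skew row from \<open>mu i\<close> to
  \<open>la i\<close> is a half-open interval. The shapes need not be partitions.\<close>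

definition row_boxes :: "parts \<Rightarrow> parts \<Rightarrow> (nat \<times> nat) set" where
  "row_boxes la mu = Sigma {1..n} (\<lambda>i. {mu i..<la i})"

definition x :: "nat \<times> nat \<Rightarrow> complex" where "x s = q ^ snd s * y (fst s)"

end

text \<open>The column bound \<open>K\<close> leaves only finitely many conditions, so that all of
  them can hold simultaneously near the special parameters.\<close>

locale generic_rows = rows +
  fixes K :: nat
  assumes q0: "q \<noteq> 0" and b0: "b \<noteq> 0"
    and y0: "i \<in> {1..n} \<Longrightarrow> y i \<noteq> 0"
    and g1: "i \<in> {1..n} \<Longrightarrow> j \<in> {1..n} \<Longrightarrow> k \<le> K \<Longrightarrow> m \<le> K \<Longrightarrow> q ^ k * y i = q ^ m * y j \<Longrightarrow> i = j \<and> k = m"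
    and gb: "i \<in> {1..n} \<Longrightarrow> j \<in> {1..n} \<Longrightarrow> k \<le> K \<Longrightarrow> m \<le> K \<Longrightarrow> q ^ k * y i \<noteq> b * q ^ m * y j"
    and gp: "i \<in> {1..n} \<Longrightarrow> j \<in> {1..n} \<Longrightarrow> k \<le> K \<Longrightarrow> m \<le> K \<Longrightarrow> q ^ k * y i \<noteq> q * b * (q ^ m * y j)"
    and gpp: "i \<in> {1..n} \<Longrightarrow> j \<in> {1..n} \<Longrightarrow> k \<le> K \<Longrightarrow> m \<le> K \<Longrightarrow> q ^ k * y i \<noteq> (q * b) * (q * b) * (q ^ m * y j)"
begin

lemma g_nz: "i \<in> {1..n} \<Longrightarrow> j \<in> {1..n} \<Longrightarrow> k \<le> K \<Longrightarrow> m \<le> K \<Longrightarrow> i \<noteq> j \<or> k \<noteq> m \<Longrightarrow> g i j k m \<noteq> 0"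
  using g1[of i j k m] gb[of i j k m] by (auto simp: g_def)

lemma g_shift: "g i j (Suc k) (Suc m) = g i j k m"
proof -
  have "g i j (Suc k) (Suc m) = (q * (q ^ k * y i - b * q ^ m * y j)) / (q * (q ^ k * y i - q ^ m * y j))"
    by (simp add: g_def algebra_simps)
  then show ?thesis using q0 by (simp add: g_def)
qed

context
  fixes la mu nu :: parts
  assumes le: "mu \<le> nu" "nu \<le> la" and K: "\<And>i. la i \<le> K"
begin

lemma bounds: "mu i \<le> nu i" "nu i \<le> la i" "mu i \<le> K" "nu i \<le> K"
proof -
  show "mu i \<le> nu i" "nu i \<le> la i" using le by (auto simp: le_fun_def)
  then show "nu i \<le> K" "mu i \<le> K" using K[of i] by linarith+
qed

lemma split_prod: "(\<Prod>k=mu i..<la i. f k) = (\<Prod>k=mu i..<nu i. f k) * (\<Prod>k=nu i..<la i. f k :: complex)"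
  using bounds by (simp add: prod.atLeastLessThan_concat)

lemma layer_g_part:
  assumes "i \<in> {1..n}" "j \<in> {1..n}" "i < j"
  shows "(\<Prod>k=nu i..<la i. g i j k (la j)) * (\<Prod>k=mu i..<nu i. g i j k (nu j)) =
    (\<Prod>k=mu i..<la i. g i j k (la j)) * T la mu nu i j"
proof -
  have "(\<Prod>k=mu i..<nu i. g i j k (la j)) \<noteq> 0"
    using bounds[of i] K[of j] assms g_nz[OF assms(1,2)] by (auto simp: prod_zero_iff)
  then show ?thesis unfolding T_def split_prod prod_dividef by simp
qed

text \<open>The quotient of the two sides before \<open>T\<close> enters runs over the boxes of
  \<open>la / nu\<close> in row \<open>i\<close>, whereas \<open>T la mu nu j i\<close> runs over
  those of \<open>nu / mu\<close> in row \<open>j\<close>. The rectangle exchange converts one into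
  the other.\<close>

lemma layer_h_part:
  assumes "i \<in> {1..n}" "j \<in> {1..n}" "i \<le> j"
  shows "(\<Prod>k=nu i..<la i. g j i (nu j) (Suc k)) * (\<Prod>k=mu i..<nu i. g j i (mu j) (Suc k)) =
    (\<Prod>k=mu i..<la i. g j i (mu j) (Suc k)) * T la mu nu j i"
proof -
  have nz: "g j i m k \<noteq> 0" if "mu j \<le> m" "m \<le> nu j" "nu i \<le> k" "k \<le> la i" "m < nu j \<or> nu i < k" for m k
    using that bounds[of i] bounds[of j] K[of i] K[of j] assms by (intro g_nz) auto
  have "g j i (mu j) (Suc k) \<noteq> 0" if "k \<in> {nu i..<la i}" for k
    by (rule nz) (use bounds[of j] that in auto)
  then have 0: "(\<Prod>k=nu i..<la i. g j i (mu j) (Suc k)) \<noteq> 0" by simp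
  have "T la mu nu j i = (\<Prod>k=nu i..<la i. g j i (nu j) (Suc k) / g j i (mu j) (Suc k))"
    unfolding T_def by (rule prod_rectangle_exchange[symmetric]) (use bounds nz g_shift in auto)
  then show ?thesis unfolding split_prod prod_dividef using 0 by simp
qed

text \<open>For \<open>i < j\<close> the two kinds of factors supply \<open>T i j\<close> and
  \<open>T j i\<close>; for \<open>i = j\<close> only the second kind is present and supplies
  \<open>T i i\<close>. So each ordered pair of rows occurs exactly once.\<close>

lemma layer_mult:
  "layer la nu * layer nu mu = layer la mu * (\<Prod>i=1..n. \<Prod>j=1..n. T la mu nu i j)"
proof -
  have 1: "(if i \<le> j then \<Prod>k=nu i..<la i. g j i (nu j) (Suc k) else 1) *
      (if i < j then \<Prod>k=nu i..<la i. g i j k (la j) else 1) *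
      ((if i \<le> j then \<Prod>k=mu i..<nu i. g j i (mu j) (Suc k) else 1) *
      (if i < j then \<Prod>k=mu i..<nu i. g i j k (nu j) else 1)) =
      (if i \<le> j then \<Prod>k=mu i..<la i. g j i (mu j) (Suc k) else 1) *
      (if i < j then \<Prod>k=mu i..<la i. g i j k (la j) else 1) *
      ((if i \<le> j then T la mu nu j i else 1) * (if i < j then T la mu nu i j else 1))"
    if "i \<in> {1..n}" "j \<in> {1..n}" for i j
    using layer_g_part[OF that] layer_h_part[OF that] by (auto simp: algebra_simps)
  have 2: "(\<Prod>i=1..n. \<Prod>j=1..n. (if i \<le> j then T la mu nu j i else 1) * (if i < j then T la mu nu i j else 1))
    = (\<Prod>i=1..n. \<Prod>j=1..n. T la mu nu i j)"
  proof -
    have "(\<Prod>i=1..n. \<Prod>j=1..n. (if i \<le> j then T la mu nu j i else 1)) =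
      (\<Prod>j=1..n. \<Prod>i=1..n. (if i \<le> j then T la mu nu j i else 1))" by (rule prod.swap)
    then show ?thesis
      unfolding prod.distrib by (simp add: prod.distrib[symmetric]) (intro prod.cong refl; auto)
  qed
  show ?thesis
    unfolding layer_def 2[symmetric] prod.distrib[symmetric]
    by (intro prod.cong refl 1) auto
qed

lemma row_boxes_diff: "row_boxes la mu - row_boxes nu mu = row_boxes la nu"
  using bounds by (auto simp: row_boxes_def intro: order_trans) (meson not_le order_trans)

lemma row_boxes_mono: "row_boxes nu mu \<subseteq> row_boxes la mu"
  using bounds by (force simp: row_boxes_def intro: less_le_trans)

lemma card_row_boxes: "card (row_boxes nu mu) = size_rows nu - size_rows mu"
proof -
  have "card (row_boxes nu mu) = (\<Sum>i=1..n. nu i - mu i)" by (simp add: row_boxes_def)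
  also have "\<dots> = size_rows nu - size_rows mu"
    unfolding size_rows_def by (rule sum_subtractf_nat) (use bounds in auto)
  finally show ?thesis .
qed

lemma cross_prod_rows:
  "cross_prod (\<lambda>s s'. pair_factor q b (x s) (x s')) (row_boxes la mu) (row_boxes nu mu) =
    (\<Prod>i=1..n. \<Prod>j=1..n. T la mu nu i j)"
proof -
  let ?pf = "\<lambda>i k j m. pair_factor q b (q ^ k * y i) (q ^ m * y j)"
  have tele: "(\<Prod>m=nu j..<la j. ?pf i k j m) = g i j k (nu j) / g i j k (la j)"
    if "i \<in> {1..n}" "j \<in> {1..n}" "k \<in> {mu i..<nu i}" for i j k
  proof -
    have "k < nu i" "k \<le> K" using that bounds[of i] by auto
    have nz: "q ^ k * y i - q ^ m * y j \<noteq> 0" "q ^ k * y i - b * q ^ m * y j \<noteq> 0" 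
      if "nu j \<le> m" "m \<le> la j" for m
      using that g1[OF \<open>i \<in> _\<close> \<open>j \<in> _\<close> \<open>k \<le> K\<close>, of m] gb[OF \<open>i \<in> _\<close> \<open>j \<in> _\<close> \<open>k \<le> K\<close>, of m] K[of j] \<open>k < nu i\<close>
      by auto
    have "(\<Prod>m=nu j..<la j. ?pf i k j m) = (\<Prod>m=nu j..<la j. g i j k m / g i j k (Suc m))"
    proof (intro prod.cong refl)
      fix m assume m: "m \<in> {nu j..<la j}"
      show "?pf i k j m = g i j k m / g i j k (Suc m)"
        by (simp add: pair_factor_def g_def mult_ac)
    qed
    also have "\<dots> = g i j k (nu j) / g i j k (la j)"
      by (rule prod_telescope_quot(2)) (use bounds[of j] nz in \<open>auto simp: g_def\<close>)
    finally show ?thesis .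
  qed
  have "cross_prod (\<lambda>s s'. pair_factor q b (x s) (x s')) (row_boxes la mu) (row_boxes nu mu) =
    (\<Prod>i=1..n. \<Prod>k=mu i..<nu i. \<Prod>j=1..n. \<Prod>m=nu j..<la j. ?pf i k j m)"
    unfolding cross_prod_def row_boxes_diff unfolding row_boxes_def x_def
    by (simp add: prod_Sigma_iterated)
  also have "\<dots> = (\<Prod>i=1..n. \<Prod>k=mu i..<nu i. \<Prod>j=1..n. g i j k (nu j) / g i j k (la j))"
    by (intro prod.cong refl tele)
  also have "\<dots> = (\<Prod>i=1..n. \<Prod>j=1..n. T la mu nu i j)"
    unfolding T_def by (intro prod.cong refl prod.swap)
  finally show ?thesis .
qed

end

lemma generic_points_rows:
  assumes "\<And>i. la i \<le> K"
  shows "generic_points q b x (row_boxes la mu)"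
proof unfold_locales
  show "finite (row_boxes la mu)" by (simp add: row_boxes_def)
  show "q * b \<noteq> 0" using q0 b0 by simp
  have *: "fst s \<in> {1..n}" "snd s \<le> K" if "s \<in> row_boxes la mu" for s
    using that assms[of "fst s"] by (auto simp: row_boxes_def)
  show "inj_on x (row_boxes la mu)"
    using g1 * by (intro inj_onI) (metis prod.expand x_def)
  show "x s \<noteq> 0" if "s \<in> row_boxes la mu" for s
    using *[OF that] q0 y0 by (simp add: x_def)
  show "x s \<noteq> q * b * x s'" "x s \<noteq> q * b * (q * b) * x s'" if "s \<in> row_boxes la mu" "s' \<in> row_boxes la mu" for s s'
    using *[OF that(1)] *[OF that(2)] gp gpp by (auto simp: x_def)
qed

text \<open>A subset with nonzero cross product contains \<open>(i, k)\<close> along with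
  \<open>(i, Suc k)\<close> whenever \<open>mu i \<le> k\<close>, because
  \<open>pair_factor q b\<close> vanishes at \<open>(q * z, z)\<close>. Hence it is
  \<open>row_boxes nu mu\<close> for some \<open>nu\<close> between \<open>mu\<close> and
  \<open>la\<close>, which need not be decreasing.\<close>

lemma subset_sum_rows:
  assumes le: "mu \<le> la" and K: "\<And>i. la i \<le> K" and out: "\<And>i. i \<notin> {1..n} \<Longrightarrow> la i = 0"
  shows "subset_sum (\<lambda>s s'. pair_factor q b (x s) (x s')) (row_boxes la mu) r =
    (\<Sum>nu | nu \<in> {mu..la} \<and> size_rows nu - size_rows mu = r. \<Prod>i=1..n. \<Prod>j=1..n. T la mu nu i j)"
proof -
  let ?F = "\<lambda>s s'. pair_factor q b (x s) (x s')"
  let ?N = "{nu \<in> {mu..la}. size_rows nu - size_rows mu = r}"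
  let ?f = "\<lambda>nu. row_boxes nu mu"
  let ?S = "{I. I \<subseteq> row_boxes la mu \<and> card I = r}"
  have N: "mu \<le> nu" "nu \<le> la" "nu i \<le> la i" "mu i \<le> nu i" "mu i \<le> la i" if "nu \<in> ?N" for nu i
    using that by (auto simp: le_fun_def intro: order_trans)
  have inj: "inj_on ?f ?N"
  proof (rule inj_onI, rule ext)
    fix nu nu' i assume nu: "nu \<in> ?N" "nu' \<in> ?N" and eq: "?f nu = ?f nu'"
    show "nu i = nu' i"
    proof (cases "i \<in> {1..n}")
      case True
      then have "{mu i..<nu i} = {mu i..<nu' i}" using eq unfolding row_boxes_def by blast
      then show ?thesis using N(4)[OF nu(1), of i] N(4)[OF nu(2), of i]
        by (metis atLeastLessThan_empty_iff2 atLeastLessThan_inj(2) linorder_not_less nless_le)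
    next
      case False
      then show ?thesis using out[of i] N(3)[OF nu(1), of i] N(3)[OF nu(2), of i] by simp
    qed
  qed
  have sub: "?f ` ?N \<subseteq> ?S"
    using row_boxes_mono[OF N(1,2) K] card_row_boxes[OF N(1,2) K] by auto
  have zero: "cross_prod ?F (row_boxes la mu) I = 0" if I: "I \<in> ?S - ?f ` ?N" for I
  proof (rule ccontr)
    assume nz: "cross_prod ?F (row_boxes la mu) I \<noteq> 0"
    have IA: "I \<subseteq> row_boxes la mu" using I by auto
    have finI: "finite I" "finite (row_boxes la mu)" using IA finite_subset
      by (auto simp: row_boxes_def)
    have down: "(i, k) \<in> I" if "(i, Suc k) \<in> I" "mu i \<le> k" for i k
    proof (rule ccontr)
      assume *: "(i, k) \<notin> I"
      have "(i, k) \<in> row_boxes la mu" using that IA by (auto simp: row_boxes_def)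
      then have "(i, k) \<in> row_boxes la mu - I" using * by auto
      moreover have "?F (i, Suc k) (i, k) = 0" by (simp add: pair_factor_def x_def)
      ultimately have "(\<Prod>s'\<in>row_boxes la mu - I. ?F (i, Suc k) s') = 0"
        using finI by (intro prod_zero) (auto intro: bexI[of _ "(i,k)"])
      then have "cross_prod ?F (row_boxes la mu) I = 0"
        using finI that unfolding cross_prod_def by (intro prod_zero) auto
      then show False using nz by simp
    qed
    \<comment> \<open>The first free column of row \<open>i\<close>; \<open>la i\<close> is always
      free, so the minimum exists and is at most \<open>la i\<close>.\<close>
    define nu where "nu i = (LEAST k. mu i \<le> k \<and> (i, k) \<notin> I)" for i
    have ex: "mu i \<le> la i \<and> (i, la i) \<notin> I" for i using le IA by (auto simp: le_fun_def row_boxes_def)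
    have nu1: "mu i \<le> nu i" "(i, nu i) \<notin> I" "nu i \<le> la i" for i
      using LeastI[of "\<lambda>k. mu i \<le> k \<and> (i, k) \<notin> I", OF ex] Least_le[of "\<lambda>k. mu i \<le> k \<and> (i, k) \<notin> I", OF ex]
      by (auto simp: nu_def)
    have nu2: "(i, k) \<in> I" if "mu i \<le> k" "k < nu i" for i k
      using that not_less_Least[of k "\<lambda>k. mu i \<le> k \<and> (i, k) \<notin> I"] by (auto simp: nu_def)
    have nu3: "k < nu i" if "(i, k) \<in> I" for i k
    proof (rule ccontr)
      assume "\<not> k < nu i"
      then have "nu i \<le> k" by simp
      then have "(i, k) \<notin> I"
      proof (induction k rule: dec_induct)
        case (step m)
        then show ?case using down[of i m] nu1(1)[of i] by fastforce
      qed (rule nu1)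
      then show False using that by simp
    qed
    have "I = row_boxes nu mu"
    proof safe
      fix i k assume "(i, k) \<in> I"
      then show "(i, k) \<in> row_boxes nu mu" using IA nu3 by (auto simp: row_boxes_def)
    next
      fix i k assume "(i, k) \<in> row_boxes nu mu"
      then show "(i, k) \<in> I" using nu2 by (auto simp: row_boxes_def)
    qed
    moreover have le: "mu \<le> nu" "nu \<le> la" using nu1 by (auto simp: le_fun_def)
    ultimately have "I \<in> ?f ` ?N" using I card_row_boxes[OF le K] by auto
    then show False using I by simp
  qed
  have "finite ?S" by (simp add: row_boxes_def)
  then have "subset_sum ?F (row_boxes la mu) r = (\<Sum>I\<in>?f ` ?N. cross_prod ?F (row_boxes la mu) I)"
    unfolding subset_sum_def using sub zero by (intro sum.mono_neutral_right) auto
  also have "\<dots> = (\<Sum>nu\<in>?N. cross_prod ?F (row_boxes la mu) (row_boxes nu mu))"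
    unfolding sum.reindex[OF inj] by simp
  also have "\<dots> = (\<Sum>nu\<in>?N. \<Prod>i=1..n. \<Prod>j=1..n. T la mu nu i j)"
    by (rule sum.cong[OF refl]) (rule cross_prod_rows[OF N(1,2) K])
  finally show ?thesis .
qed

lemma size_rows_mono: "mu \<le> la \<Longrightarrow> size_rows mu \<le> size_rows la"
  unfolding size_rows_def by (intro sum_mono) (auto simp: le_fun_def)

text \<open>Both sums have the common factor \<open>layer la mu\<close>, and the identity for subset
  sums applies to what is left. The sums include shapes \<open>nu\<close> that are not partitions;
  these disappear only at the special row parameters.\<close>

theorem layer_sum_symmetric:
  assumes le: "mu \<le> la" and K: "\<And>i. la i \<le> K" and out: "\<And>i. i \<notin> {1..n} \<Longrightarrow> la i = 0"
  shows "(\<Sum>nu | nu \<in> {mu..la} \<and> size_rows nu = size_rows mu + r. layer la nu * layer nu mu) =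
    (\<Sum>nu | nu \<in> {mu..la} \<and> size_rows nu + r = size_rows la. layer la nu * layer nu mu)"
proof (cases "r \<le> size_rows la - size_rows mu")
  case True
  let ?A = "row_boxes la mu"
  have card: "card ?A = size_rows la - size_rows mu"
    by (rule card_row_boxes[OF le order_refl K])
  have T: "layer la nu * layer nu mu = layer la mu * (\<Prod>i=1..n. \<Prod>j=1..n. T la mu nu i j)"
    if "nu \<in> {mu..la}" for nu using layer_mult[of mu nu la] that K by auto
  have sum: "(\<Sum>nu | nu \<in> {mu..la} \<and> size_rows nu - size_rows mu = r'. layer la nu * layer nu mu) =
     layer la mu * subset_sum (\<lambda>s s'. pair_factor q b (x s) (x s')) ?A r'" for r'
  proof -
    have "subset_sum (\<lambda>s s'. pair_factor q b (x s) (x s')) ?A r' =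
      (\<Sum>nu | nu \<in> {mu..la} \<and> size_rows nu - size_rows mu = r'. \<Prod>i=1..n. \<Prod>j=1..n. T la mu nu i j)"
      by (rule subset_sum_rows[OF le K]) (rule out)
    then show ?thesis by (simp only: sum_distrib_left) (rule sum.cong, use T in auto)
  qed
  have 1: "{nu \<in> {mu..la}. size_rows nu = size_rows mu + r} = {nu \<in> {mu..la}. size_rows nu - size_rows mu = r}"
    using size_rows_mono[of mu] by fastforce
  have 2: "{nu \<in> {mu..la}. size_rows nu + r = size_rows la} = {nu \<in> {mu..la}. size_rows nu - size_rows mu = card ?A - r}"
    using size_rows_mono[of mu] size_rows_mono[of _ la] True unfolding card
    by (intro Collect_cong conj_cong refl) fastforce
  show ?thesis
    unfolding 1 2 sum using subset_sum_symmetric[OF generic_points_rows[of la mu, OF K], of r] True card by simp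
next
  case False
  have "size_rows mu \<le> size_rows nu" "size_rows nu \<le> size_rows la" if "nu \<in> {mu..la}" for nu
    using that size_rows_mono by auto
  then have "{nu \<in> {mu..la}. size_rows nu = size_rows mu + r} = {}" "{nu \<in> {mu..la}. size_rows nu + r = size_rows la} = {}"
    using False by fastforce+
  then show ?thesis by (simp only: sum.empty)
qed

end

section \<open>The limit of geometric row parameters\<close>

lemma generic_powi_eq:
  assumes "generic_parameters q t" "q powi a * t powi b = q powi c * t powi d"
  shows "a = c \<and> b = d"
proof -
  have nz: "q \<noteq> 0" "t \<noteq> 0" using assms by (auto simp: generic_parameters_def)
  then have "q powi (a - c) * t powi (b - d) = 1"
    using assms(2) by (simp add: power_int_diff)
  then show ?thesis using assms(1) unfolding generic_parameters_def by force
qed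

lemma generic_power_eq:
  assumes "generic_parameters q t" "q ^ a * t ^ b = q ^ c * t ^ d"
  shows "a = c \<and> b = d"
  using generic_powi_eq[OF assms(1), of "int a" "int b" "int c" "int d"] assms(2)
  by (simp only: power_int_of_nat of_nat_eq_iff)

text \<open>The parameters stay geometric when \<open>t\<close> is replaced by \<open>u\<close>, so
  the deformation has a single variable and the specialisation is an ordinary limit.\<close>

definition rows_at :: "complex \<Rightarrow> nat \<Rightarrow> nat \<Rightarrow> complex" where
  "rows_at u n i = u ^ (n - i)"

text \<open>For two boxes in one row the row parameter cancels, and no choice of \<open>u\<close>
  can prevent a coincidence. These are the conditions that remain, on \<open>q\<close> and
  \<open>b\<close> alone.\<close>

definition admissible :: "complex \<Rightarrow> complex \<Rightarrow> complex \<Rightarrow> bool" where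
  "admissible q t b \<longleftrightarrow> generic_parameters q t \<and> b \<noteq> 0 \<and> 
     (\<forall>k m :: nat. q ^ k \<noteq> b * q ^ m \<and> q ^ k \<noteq> q * b * q ^ m \<and> q ^ k \<noteq> (q * b) * (q * b) * q ^ m)"

lemma admissible_cases:
  assumes "generic_parameters q t"
  shows "admissible q t (t / q)" "admissible q t (inverse t)"
proof -
  have nz: "q \<noteq> 0" "t \<noteq> 0" using assms by (auto simp: generic_parameters_def)
  have *: "q ^ k \<noteq> q ^ l * t ^ Suc c" "t ^ Suc c * q ^ k \<noteq> q ^ l" for k l c
    using generic_power_eq[OF assms, of k 0 l "Suc c"] generic_power_eq[OF assms, of k "Suc c" l 0]
    by (auto simp: mult.commute)
  have "q ^ k \<noteq> t / q * q ^ m" for k m using *(1)[of "Suc k" m 0] nz by (auto simp: field_simps)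
  moreover have "q ^ k \<noteq> q * (t / q) * q ^ m" for k m using *(1)[of k m 0] nz by (auto simp: field_simps)
  moreover have "q ^ k \<noteq> (q * (t / q)) * (q * (t / q)) * q ^ m" for k m 
    using *(1)[of k m 1] nz by (auto simp: field_simps)
  ultimately show "admissible q t (t / q)" using nz assms unfolding admissible_def by auto
  have "q ^ k \<noteq> inverse t * q ^ m" for k m using *(2)[of 0 k m] nz by (auto simp: field_simps)
  moreover have "q ^ k \<noteq> q * inverse t * q ^ m" for k m using *(2)[of 0 k "Suc m"] nz by (auto simp: field_simps)
  moreover have "q ^ k \<noteq> (q * inverse t) * (q * inverse t) * q ^ m" for k m
    using *(2)[of 1 k "Suc (Suc m)"] nz by (auto simp: field_simps)
  ultimately show "admissible q t (inverse t)" using nz assms unfolding admissible_def by auto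
qed

lemma finite_avoid_eventually:
  fixes t :: complex
  assumes "finite S" shows "eventually (\<lambda>u. u \<notin> S) (at t)"
proof -
  have "eventually (\<lambda>u. \<forall>s\<in>S. u \<noteq> s) (at t)"
    using assms by (subst eventually_ball_finite_distrib) (auto intro: eventually_neq_at_within)
  then show ?thesis by eventually_elim auto
qed

lemma eventually_generic_rows:
  assumes "admissible q t b"
  shows "eventually (\<lambda>u. generic_rows q b (rows_at u n) n K) (at t)"
proof -
  have gen: "generic_parameters q t" and b0: "b \<noteq> 0" 
    and B: "q ^ k \<noteq> b * q ^ m" "q ^ k \<noteq> q * b * q ^ m" "q ^ k \<noteq> (q * b) * (q * b) * q ^ m" for k m
    using assms by (auto simp: admissible_def)
  have q0: "q \<noteq> 0" using gen by (auto simp: generic_parameters_def)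
  have qinj: "k = m" if "q ^ k = q ^ m" for k m
    using generic_power_eq[OF gen, of k 0 m 0] that by simp
  define C where "C = {1, b, q * b, (q * b) * (q * b)}"
  \<comment> \<open>The parameters of distinct rows \<open>i\<close> and \<open>j\<close> differ by
    the factor \<open>u ^ d\<close> with \<open>d = |i - j| \<ge> 1\<close>, so each forbidden
    coincidence prescribes the value of \<open>u ^ d\<close>. The two sets treat the two signs of
    \<open>i - j\<close>.\<close>
  define S where "S = insert 0 (\<Union>d\<in>{1..n}. \<Union>k\<in>{..K}. \<Union>m\<in>{..K}. \<Union>c\<in>C.
     {u. u ^ d = c * q ^ m / q ^ k} \<union> {u. u ^ d = q ^ k / (c * q ^ m)})"
  have "finite S" unfolding S_def C_def by (auto intro!: finite_nth_roots)
  show ?thesis using finite_avoid_eventually[OF \<open>finite S\<close>]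
  proof (rule eventually_mono)
    fix u assume u: "u \<notin> S"
    then have u0: "u \<noteq> 0" by (auto simp: S_def)
    have off: "q ^ k * rows_at u n i \<noteq> c * (q ^ m * rows_at u n j)"
      if ij: "i \<in> {1..n}" "j \<in> {1..n}" "i \<noteq> j" and km: "k \<le> K" "m \<le> K" and c: "c \<in> C" for i j k m c
    proof
      assume eq: "q ^ k * rows_at u n i = c * (q ^ m * rows_at u n j)"
      have c0: "c \<noteq> 0" using c q0 b0 by (auto simp: C_def)
      show False
      proof (cases "i < j")
        case True
        then have "n - i = (j - i) + (n - j)" using ij by auto
        then have "q ^ k * u ^ (j - i) * u ^ (n - j) = c * q ^ m * u ^ (n - j)"
          using eq by (simp add: rows_at_def power_add mult_ac)
        then have "u ^ (j - i) = c * q ^ m / q ^ k" using u0 q0 by (simp add: field_simps)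
        moreover have "j - i \<in> {1..n}" using True ij by auto
        ultimately show False using u km c unfolding S_def by blast
      next
        case False
        then have "n - j = (i - j) + (n - i)" using ij by auto
        then have "q ^ k * u ^ (n - i) = c * q ^ m * u ^ (i - j) * u ^ (n - i)"
          using eq by (simp add: rows_at_def power_add mult_ac)
        then have "u ^ (i - j) = q ^ k / (c * q ^ m)" using u0 q0 c0 by (simp add: field_simps)
        moreover have "i - j \<in> {1..n}" using False ij by auto
        ultimately show False using u km c unfolding S_def by blast
      qed
    qed
    have on: "q ^ k * rows_at u n i = c * (q ^ m * rows_at u n i) \<longleftrightarrow> q ^ k = c * q ^ m" for i k m c
      using u0 by (auto simp: rows_at_def)
    show "generic_rows q b (rows_at u n) n K"
    proof
      show "q \<noteq> 0" "b \<noteq> 0" by fact+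
      show "rows_at u n i \<noteq> 0" for i using u0 by (simp add: rows_at_def)
      fix i j k m assume ij: "i \<in> {1..n}" "j \<in> {1..n}" and km: "k \<le> K" "m \<le> K"
      show "i = j \<and> k = m" if "q ^ k * rows_at u n i = q ^ m * rows_at u n j"
        using off[OF ij _ km, of 1] on[of k i 1 m] that qinj by (cases "i = j") (auto simp: C_def)
      show "q ^ k * rows_at u n i \<noteq> b * q ^ m * rows_at u n j"
        using off[OF ij _ km, of b] on[of k i b m] B(1)[of k m] by (cases "i = j") (auto simp: C_def mult.assoc)
      show "q ^ k * rows_at u n i \<noteq> q * b * (q ^ m * rows_at u n j)"
        using off[OF ij _ km, of "q * b"] on[of k i "q * b" m] B(2)[of k m] by (cases "i = j") (auto simp: C_def)
      show "q ^ k * rows_at u n i \<noteq> q * b * (q * b) * (q ^ m * rows_at u n j)"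
        using off[OF ij _ km, of "q * b * (q * b)"] on[of k i "q * b * (q * b)" m] B(3)[of k m]
        by (cases "i = j") (auto simp: C_def)
    qed
  qed
qed

lemma rows_at_neq:
  assumes "generic_parameters q t" "i \<le> n" "j \<le> n" "i \<noteq> j \<or> k \<noteq> m"
  shows "q ^ k * rows_at t n i \<noteq> q ^ m * rows_at t n j"
  using generic_power_eq[OF assms(1), of k "n - i" m "n - j"] assms(2-)
  by (auto simp: rows_at_def)

text \<open>The denominators are differences \<open>q ^ k * y i - q ^ m * y j\<close>. Inside one
  row the two exponents are \<open>mu i\<close> and \<open>Suc k > mu i\<close>; for different rows
  the powers of \<open>t\<close> differ. Neither kind vanishes at \<open>u = t\<close>.\<close>

lemma isCont_layer:
  assumes "generic_parameters q t"
  shows "isCont (\<lambda>u. rows.layer q b (rows_at u n) n la mu) t"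
proof -
  have g: "isCont (\<lambda>u. rows.g q b (rows_at u n) i j k m) t" if "i \<in> {1..n}" "j \<in> {1..n}" "i \<noteq> j \<or> k \<noteq> m" for i j k m
  proof -
    have "q ^ k * t ^ (n - i) - q ^ m * t ^ (n - j) \<noteq> 0"
      using rows_at_neq[OF assms, of i n j k m] that by (simp add: rows_at_def)
    then show ?thesis unfolding rows.g_def rows_at_def by (intro continuous_intros)
  qed
  have "isCont (\<lambda>u. (if i \<le> j then \<Prod>k=mu i..<la i. rows.g q b (rows_at u n) j i (mu j) (Suc k) else 1)) t"
    if "i \<in> {1..n}" "j \<in> {1..n}" for i j
    using that by (cases "i \<le> j") (auto intro!: continuous_prod g)
  moreover have "isCont (\<lambda>u. (if i < j then \<Prod>k=mu i..<la i. rows.g q b (rows_at u n) i j k (la j) else 1)) t"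
    if "i \<in> {1..n}" "j \<in> {1..n}" for i j
    using that by (cases "i < j") (auto intro!: continuous_prod g)
  ultimately show ?thesis unfolding rows.layer_def
    by (intro continuous_prod isCont_mult) auto
qed

abbreviation size_rows :: "nat \<Rightarrow> parts \<Rightarrow> nat" where "size_rows \<equiv> rows.size_rows"

text \<open>The value \<open>u = t\<close> itself may violate genericity; the identity holds in a
  punctured neighbourhood, and both finite sums are continuous.\<close>

theorem layer_sum_symmetric_at:
  assumes adm: "admissible q t b" and le: "mu \<le> la" and out: "\<And>i. i \<notin> {1..n} \<Longrightarrow> la i = 0"
  defines "w \<equiv> rows.layer q b (rows_at t n) n"
  shows "(\<Sum>nu | nu \<in> {mu..la} \<and> size_rows n nu = size_rows n mu + r. w la nu * w nu mu) =
    (\<Sum>nu | nu \<in> {mu..la} \<and> size_rows n nu + r = size_rows n la. w la nu * w nu mu)"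
proof -
  have gen: "generic_parameters q t" using adm by (simp add: admissible_def)
  let ?w = "\<lambda>u. rows.layer q b (rows_at u n) n"
  let ?f = "\<lambda>u. \<Sum>nu | nu \<in> {mu..la} \<and> size_rows n nu = size_rows n mu + r. ?w u la nu * ?w u nu mu"
  let ?h = "\<lambda>u. \<Sum>nu | nu \<in> {mu..la} \<and> size_rows n nu + r = size_rows n la. ?w u la nu * ?w u nu mu"
  obtain K where K: "la i \<le> K" for i
  proof
    fix i show "la i \<le> sum la {1..n}"
    proof (cases "i \<in> {1..n}")
      case True then show ?thesis by (intro member_le_sum) auto
    qed (simp add: out)
  qed
  have "eventually (\<lambda>u. ?f u = ?h u) (at t)"
    using eventually_generic_rows[OF adm, of n K]
  proof (rule eventually_mono)
    fix u assume "generic_rows q b (rows_at u n) n K"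
    then show "?f u = ?h u" by (rule generic_rows.layer_sum_symmetric) (use le K out in auto)
  qed
  moreover have "(?f \<longlongrightarrow> ?f t) (at t)" "(?h \<longlongrightarrow> ?h t) (at t)"
    by (intro tendsto_sum tendsto_mult isCont_layer[OF gen, unfolded isCont_def])+
  ultimately have "?f t = ?h t"
    using tendsto_unique[OF at_neq_bot, of ?h "?f t" t "?h t"] tendsto_cong[of ?f ?h]  by blast
  then show ?thesis by (simp add: w_def)
qed

text \<open>Passing from row \<open>i\<close> to row \<open>i + 1\<close> divides the parameter by
  \<open>t\<close>, so for \<open>b = t / q\<close> the numerator of \<open>g\<close> vanishes when
  a column step by one is compensated by a row step. This happens exactly once
  \<open>la (Suc i)\<close> exceeds \<open>mu i\<close>.\<close>

lemma layer_ordinary_eq_0: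
  assumes nz: "q \<noteq> 0" "t \<noteq> 0" and i: "1 \<le> i" "i < n" and "mu i < la (Suc i)" "la (Suc i) \<le> la i"
  shows "rows.layer q (t / q) (rows_at t n) n la mu = 0"
proof -
  \<comment> \<open>With columns counted from 0 this is the last column of row \<open>i + 1\<close>
    in \<open>la\<close>; in row \<open>i\<close> it belongs to \<open>la / mu\<close>.\<close>
  define k where "k = la (Suc i) - 1"
  have k: "la (Suc i) = Suc k" "k \<in> {mu i..<la i}" using assms by (auto simp: k_def)
  have "n - i = Suc (n - Suc i)" using i by auto
  then have "rows.g q (t / q) (rows_at t n) i (Suc i) k (Suc k) = 0"
    using nz by (simp add: rows.g_def rows_at_def)
  then have "(\<Prod>k=mu i..<la i. rows.g q (t / q) (rows_at t n) i (Suc i) k (la (Suc i))) = 0"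
    unfolding k(1) using k(2) by (intro prod_zero) auto
  then show ?thesis using i unfolding rows.layer_def
    by (intro prod_zero bexI[of _ i] bexI[of _ "Suc i"]) auto
qed

text \<open>For \<open>b = 1 / t\<close> the numerator vanishes between neighbouring rows at equal
  exponents of \<open>q\<close>. This detects an ascent of the inner shape instead of a failure of
  interlacing.\<close>

lemma layer_hyper_eq_0:
  assumes nz: "q \<noteq> 0" "t \<noteq> 0" and i: "1 \<le> i" "i < n" and "mu i < mu (Suc i)" "mu (Suc i) \<le> la i"
  shows "rows.layer q (inverse t) (rows_at t n) n la mu = 0"
proof -
  define k where "k = mu (Suc i) - 1"
  have k: "mu (Suc i) = Suc k" "k \<in> {mu i..<la i}" using assms by (auto simp: k_def)
  have "n - i = Suc (n - Suc i)" using i by auto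
  then have "rows.g q (inverse t) (rows_at t n) (Suc i) i (Suc k) (Suc k) = 0"
    using nz by (simp add: rows.g_def rows_at_def)
  then have "(\<Prod>k=mu i..<la i. rows.g q (inverse t) (rows_at t n) (Suc i) i (mu (Suc i)) (Suc k)) = 0"
    unfolding k(1) using k(2) by (intro prod_zero) auto
  then show ?thesis using i unfolding rows.layer_def
    by (intro prod_zero bexI[of _ i] bexI[of _ "Suc i"]) auto
qed

section \<open>The layer weights of Macdonald and hyper type\<close>

lemma partition_nz_iff:
  assumes "is_partition p" "1 \<le> i"
  shows "p i \<noteq> 0 \<longleftrightarrow> i \<le> len p"
proof -
  let ?S = "{i. 1 \<le> i \<and> p i \<noteq> 0}"
  have fin: "finite ?S" and mono: "\<And>i j. 1 \<le> i \<Longrightarrow> i \<le> j \<Longrightarrow> p j \<le> p i"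
    using assms by (auto simp: is_partition_def)
  show ?thesis
  proof
    assume "p i \<noteq> 0"
    then have "{1..i} \<subseteq> ?S" using mono[of _ i] by fastforce
    from card_mono[OF fin this] show "i \<le> len p" by (simp add: len_def)
  next
    assume i: "i \<le> len p"
    show "p i \<noteq> 0"
    proof
      assume "p i = 0"
      then have z: "p j = 0" if "i \<le> j" for j using mono[OF assms(2) that] by simp
      have "?S \<subseteq> {1..<i}"
      proof
        fix j assume "j \<in> ?S"
        then show "j \<in> {1..<i}" using z[of j] by (cases "i \<le> j") auto
      qed
      from card_mono[OF _ this] show False using i assms(2) by (simp add: len_def)
    qed
  qed
qed

text \<open>A product of weights of single boxes. In a two-step chain from \<open>mu\<close> to
  \<open>la\<close> its total does not depend on the intermediate shape, so such a factor is
  harmless for commutation.\<close>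

definition cocycle :: "(nat \<Rightarrow> nat \<Rightarrow> complex) \<Rightarrow> nat \<Rightarrow> parts \<Rightarrow> parts \<Rightarrow> complex" where
  "cocycle c n la mu = (\<Prod>i=1..n. \<Prod>k=mu i..<la i. c i k)"

lemma cocycle_mult: "mu \<le> nu \<Longrightarrow> nu \<le> la \<Longrightarrow> cocycle c n la nu * cocycle c n nu mu = cocycle c n la mu"
  unfolding cocycle_def prod.distrib[symmetric]
  by (intro prod.cong refl) (auto simp: prod.atLeastLessThan_concat mult.commute le_fun_def)

lemma f_ratio_shift:
  assumes "q \<noteq> 0"
  shows "f_ratio q t (l - m) (q powi (int m - int e) * w) =
    (\<Prod>k=m..<l. (1 - q powi (int k + 1 - int e) * w) / (1 - t * q powi (int k - int e) * w))"
proof -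
  have "(\<Prod>k=m..<l. (1 - q powi (int k + 1 - int e) * w) / (1 - t * q powi (int k - int e) * w)) =
    (\<Prod>i<l - m. (1 - q powi (int (i + m) + 1 - int e) * w) / (1 - t * q powi (int (i + m) - int e) * w))"
    by (rule prod.reindex_bij_witness[of _ "\<lambda>i. i + m" "\<lambda>k. k - m"]) auto
  also have "\<dots> = f_ratio q t (l - m) (q powi (int m - int e) * w)"
    unfolding f_ratio_def
  proof (intro prod.cong refl)
    fix i
    have "q powi (int (i + m) + 1 - int e) = q ^ (i + 1) * q powi (int m - int e)"
      using assms power_int_add[of q "int (i + 1)" "int m - int e"] by (simp add: algebra_simps power_int_add)
    moreover have "q powi (int (i + m) - int e) = q ^ i * q powi (int m - int e)"
      using assms power_int_add[of q "int i" "int m - int e"] by (simp add: algebra_simps)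
    ultimately show "(1 - q powi (int (i + m) + 1 - int e) * w) / (1 - t * q powi (int (i + m) - int e) * w) =
      (1 - q ^ (i + 1) * (q powi (int m - int e) * w)) / (1 - t * q ^ i * (q powi (int m - int e) * w))"
      by (simp add: mult.assoc)
  qed
  finally show ?thesis ..
qed

lemma prod_lessThan_shift: "(\<Prod>j<l - m. f j) = (\<Prod>k=m..<l. f (k - m :: nat))"
  by (rule prod.reindex_bij_witness[of _ "\<lambda>k. k - m" "\<lambda>j. j + m"]) auto

text \<open>The weights pair row \<open>i\<close> with rows \<open>j\<close> and
  \<open>j + 1\<close>. Reindexing the second kind gives factors for pairs \<open>i < j\<close>, at
  the price of a boundary column \<open>n + 1\<close>, where the part is 0 and the factor becomes a
  box weight.\<close>

lemma prod_triangle_shift: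
  fixes A B :: "nat \<Rightarrow> nat \<Rightarrow> complex"
  shows "(\<Prod>j=1..n. \<Prod>i=1..j. A i (Suc j) / B i j) = (\<Prod>i=1..n. A i (Suc n)) *
    (\<Prod>i=1..n. \<Prod>j=1..n. (if i \<le> j then inverse (B i j) else 1) * (if i < j then A i j else 1))"
proof (induction n)
  case (Suc n)
  have 1: "(\<Prod>j=1..n. (if Suc n \<le> j then inverse (B (Suc n) j) else 1) * (if Suc n < j then A (Suc n) j else 1)) = 1"
    by (rule prod.neutral) auto
  have 2: "(\<Prod>i=1..n. (if i \<le> Suc n then inverse (B i (Suc n)) else 1) * (if i < Suc n then A i (Suc n) else 1)) =
    (\<Prod>i=1..n. inverse (B i (Suc n))) * (\<Prod>i=1..n. A i (Suc n))"
    unfolding prod.distrib[symmetric] by (rule prod.cong) auto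
  show ?case
    using Suc.IH by (simp add: 1 2 prod.distrib prod_dividef prod_inversef divide_inverse mult_ac del: prod.lessThan_Suc)
qed auto

section \<open>The factors of the weights as values of \<open>g\<close>\<close>

locale generic_qt =
  fixes q t :: complex
  assumes generic: "generic_parameters q t"
begin

lemma nz: "q \<noteq> 0" "t \<noteq> 0" using generic by (auto simp: generic_parameters_def)

lemma powi_ne_1: "q powi a * t powi b = 1 \<longleftrightarrow> a = 0 \<and> b = 0"
  using generic by (auto simp: generic_parameters_def)

lemma factor_nz: "0 < s \<Longrightarrow> 1 - t ^ s * q powi e \<noteq> 0" "0 < s \<Longrightarrow> 1 - q powi e * t ^ s \<noteq> 0"
  using powi_ne_1[of e "int s"] by (auto simp: mult.commute)

lemma factor_nz': "e \<noteq> 0 \<Longrightarrow> 1 - q powi e \<noteq> 0"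
  using powi_ne_1[of e 0] by auto

text \<open>\<open>R s e k\<close> is \<open>f(q\<^sup>k\<^sup>+\<^sup>1 u) / f(q\<^sup>k u)\<close> for \<open>u = q\<^sup>-\<^sup>e t\<^sup>s\<close>.\<close>

definition R :: "nat \<Rightarrow> nat \<Rightarrow> nat \<Rightarrow> complex" where
  "R s e k = (1 - q powi (int k + 1 - int e) * t ^ s) / (1 - t * q powi (int k - int e) * t ^ s)"

lemma f_ratio_R: "f_ratio q t (l - m) (q powi (int m - int e) * t ^ s) = (\<Prod>k=m..<l. R s e k)"
  unfolding R_def by (rule f_ratio_shift) (rule nz)

lemma R_nz: "0 < s \<or> e \<le> k \<Longrightarrow> R s e k \<noteq> 0"
  using factor_nz(1)[of "Suc s" "int k - int e"] factor_nz(2)[of s "int k + 1 - int e"] factor_nz'[of "int k + 1 - int e"]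
  unfolding R_def by (cases "s = 0") (auto simp: mult_ac)

lemma powi_diff': "q powi (int k - int e) = q ^ k / q ^ e" "q powi (int k + 1 - int e) = q * q ^ k / q ^ e"
  using nz by (auto simp: power_int_diff power_int_add)

lemma scale_fraction: "(c :: complex) \<noteq> 0 \<Longrightarrow> a' = c * a \<Longrightarrow> b' = c * b \<Longrightarrow> a' / b' = a / b"
  by simp

text \<open>\<open>t ^ (j - i)\<close> is the quotient of two row parameters, and comparing
  numerators forces \<open>b = t / q\<close>. The constant \<open>q / t\<close> per box goes into
  the cocycle.\<close>

lemma g_ordinary:
  assumes "i < j" "j \<le> n"
  shows "R (j - Suc i) e k = (q / t) * rows.g q (t / q) (rows_at t n) i j k e"
proof -
  define w where "w = t ^ (j - Suc i)"
  define z where "z = t ^ (n - j)"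
  have z0: "z \<noteq> 0" using nz by (simp add: z_def)
  have ni: "n - i = Suc (j - Suc i) + (n - j)" using assms by auto
  have ti: "rows_at t n i = t * w * z" "rows_at t n j = z"
    unfolding rows_at_def w_def z_def by (simp_all only: ni power_add power_Suc)
  have "(q / t) * rows.g q (t / q) (rows_at t n) i j k e =
     (q / t * (q ^ k * (t * w * z) - t / q * q ^ e * z)) / (q ^ k * (t * w * z) - q ^ e * z)"
    by (simp add: rows.g_def ti)
  also have "\<dots> = R (j - Suc i) e k"
    unfolding R_def powi_diff' w_def[symmetric]
    by (rule scale_fraction[of "- (q ^ e * z)"]) (use nz z0 in \<open>simp_all add: field_simps\<close>)
  finally show ?thesis ..
qed

lemma h_ordinary:
  assumes "i \<le> j" "j \<le> n"
  shows "inverse (R (j - i) e k) = rows.g q (t / q) (rows_at t n) j i e (Suc k)"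
proof -
  define w where "w = t ^ (j - i)"
  define z where "z = t ^ (n - j)"
  have z0: "z \<noteq> 0" using nz by (simp add: z_def)
  have ni: "n - i = (j - i) + (n - j)" using assms by auto
  have ti: "rows_at t n i = w * z" "rows_at t n j = z"
    unfolding rows_at_def w_def z_def by (simp_all only: ni power_add power_Suc)
  have "rows.g q (t / q) (rows_at t n) j i e (Suc k) =
     (q ^ e * z - t / q * q ^ Suc k * (w * z)) / (q ^ e * z - q ^ Suc k * (w * z))"
    by (simp add: rows.g_def ti)
  also have "\<dots> = inverse (R (j - i) e k)"
    unfolding R_def powi_diff' w_def[symmetric] inverse_divide
    by (rule scale_fraction[of "q ^ e * z"]) (use nz z0 in \<open>simp_all add: field_simps\<close>)
  finally show ?thesis ..
qed

text \<open>The boundary factor of the box, and one factor \<open>q / t\<close> for each lower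
  row.\<close>

definition c_ordinary :: "nat \<Rightarrow> nat \<Rightarrow> nat \<Rightarrow> complex" where
  "c_ordinary n i k = R (n - i) 0 k * (\<Prod>j=1..n. if i < j then q / t else 1)"

lemma psi_eq_layer:
  assumes mu: "is_partition mu" and len: "len mu \<le> n" and le: "mu \<le> la"
    and out: "\<And>i. i \<notin> {1..n} \<Longrightarrow> la i = 0" and strip: "\<And>i. 1 \<le> i \<Longrightarrow> la (Suc i) \<le> mu i"
  shows "psi q t la mu = cocycle (c_ordinary n) n la mu * rows.layer q (t / q) (rows_at t n) n la mu"
proof -
  let ?A = "\<lambda>i j. \<Prod>k=mu i..<la i. R (j - Suc i) (la j) k"
  let ?B = "\<lambda>i j. \<Prod>k=mu i..<la i. R (j - i) (mu j) k"
  have 0: "mu i \<le> la i" for i using le by (simp add: le_fun_def)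
  have "psi q t la mu = (\<Prod>j=1..len mu. \<Prod>i=1..j. ?A i (Suc j) / ?B i j)"
    unfolding psi_def f_ratio_R by simp
  also have "\<dots> = (\<Prod>j=1..n. \<Prod>i=1..j. ?A i (Suc j) / ?B i j)"
  \<comment> \<open>For \<open>j > len mu\<close> both \<open>mu j\<close> and
    \<open>la (Suc j)\<close> are 0, the latter by the strip condition, so numerator and denominator
    are the same nonzero product.\<close>
  proof (rule prod.mono_neutral_left)
    show "\<forall>j\<in>{1..n} - {1..len mu}. (\<Prod>i=1..j. ?A i (Suc j) / ?B i j) = 1"
    proof
      fix j assume "j \<in> {1..n} - {1..len mu}"
      then have j: "1 \<le> j" "\<not> j \<le> len mu" by auto
      then have "mu j = 0" using partition_nz_iff[OF mu j(1)] by simp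
      moreover have "la (Suc j) = 0" using strip[OF j(1)] \<open>mu j = 0\<close> by simp
      ultimately show "(\<Prod>i=1..j. ?A i (Suc j) / ?B i j) = 1"
        by (intro prod.neutral ballI) (simp add: R_nz)
    qed
  qed (use len in auto)
  also have "\<dots> = (\<Prod>i=1..n. ?A i (Suc n)) *
    (\<Prod>i=1..n. \<Prod>j=1..n. (if i \<le> j then inverse (?B i j) else 1) * (if i < j then ?A i j else 1))"
    by (rule prod_triangle_shift)
  also have "(\<Prod>i=1..n. \<Prod>j=1..n. (if i \<le> j then inverse (?B i j) else 1) * (if i < j then ?A i j else 1)) =
    (\<Prod>i=1..n. \<Prod>j=1..n. (\<Prod>k=mu i..<la i. if i < j then q / t else 1) *
     ((if i \<le> j then \<Prod>k=mu i..<la i. rows.g q (t / q) (rows_at t n) j i (mu j) (Suc k) else 1) *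
      (if i < j then \<Prod>k=mu i..<la i. rows.g q (t / q) (rows_at t n) i j k (la j) else 1)))"
  proof (intro prod.cong refl)
    fix i j assume j: "j \<in> {1..n}"
    let ?g = "rows.g q (t / q) (rows_at t n)"
    have A: "?A i j = (\<Prod>k=mu i..<la i. q / t) * (\<Prod>k=mu i..<la i. ?g i j k (la j))" if "i < j"
      unfolding prod.distrib[symmetric] by (rule prod.cong) (use g_ordinary[OF that, of n] j in auto)
    have B: "inverse (?B i j) = (\<Prod>k=mu i..<la i. ?g j i (mu j) (Suc k))" if "i \<le> j"
      unfolding prod_inversef[symmetric] by (rule prod.cong) (use h_ordinary[OF that, of n] j in auto)
    consider "i < j" | "i = j" | "j < i" by linarith
    then show "(if i \<le> j then inverse (?B i j) else 1) * (if i < j then ?A i j else 1) =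
      (\<Prod>k=mu i..<la i. if i < j then q / t else 1) *
     ((if i \<le> j then \<Prod>k=mu i..<la i. rows.g q (t / q) (rows_at t n) j i (mu j) (Suc k) else 1) *
      (if i < j then \<Prod>k=mu i..<la i. rows.g q (t / q) (rows_at t n) i j k (la j) else 1))"
    proof cases
      case 1
      then show ?thesis unfolding A[OF 1] B[OF less_imp_le[OF 1]] by (simp del: prod_constant)
    next
      case 2
      then show ?thesis using B[of] by simp
    qed simp
  qed
  also have "\<dots> = (\<Prod>i=1..n. \<Prod>j=1..n. \<Prod>k=mu i..<la i. if i < j then q / t else 1) *
      rows.layer q (t / q) (rows_at t n) n la mu"
    unfolding rows.layer_def by (simp only: prod.distrib)
  also have "(\<Prod>i=1..n. \<Prod>j=1..n. \<Prod>k=mu i..<la i. if i < j then q / t else 1) =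
     (\<Prod>i=1..n. \<Prod>k=mu i..<la i. \<Prod>j=1..n. if i < j then q / t else 1)"
    by (intro prod.cong refl prod.swap)
  also have "(\<Prod>i=1..n. ?A i (Suc n)) = (\<Prod>i=1..n. \<Prod>k=mu i..<la i. R (n - i) 0 k)"
    using out[of "Suc n"] by simp
  finally show ?thesis by (simp add: cocycle_def c_ordinary_def prod.distrib mult_ac)
qed

text \<open>
  The part of \<open>\<A>\<^sub>2\<close> that belongs to one entry; \<open>r\<close> stands for \<open>\<ell>(T\<^sub>2)\<close>, on which the value does
  not depend as long as \<open>la\<close> has at most \<open>r\<close> parts.
\<close>

definition hyper_layer :: "parts \<Rightarrow> parts \<Rightarrow> nat \<Rightarrow> complex" where
  "hyper_layer la mu r = fC q t la mu *
    (\<Prod>i=1..r. \<Prod>j=1..la i - mu i - 1.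
            ((1 - q * inverse t * q ^ j) * (1 - t)) / ((1 - q * inverse t) * (1 - t * q ^ j))) *
    (\<Prod>i=1..r. \<Prod>j=i+1..r. \<Prod>\<alpha><la i - mu i.
            ((1 - t ^ (j - i + 1) * q powi (int (mu i) + int \<alpha> - int (la j))) *
             (1 - t ^ (j - i) * q powi (int (mu i) + int \<alpha> - int (mu j)))) /
            ((1 - t ^ (j - i) * q powi (int (mu i) + int \<alpha> - int (la j))) *
             (1 - t ^ (j - i + 1) * q powi (int (mu i) + int \<alpha> - int (mu j)))))"

text \<open>The last product of \<open>A2\<close> for one box; \<open>e\<close> and
  \<open>e'\<close> stand for \<open>la j\<close> and \<open>mu j\<close>.\<close>

definition R' :: "nat \<Rightarrow> nat \<Rightarrow> nat \<Rightarrow> nat \<Rightarrow> complex" where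
  "R' s e e' k = ((1 - t ^ (s + 1) * q powi (int k - int e)) * (1 - t ^ s * q powi (int k - int e'))) /
     ((1 - t ^ s * q powi (int k - int e)) * (1 - t ^ (s + 1) * q powi (int k - int e')))"

lemma R'_same: "0 < s \<Longrightarrow> R' s e e k = 1"
  using factor_nz(1)[of "s + 1"] factor_nz(1)[of s] by (simp add: R'_def del: power_Suc)

lemma prod_R':
  "(\<Prod>\<alpha><l - m.
            ((1 - t ^ (s + 1) * q powi (int m + int \<alpha> - int e)) *
             (1 - t ^ s * q powi (int m + int \<alpha> - int e'))) /
            ((1 - t ^ s * q powi (int m + int \<alpha> - int e)) *
             (1 - t ^ (s + 1) * q powi (int m + int \<alpha> - int e')))) = (\<Prod>k=m..<l. R' s e e' k)"
  unfolding R'_def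
  by (rule prod.reindex_bij_witness[of _ "\<lambda>k. k - m" "\<lambda>i. i + m"]) (auto simp: add_ac)

text \<open>Normalised so that the factor with \<open>j = 0\<close> in the middle product of
  \<open>A2\<close> becomes 1. The product over \<open>1..\<theta> - 1\<close> then extends to all
  boxes of the row, and \<open>c0\<close> is a box weight.\<close>

definition c0 :: complex where "c0 = (1 - t) / (1 - q / t)"

lemma prod_diagonal:
  "(\<Prod>j=1..d - 1. ((1 - q * inverse t * q ^ j) * (1 - t)) / ((1 - q * inverse t) * (1 - t * q ^ j))) =
    (\<Prod>j<d. c0 * ((1 - q / t * q ^ j) / (1 - t * q ^ j)))"
proof (cases d)
  case (Suc d')
  have ne: "1 - t \<noteq> 0" using factor_nz(1)[of 1 0] by simp
  have ne': "1 - q / t \<noteq> 0" using powi_ne_1[of 1 "-1"] nz by (simp add: power_int_minus field_simps)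
  have "(\<Prod>j<d. c0 * ((1 - q / t * q ^ j) / (1 - t * q ^ j))) =
    c0 * ((1 - q / t) / (1 - t)) * (\<Prod>j<d'. c0 * ((1 - q / t * q ^ Suc j) / (1 - t * q ^ Suc j)))"
    unfolding Suc prod.lessThan_Suc_shift by simp
  also have "c0 * ((1 - q / t) / (1 - t)) = 1" using ne ne' by (simp add: c0_def)
  also have "(\<Prod>j<d'. c0 * ((1 - q / t * q ^ Suc j) / (1 - t * q ^ Suc j))) =
    (\<Prod>j=1..d - 1. c0 * ((1 - q / t * q ^ j) / (1 - t * q ^ j)))"
    by (rule prod.reindex_bij_witness[of _ "\<lambda>j. j - 1" Suc]) (auto simp: Suc)
  finally show ?thesis by (simp add: c0_def divide_inverse mult_ac)
qed auto

text \<open>For a row paired with itself, the denominator \<open>1 - t * q ^ (k - e)\<close> in the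
  middle product of \<open>A2\<close> cancels against \<open>fC\<close>, leaving a value of
  \<open>g\<close> with \<open>b = 1 / t\<close>.\<close>

lemma h_hyper_diag:
  assumes "j \<le> n" "e \<le> k"
  shows "inverse (R 0 e k) * ((1 - q / t * q ^ (k - e)) / (1 - t * q ^ (k - e))) =
    rows.g q (inverse t) (rows_at t n) j j e (Suc k)"
proof -
  define z where "z = t ^ (n - j)"
  define Q where "Q = q ^ (k - e)"
  have z0: "z \<noteq> 0" using nz by (simp add: z_def)
  have qk: "q ^ k = Q * q ^ e" using assms by (simp add: Q_def flip: power_add)
  have ne: "1 - t * Q \<noteq> 0" using factor_nz(1)[of 1 "int (k - e)"] by (simp add: Q_def)
  have "rows.g q (inverse t) (rows_at t n) j j e (Suc k) =
     (q ^ e * z - inverse t * q ^ Suc k * z) / (q ^ e * z - q ^ Suc k * z)"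
    by (simp add: rows.g_def rows_at_def z_def)
  also have "\<dots> = (1 - q / t * Q) / (1 - q * Q)"
    by (rule scale_fraction[of "q ^ e * z"]) (use nz z0 in \<open>simp_all add: field_simps qk\<close>)
  also have "\<dots> = inverse (R 0 e k) * ((1 - q / t * Q) / (1 - t * Q))"
    using ne nz by (simp add: R_def powi_diff' qk)
  finally show ?thesis unfolding Q_def ..
qed

text \<open>The two factors from \<open>fC\<close> contain \<open>1 - t^(s+1) q^(k-e')\<close> and
  \<open>1 - t^s q^(k-e')\<close> for \<open>s = j - i\<close>, and the half of \<open>R'\<close>
  with \<open>e'\<close> cancels exactly these. The half with \<open>e\<close> becomes the second
  \<open>g\<close>, up to the box weight \<open>t\<close>.\<close>

lemma g_h_hyper:
  assumes "i < j" "j \<le> n"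
  shows "inverse (R (j - i) e' k) * R (j - Suc i) e' k * R' (j - i) e e' k =
    t * (rows.g q (inverse t) (rows_at t n) j i e' (Suc k) * rows.g q (inverse t) (rows_at t n) i j k e)"
proof -
  define s where "s = j - Suc i"
  have s: "j - i = Suc s" using assms by (auto simp: s_def)
  define w where "w = t ^ s"
  define z where "z = t ^ (n - j)"
  have z0: "z \<noteq> 0" using nz by (simp add: z_def)
  have ni: "n - i = Suc s + (n - j)" using assms by (auto simp: s_def)
  have ti: "rows_at t n i = t * w * z" "rows_at t n j = z"
    unfolding rows_at_def w_def z_def by (simp_all only: ni power_add power_Suc)
  define P where "P = q ^ k / q ^ e"
  define P' where "P' = q ^ k / q ^ e'"
  have n1: "1 - t * P' * (t * w) \<noteq> 0" using factor_nz(1)[of "Suc (Suc s)" "int k - int e'"]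
    by (simp add: P'_def powi_diff' w_def mult_ac)
  have n2: "1 - t * P' * w \<noteq> 0" using factor_nz(1)[of "Suc s" "int k - int e'"]
    by (simp add: P'_def powi_diff' w_def mult_ac)
  have 1: "rows.g q (inverse t) (rows_at t n) j i e' (Suc k) = (1 - q * P' * w) / (1 - q * P' * (t * w))"
    unfolding rows.g_def ti
    by (rule scale_fraction[of "q ^ e' * z"]) (use nz z0 in \<open>simp_all add: field_simps P'_def\<close>)
  have 2: "t * rows.g q (inverse t) (rows_at t n) i j k e = (1 - t * t * w * P) / (1 - t * w * P)"
    unfolding rows.g_def ti times_divide_eq_right
    by (rule scale_fraction[of "- (q ^ e * z)"]) (use nz z0 in \<open>simp_all add: field_simps P_def\<close>)
  have 3: "R (j - i) e' k = (1 - q * P' * (t * w)) / (1 - t * P' * (t * w))"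
    "R (j - Suc i) e' k = (1 - q * P' * w) / (1 - t * P' * w)"
    unfolding s s_def[symmetric] by (simp_all add: R_def powi_diff' P'_def w_def)
  have 4: "R' (j - i) e e' k = ((1 - t * t * w * P) * (1 - t * P' * w)) / ((1 - t * w * P) * (1 - t * P' * (t * w)))"
    unfolding s by (simp add: R'_def powi_diff' P_def P'_def w_def mult_ac)
  have "inverse (R (j - i) e' k) * R (j - Suc i) e' k * R' (j - i) e e' k =
    ((1 - q * P' * w) / (1 - q * P' * (t * w))) * ((1 - t * t * w * P) / (1 - t * w * P))"
    unfolding 3 4 inverse_divide using n1 n2 by simp
  then show ?thesis unfolding 1 2[symmetric] by (simp add: mult_ac)
qed

definition c_hyper :: "nat \<Rightarrow> nat \<Rightarrow> nat \<Rightarrow> complex" where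
  "c_hyper n i k = R (n - i) 0 k * c0 * (\<Prod>j=1..n. if i < j then t else 1)"

text \<open>The right side does not contain \<open>r\<close>, so two applications also compare
  \<open>hyper_layer\<close> for different admissible \<open>r\<close>.\<close>

lemma hyper_layer_eq:
  assumes mu: "is_partition mu" and r: "r \<le> n" and le: "mu \<le> la"
    and out: "\<And>i. i \<notin> {1..r} \<Longrightarrow> la i = 0"
  shows "hyper_layer la mu r = cocycle (c_hyper n) n la mu * rows.layer q (inverse t) (rows_at t n) n la mu"
proof -
  let ?A = "\<lambda>i j. \<Prod>k=mu i..<la i. R (j - Suc i) (mu j) k"
  let ?B = "\<lambda>i j. \<Prod>k=mu i..<la i. R (j - i) (mu j) k"
  let ?C = "\<lambda>i j. \<Prod>k=mu i..<la i. R' (j - i) (la j) (mu j) k"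
  let ?D = "\<lambda>i. \<Prod>k=mu i..<la i. c0 * ((1 - q / t * q ^ (k - mu i)) / (1 - t * q ^ (k - mu i)))"
  have 0: "mu i \<le> la i" for i using le by (simp add: le_fun_def)
  have mu0: "mu i = 0" if "i \<notin> {1..r}" for i using 0[of i] out[OF that] by simp
  have len: "len mu \<le> n"
  proof (rule ccontr)
    assume "\<not> len mu \<le> n"
    then have "mu (len mu) \<noteq> 0" using partition_nz_iff[OF mu, of "len mu"] by simp
    then show False using mu0[of "len mu"] r \<open>\<not> len mu \<le> n\<close> by auto
  qed
  have "fC q t la mu = (\<Prod>j=1..len mu. \<Prod>i=1..j. ?A i (Suc j) / ?B i j)"
    unfolding fC_def f_ratio_R by simp
  also have "\<dots> = (\<Prod>j=1..n. \<Prod>i=1..j. ?A i (Suc j) / ?B i j)"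
  proof (rule prod.mono_neutral_left)
    show "\<forall>j\<in>{1..n} - {1..len mu}. (\<Prod>i=1..j. ?A i (Suc j) / ?B i j) = 1"
    proof
      fix j assume "j \<in> {1..n} - {1..len mu}"
      then have j: "1 \<le> j" "\<not> j \<le> len mu" by auto
      then have "mu j = 0" "mu (Suc j) = 0" using partition_nz_iff[OF mu, of j] partition_nz_iff[OF mu, of "Suc j"] by simp_all
      then show "(\<Prod>i=1..j. ?A i (Suc j) / ?B i j) = 1"
        by (intro prod.neutral ballI) (simp add: R_nz)
    qed
  qed (use len in auto)
  also have "\<dots> = (\<Prod>i=1..n. ?A i (Suc n)) *
    (\<Prod>i=1..n. \<Prod>j=1..n. (if i \<le> j then inverse (?B i j) else 1) * (if i < j then ?A i j else 1))"
    by (rule prod_triangle_shift)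
  also have "(\<Prod>i=1..n. ?A i (Suc n)) = (\<Prod>i=1..n. \<Prod>k=mu i..<la i. R (n - i) 0 k)"
    using mu0[of "Suc n"] r by simp
  finally have fC: "fC q t la mu = \<dots> * (\<Prod>i=1..n. \<Prod>j=1..n. (if i \<le> j then inverse (?B i j) else 1) * (if i < j then ?A i j else 1))" .
  have "(\<Prod>i=1..r. \<Prod>j=1..la i - mu i - 1.
            ((1 - q * inverse t * q ^ j) * (1 - t)) / ((1 - q * inverse t) * (1 - t * q ^ j))) = (\<Prod>i=1..r. ?D i)"
    unfolding prod_diagonal by (intro prod.cong refl prod_lessThan_shift)
  also have "\<dots> = (\<Prod>i=1..n. ?D i)"
    by (rule prod.mono_neutral_left) (use r out in auto)
  also have "\<dots> = (\<Prod>i=1..n. \<Prod>j=1..n. if i = j then ?D i else 1)" by simp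
  finally have diag: "(\<Prod>i=1..r. \<Prod>j=1..la i - mu i - 1.
            ((1 - q * inverse t * q ^ j) * (1 - t)) / ((1 - q * inverse t) * (1 - t * q ^ j))) = \<dots>" .
  have "(\<Prod>i=1..r. \<Prod>j=i+1..r. ?C i j) = (\<Prod>i=1..n. \<Prod>j=1..n. if i < j then ?C i j else 1)"
  proof (rule prod.mono_neutral_cong_left)
    show "\<forall>i\<in>{1..n} - {1..r}. (\<Prod>j=1..n. if i < j then ?C i j else 1) = 1"
      using out by (intro ballI prod.neutral) auto
    fix i assume "i \<in> {1..r}"
    show "(\<Prod>j=i+1..r. ?C i j) = (\<Prod>j=1..n. if i < j then ?C i j else 1)"
    proof (rule prod.mono_neutral_cong_left)
      \<comment> \<open>Rows below \<open>r\<close> are empty in both shapes, and \<open>R'\<close>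
        with equal exponents is 1.\<close>
      show "\<forall>j\<in>{1..n} - {i + 1..r}. (if i < j then ?C i j else 1) = 1"
        using out mu0 by (auto intro!: prod.neutral R'_same)
    qed (use r in auto)
  qed (use r in auto)
  then have off: "(\<Prod>i=1..r. \<Prod>j=i+1..r. \<Prod>\<alpha><la i - mu i.
            ((1 - t ^ (j - i + 1) * q powi (int (mu i) + int \<alpha> - int (la j))) *
             (1 - t ^ (j - i) * q powi (int (mu i) + int \<alpha> - int (mu j)))) /
            ((1 - t ^ (j - i) * q powi (int (mu i) + int \<alpha> - int (la j))) *
             (1 - t ^ (j - i + 1) * q powi (int (mu i) + int \<alpha> - int (mu j))))) =
    (\<Prod>i=1..n. \<Prod>j=1..n. if i < j then ?C i j else 1)"
    unfolding prod_R' .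
  have ij: "(if i \<le> j then inverse (?B i j) else 1) * (if i < j then ?A i j else 1) *
      (if i = j then ?D i else 1) * (if i < j then ?C i j else 1) =
     (\<Prod>k=mu i..<la i. if i = j then c0 else 1) * (\<Prod>k=mu i..<la i. if i < j then t else 1) *
     ((if i \<le> j then \<Prod>k=mu i..<la i. rows.g q (inverse t) (rows_at t n) j i (mu j) (Suc k) else 1) *
      (if i < j then \<Prod>k=mu i..<la i. rows.g q (inverse t) (rows_at t n) i j k (la j) else 1))"
    if "j \<in> {1..n}" for i j
  proof -
    consider "i < j" | "i = j" | "j < i" by linarith
    then show ?thesis
    proof cases
      case 1
      have "inverse (?B i j) * ?A i j * ?C i j = (\<Prod>k=mu i..<la i. t * (rows.g q (inverse t) (rows_at t n) j i (mu j) (Suc k) *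
         rows.g q (inverse t) (rows_at t n) i j k (la j)))"
        unfolding prod_inversef[symmetric] prod.distrib[symmetric]
        by (rule prod.cong) (use g_h_hyper[OF 1, of n] that in auto)
      then show ?thesis using 1 by (simp add: prod.distrib mult_ac)
    next
      case 2
      have "inverse (?B i i) * ?D i = (\<Prod>k=mu i..<la i. c0 * rows.g q (inverse t) (rows_at t n) i i (mu i) (Suc k))"
        unfolding prod_inversef[symmetric] prod.distrib[symmetric]
      proof (intro prod.cong refl)
        fix k assume "k \<in> {mu i..<la i}"
        then have *: "inverse (R 0 (mu i) k) * ((1 - q / t * q ^ (k - mu i)) / (1 - t * q ^ (k - mu i))) =
            rows.g q (inverse t) (rows_at t n) i i (mu i) (Suc k)"
          using that 2 by (intro h_hyper_diag) auto
        show "(inverse \<circ> R (i - i) (mu i)) k * (c0 * ((1 - q / t * q ^ (k - mu i)) / (1 - t * q ^ (k - mu i)))) =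
          c0 * rows.g q (inverse t) (rows_at t n) i i (mu i) (Suc k)"
          unfolding *[symmetric] by simp
      qed
      then show ?thesis using 2 by (simp add: prod.distrib mult_ac)
    qed auto
  qed
  have "hyper_layer la mu r = (\<Prod>i=1..n. \<Prod>k=mu i..<la i. R (n - i) 0 k) *
    (\<Prod>i=1..n. \<Prod>j=1..n. (if i \<le> j then inverse (?B i j) else 1) * (if i < j then ?A i j else 1) *
      (if i = j then ?D i else 1) * (if i < j then ?C i j else 1))"
    unfolding hyper_layer_def fC diag off prod.distrib by (simp only: mult_ac)
  also have "(\<Prod>i=1..n. \<Prod>j=1..n. (if i \<le> j then inverse (?B i j) else 1) * (if i < j then ?A i j else 1) *
      (if i = j then ?D i else 1) * (if i < j then ?C i j else 1)) =
     (\<Prod>i=1..n. \<Prod>j=1..n. (\<Prod>k=mu i..<la i. if i = j then c0 else 1) * (\<Prod>k=mu i..<la i. if i < j then t else 1) *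
     ((if i \<le> j then \<Prod>k=mu i..<la i. rows.g q (inverse t) (rows_at t n) j i (mu j) (Suc k) else 1) *
      (if i < j then \<Prod>k=mu i..<la i. rows.g q (inverse t) (rows_at t n) i j k (la j) else 1)))"
    by (intro prod.cong refl ij)
  also have "\<dots> = (\<Prod>i=1..n. \<Prod>j=1..n. \<Prod>k=mu i..<la i. if i = j then c0 else 1) *
     (\<Prod>i=1..n. \<Prod>j=1..n. \<Prod>k=mu i..<la i. if i < j then t else 1) *
     rows.layer q (inverse t) (rows_at t n) n la mu"
    unfolding rows.layer_def prod.distrib by (rule refl)
  also have "(\<Prod>i=1..n. \<Prod>j=1..n. \<Prod>k=mu i..<la i. if i < j then t else 1) =
     (\<Prod>i=1..n. \<Prod>k=mu i..<la i. \<Prod>j=1..n. if i < j then t else 1)"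
    by (intro prod.cong refl prod.swap)
  also have "(\<Prod>i=1..n. \<Prod>j=1..n. \<Prod>k=mu i..<la i. if i = j then c0 else 1) =
     (\<Prod>i=1..n. \<Prod>k=mu i..<la i. \<Prod>j=1..n. if i = j then c0 else 1)"
    by (intro prod.cong refl prod.swap)
  also have "\<dots> = (\<Prod>i=1..n. \<Prod>k=mu i..<la i. c0)" by (intro prod.cong refl) simp
  finally show ?thesis by (simp only: cocycle_def c_hyper_def prod.distrib mult_ac)
qed

end

section \<open>Commuting kernels\<close>

lemma partition_antimono: "is_partition p \<Longrightarrow> 1 \<le> i \<Longrightarrow> i \<le> j \<Longrightarrow> p j \<le> p i"
  by (auto simp: is_partition_def)

lemma is_partitionI:
  assumes "\<And>i. 1 \<le> i \<Longrightarrow> p (Suc i) \<le> p i" "\<And>i. n < i \<Longrightarrow> p i = 0"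
  shows "is_partition p"
  unfolding is_partition_def
proof (intro conjI allI impI)
  fix i j :: nat assume ij: "1 \<le> i \<and> i \<le> j"
  then have "i \<le> j" by simp
  then show "p j \<le> p i" using ij
  proof (induction j rule: dec_induct)
    case (step m) then show ?case using assms(1)[of m] by auto
  qed auto
next
  have "{i. 1 \<le> i \<and> p i \<noteq> 0} \<subseteq> {..n}" using assms(2) by (auto simp: not_less[symmetric])
  then show "finite {i. 1 \<le> i \<and> p i \<noteq> 0}" by (rule finite_subset) simp
qed

lemma partition_eq_0: "is_partition p \<Longrightarrow> len p < i \<Longrightarrow> p i = 0"
  using partition_nz_iff[of p i] by auto

lemma finite_diagram: "is_partition p \<Longrightarrow> finite (diagram p)"
proof -
  assume p: "is_partition p"
  have "i \<le> len p \<and> j \<le> p 1" if "(i, j) \<in> diagram p" for i j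
  proof -
    have "1 \<le> i" "1 \<le> j" "j \<le> p i" using that by (auto simp: diagram_def)
    then show ?thesis using partition_nz_iff[OF p, of i] partition_antimono[OF p, of 1 i] by auto
  qed
  then have "diagram p \<subseteq> {..len p} \<times> {..p 1}" by auto
  then show ?thesis by (rule finite_subset) simp
qed

lemma diagram_mono: "p \<le> r \<Longrightarrow> diagram p \<subseteq> diagram r"
  by (auto simp: diagram_def le_fun_def intro: order_trans)

lemma conj_part_iff:
  assumes p: "is_partition p" and ij: "1 \<le> i" "1 \<le> j"
  shows "i \<le> conj_part p j \<longleftrightarrow> j \<le> p i"
proof -
  \<comment> \<open>The indicator of the rows of length at least \<open>j\<close> is itself a
    partition, and its number of parts is \<open>conj_part p j\<close>.\<close>
  define q where "q = (\<lambda>i. if 1 \<le> i \<and> j \<le> p i then 1 else 0 :: nat)"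
  have "is_partition q"
  proof (rule is_partitionI[where n = "len p"])
    show "q (Suc i) \<le> q i" if "1 \<le> i" for i
      using partition_antimono[OF p that, of "Suc i"] that by (auto simp: q_def)
    show "q i = 0" if "len p < i" for i using partition_eq_0[OF p that] ij by (simp add: q_def)
  qed
  moreover have "len q = conj_part p j"
    unfolding len_def conj_part_def using ij by (intro arg_cong[where f = card]) (auto simp: q_def diagram_def)
  moreover have "q i \<noteq> 0 \<longleftrightarrow> j \<le> p i" using ij by (simp add: q_def)
  ultimately show ?thesis using partition_nz_iff[of q i] ij by simp
qed

lemma conj_part_0: "conj_part p 0 = 0"
  by (simp add: conj_part_def diagram_def)

lemma diagram_conj: "is_partition p \<Longrightarrow> diagram (conj_part p) = prod.swap ` diagram p"
  by (force simp: diagram_def conj_part_iff)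

lemma is_partition_conj:
  assumes p: "is_partition p" shows "is_partition (conj_part p)"
proof (rule is_partitionI[where n = "p 1"])
  fix j :: nat assume j: "1 \<le> j"
  show "conj_part p (Suc j) \<le> conj_part p j"
  proof (cases "conj_part p (Suc j) = 0")
    case False
    then show ?thesis using conj_part_iff[OF p, of "conj_part p (Suc j)"] j by (meson Suc_leD less_one linorder_not_le order_refl le_SucI)
  qed simp
next
  fix j assume j: "p 1 < j"
  then show "conj_part p j = 0" using conj_part_iff[OF p, of 1 j] by (cases "conj_part p j = 0") auto
qed

lemma parts_eqI:
  assumes "p 0 = r 0" "\<And>i j. 1 \<le> i \<Longrightarrow> 1 \<le> j \<Longrightarrow> j \<le> p i \<longleftrightarrow> j \<le> r i"
  shows "p = (r :: parts)"
proof
  fix i show "p i = r i"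
  proof (cases "i = 0")
    case False
    then show ?thesis using assms(2)[of i "p i"] assms(2)[of i "r i"] by (cases "p i = 0"; cases "r i = 0") auto
  qed (use assms in simp)
qed

lemma conj_conj: "is_partition p \<Longrightarrow> p 0 = 0 \<Longrightarrow> conj_part (conj_part p) = p"
  by (rule parts_eqI) (auto simp: conj_part_0 conj_part_iff is_partition_conj)

lemma conj_mono: "is_partition p \<Longrightarrow> is_partition r \<Longrightarrow> p \<le> r \<Longrightarrow> conj_part p \<le> conj_part r"
  unfolding conj_part_def le_fun_def
proof (intro allI card_mono)
  fix j assume pr: "is_partition r" "\<forall>i. p i \<le> r i"
  show "finite {i. (i, j) \<in> diagram r}"
    by (rule finite_subset[OF _ finite_imageI[OF finite_diagram[OF pr(1)], of fst]]) force
  show "{i. (i, j) \<in> diagram p} \<subseteq> {i. (i, j) \<in> diagram r}"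
    using pr(2) by (auto simp: diagram_def intro: order_trans)
qed

text \<open>Counting boxes of the diagram makes the size invariant under transposition, with no
  reference to a number of rows.\<close>

definition psize :: "parts \<Rightarrow> nat" where "psize p = card (diagram p)"

lemma psize_mono: "is_partition r \<Longrightarrow> p \<le> r \<Longrightarrow> psize p \<le> psize r"
  unfolding psize_def by (intro card_mono finite_diagram diagram_mono)

lemma psize_conj: "is_partition p \<Longrightarrow> psize (conj_part p) = psize p"
  unfolding psize_def by (simp add: diagram_conj card_image)

lemma psize_eq_size_rows:
  assumes "\<And>i. i \<notin> {1..n} \<Longrightarrow> p i = 0"
  shows "psize p = size_rows n p"
proof -
  have "diagram p = Sigma {1..n} (\<lambda>i. {1..p i})"
    using assms by (fastforce simp: diagram_def)
  then show ?thesis by (simp add: psize_def rows.size_rows_def)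
qed

text \<open>
  With \<open>lam 0 = 0\<close> the meaningless \<open>0\<close>-th parts vanish, so that transposition is an involution.
\<close>

definition subparts :: "parts \<Rightarrow> parts set" where
  "subparts lam = {p. is_partition p \<and> p \<le> lam}"

lemma finite_subparts:
  assumes "is_partition lam" "lam 0 = 0" shows "finite (subparts lam)"
proof -
  have "p i \<le> lam 1" "len lam < i \<Longrightarrow> p i = 0" if "p \<in> subparts lam" for p i
  proof -
    have le: "p i \<le> lam i" using that by (auto simp: subparts_def le_fun_def)
    show "p i \<le> lam 1" using le assms(2) partition_antimono[OF assms(1), of 1 i] by (cases "i = 0") auto
    show "p i = 0" if "len lam < i" using le partition_eq_0[OF assms(1) that] by simp
  qed
  then have "subparts lam \<subseteq> {p. \<forall>i. (i \<in> {..len lam} \<longrightarrow> p i \<in> {..lam 1}) \<and> (i \<notin> {..len lam} \<longrightarrow> p i = 0)}"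
    by auto
  then show ?thesis by (rule finite_subset) (rule finite_set_of_finite_funs; simp)
qed

text \<open>Commutation of transfer operators without the variables: \<open>r\<close> boxes in the
  inner step on the left, \<open>r\<close> boxes in the outer step on the right.\<close>

definition kernel_commutes :: "parts set \<Rightarrow> (parts \<Rightarrow> parts \<Rightarrow> complex) \<Rightarrow> bool" where
  "kernel_commutes X u \<longleftrightarrow> (\<forall>la\<in>X. \<forall>mu\<in>X. \<forall>r.
     (\<Sum>nu | nu \<in> X \<and> psize nu = psize mu + r. u la nu * u nu mu) =
     (\<Sum>nu | nu \<in> X \<and> psize nu + r = psize la. u la nu * u nu mu))"

definition hstrip :: "parts \<Rightarrow> parts \<Rightarrow> bool" where
  "hstrip la mu \<longleftrightarrow> mu \<le> la \<and> (\<forall>i\<ge>1. la (Suc i) \<le> mu i)"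

lemma subparts_out: "is_partition lam \<Longrightarrow> lam 0 = 0 \<Longrightarrow> p \<le> lam \<Longrightarrow> i \<notin> {1..len lam} \<Longrightarrow> p i = 0"
proof -
  assume lam: "is_partition lam" "lam 0 = 0" "p \<le> lam" "i \<notin> {1..len lam}"
  then have "lam i = 0" using partition_eq_0[of lam i] by (cases "i = 0") auto
  moreover have "p i \<le> lam i" using lam(3) by (simp add: le_fun_def)
  ultimately show "p i = 0" by simp
qed

text \<open>The layer identity sums over all functions between \<open>mu\<close> and
  \<open>la\<close>, the kernel only over partitions related by \<open>C\<close>;
  \<open>zero\<close> says that the surplus terms vanish. Since \<open>cocycle\<close> is
  multiplicative, it comes out of both sums as one factor.\<close>

lemma kernel_commutes_layer:
  assumes lam: "is_partition lam" "lam 0 = 0" and adm: "admissible q t b"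
  defines "w \<equiv> rows.layer q b (rows_at t (len lam)) (len lam)"
  assumes u: "\<And>la mu. la \<in> subparts lam \<Longrightarrow> mu \<in> subparts lam \<Longrightarrow>
      u la mu = (if C la mu then cocycle c (len lam) la mu * w la mu else 0)"
    and C: "\<And>la mu. la \<in> subparts lam \<Longrightarrow> mu \<in> subparts lam \<Longrightarrow> C la mu \<Longrightarrow> mu \<le> la"
    and zero: "\<And>la mu nu. la \<in> subparts lam \<Longrightarrow> mu \<in> subparts lam \<Longrightarrow> mu \<le> nu \<Longrightarrow> nu \<le> la \<Longrightarrow>
      w la nu * w nu mu \<noteq> 0 \<Longrightarrow> is_partition nu \<and> C la nu \<and> C nu mu"
  shows "kernel_commutes (subparts lam) u"
  unfolding kernel_commutes_def
proof (intro ballI allI)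
  fix la mu r assume la: "la \<in> subparts lam" and mu: "mu \<in> subparts lam"
  let ?X = "subparts lam" and ?n = "len lam"
  have X: "is_partition p" "p \<le> lam" if "p \<in> ?X" for p using that by (auto simp: subparts_def)
  have uz: "mu \<le> nu \<and> nu \<le> la" if "nu \<in> ?X" "u la nu * u nu mu \<noteq> 0" for nu
    using that u[OF la, of nu] u[OF _ mu, of nu] C[OF la, of nu] C[OF _ mu, of nu] by (auto split: if_splits)
  show "(\<Sum>nu | nu \<in> ?X \<and> psize nu = psize mu + r. u la nu * u nu mu) =
     (\<Sum>nu | nu \<in> ?X \<and> psize nu + r = psize la. u la nu * u nu mu)"
  proof (cases "mu \<le> la")
    case True
    have size: "psize nu = size_rows ?n nu" if "nu \<le> lam" for nu
      by (rule psize_eq_size_rows) (use subparts_out[OF lam that] in auto)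
    have conv: "(\<Sum>nu | nu \<in> ?X \<and> P (psize nu). u la nu * u nu mu) =
      cocycle c ?n la mu * (\<Sum>nu | nu \<in> {mu..la} \<and> P (size_rows ?n nu). w la nu * w nu mu)" for P
    proof -
      let ?S = "{nu. nu \<in> {mu..la} \<and> nu \<in> ?X \<and> P (psize nu)}"
      have "(\<Sum>nu | nu \<in> ?X \<and> P (psize nu). u la nu * u nu mu) = (\<Sum>nu\<in>?S. u la nu * u nu mu)"
        by (rule sum.mono_neutral_right) (use uz finite_subparts[OF lam] in auto)
      also have "\<dots> = (\<Sum>nu\<in>?S. cocycle c ?n la mu * (w la nu * w nu mu))"
      proof (rule sum.cong)
        fix nu assume nu: "nu \<in> ?S"
        then have le: "nu \<in> ?X" "mu \<le> nu" "nu \<le> la" by auto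
        show "u la nu * u nu mu = cocycle c ?n la mu * (w la nu * w nu mu)"
        proof (cases "w la nu * w nu mu = 0")
          case False
          then show ?thesis using zero[OF la mu le(2,3)] u[OF la le(1)] u[OF le(1) mu] 
            by (simp add: cocycle_mult[OF le(2,3), symmetric])
        qed (use u[OF la le(1)] u[OF le(1) mu] in auto)
      qed simp
      also have "\<dots> = (\<Sum>nu | nu \<in> {mu..la} \<and> P (size_rows ?n nu). cocycle c ?n la mu * (w la nu * w nu mu))"
      proof (rule sum.mono_neutral_left)
        have le: "nu \<le> lam" if "nu \<in> {mu..la}" for nu using that X(2)[OF la] by auto
        have "{nu. nu \<in> {mu..la} \<and> P (size_rows ?n nu)} \<subseteq>
          {p. \<forall>i. (i \<in> {1..?n} \<longrightarrow> p i \<in> {..lam 1}) \<and> (i \<notin> {1..?n} \<longrightarrow> p i = 0)}"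
        proof safe
          fix nu i assume nu: "nu \<in> {mu..la}"
          note nu = le[OF nu]
          show "nu i = 0" if "i \<notin> {1..?n}" using subparts_out[OF lam nu that] .
          show "nu i \<le> lam 1" if "i \<in> {1..?n}"
            using nu partition_antimono[OF lam(1), of 1 i] that by (auto simp: le_fun_def intro: order_trans)
        qed
        then show "finite {nu. nu \<in> {mu..la} \<and> P (size_rows ?n nu)}"
          by (rule finite_subset) (rule finite_set_of_finite_funs; simp)
        show "?S \<subseteq> {nu. nu \<in> {mu..la} \<and> P (size_rows ?n nu)}" using size le by auto
        show "\<forall>nu\<in>{nu. nu \<in> {mu..la} \<and> P (size_rows ?n nu)} - ?S. cocycle c ?n la mu * (w la nu * w nu mu) = 0"
        proof
          fix nu assume "nu \<in> {nu. nu \<in> {mu..la} \<and> P (size_rows ?n nu)} - ?S"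
          then have nu: "nu \<in> {mu..la}" "\<not> is_partition nu" using size[OF le] le by (auto simp: subparts_def)
          then show "cocycle c ?n la mu * (w la nu * w nu mu) = 0" using zero[OF la mu] by auto
        qed
      qed
      finally show ?thesis by (simp only: sum_distrib_left)
    qed
    have "(\<Sum>nu | nu \<in> {mu..la} \<and> size_rows ?n nu = size_rows ?n mu + r. w la nu * w nu mu) =
      (\<Sum>nu | nu \<in> {mu..la} \<and> size_rows ?n nu + r = size_rows ?n la. w la nu * w nu mu)"
      unfolding w_def by (rule layer_sum_symmetric_at[OF adm True]) (use subparts_out[OF lam X(2)[OF la]] in auto)
    then show ?thesis
      using conv[of "\<lambda>s. s = psize mu + r"] conv[of "\<lambda>s. s + r = psize la"] size[OF X(2)[OF la]] size[OF X(2)[OF mu]]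
      by simp
  next
    case False
    then have "u la nu * u nu mu = 0" if "nu \<in> ?X" for nu using uz[OF that] by (meson order_trans)
    then have "(\<Sum>nu | nu \<in> ?X \<and> P (psize nu). u la nu * u nu mu) = 0" for P
      by (intro sum.neutral) blast
    from this[of "\<lambda>s. s = psize mu + r"] this[of "\<lambda>s. s + r = psize la"] show ?thesis by simp
  qed
qed

section \<open>The kernels of ordinary, hyper and super entries\<close>

context generic_qt
begin

definition kernel0 :: "parts \<Rightarrow> parts \<Rightarrow> complex" where
  "kernel0 la mu = (if hstrip la mu then psi q t la mu else 0)"

definition kernel2 :: "nat \<Rightarrow> parts \<Rightarrow> parts \<Rightarrow> complex" where
  "kernel2 n la mu = (if mu \<le> la then hyper_layer la mu n else 0)"

lemma subparts_len: "is_partition lam \<Longrightarrow> mu \<in> subparts lam \<Longrightarrow> len mu \<le> len lam"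
proof (rule ccontr)
  assume *: "is_partition lam" "mu \<in> subparts lam" "\<not> len mu \<le> len lam"
  then have "mu (len mu) \<noteq> 0" using partition_nz_iff[of mu "len mu"] by (auto simp: subparts_def)
  moreover have "mu (len mu) \<le> lam (len mu)" using * by (auto simp: subparts_def le_fun_def)
  ultimately show False using partition_eq_0[of lam "len mu"] * by simp
qed

theorem kernel0_commutes:
  assumes lam: "is_partition lam" "lam 0 = 0"
  shows "kernel_commutes (subparts lam) kernel0"
proof (rule kernel_commutes_layer[OF lam admissible_cases(1)[OF generic], where C = hstrip and c = "c_ordinary (len lam)"])
  let ?n = "len lam"
  let ?w = "rows.layer q (t / q) (rows_at t ?n) ?n"
  have X: "is_partition p" "p \<le> lam" if "p \<in> subparts lam" for p using that by (auto simp: subparts_def)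
  show "mu \<le> la" if "hstrip la mu" for la mu using that by (simp add: hstrip_def)
  show "kernel0 la mu = (if hstrip la mu then cocycle (c_ordinary ?n) ?n la mu * ?w la mu else 0)"
    if "la \<in> subparts lam" "mu \<in> subparts lam" for la mu
    using psi_eq_layer[OF X(1)[OF that(2)] subparts_len[OF lam(1) that(2)], of la] subparts_out[OF lam X(2)[OF that(1)]]
    by (auto simp: kernel0_def hstrip_def)
  fix la mu nu assume la: "la \<in> subparts lam" and mu: "mu \<in> subparts lam" and le: "mu \<le> nu" "nu \<le> la"
    and ne: "?w la nu * ?w nu mu \<noteq> 0"
  have nula: "nu i \<le> la i" for i using le by (simp add: le_fun_def)
  have la0: "la (Suc i) = 0" if "?n \<le> i" for i using subparts_out[OF lam X(2)[OF la], of "Suc i"] that by simp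
  \<comment> \<open>The vanishing criterion requires a decreasing outer shape, so the outer layer is
    treated before the inner one: it gives the interlacing that makes \<open>nu\<close>
    decreasing.\<close>
  have 1: "la (Suc i) \<le> nu i" if "1 \<le> i" for i
  proof (rule ccontr)
    assume *: "\<not> la (Suc i) \<le> nu i"
    then have "i < ?n" using la0[of i] by (cases "i < ?n") auto
    moreover have "la (Suc i) \<le> la i" using partition_antimono[OF X(1)[OF la] that] by simp
    ultimately show False using layer_ordinary_eq_0[OF nz that, of ?n nu la] ne * by simp
  qed
  have anti: "nu (Suc i) \<le> nu i" if "1 \<le> i" for i using 1[OF that] nula[of "Suc i"] by simp
  have part: "is_partition nu"
  proof (rule is_partitionI[where n = ?n])
    show "nu i = 0" if "?n < i" for i using nula[of i] subparts_out[OF lam X(2)[OF la], of i] that by simp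
  qed (rule anti)
  have 2: "nu (Suc i) \<le> mu i" if "1 \<le> i" for i
  proof (rule ccontr)
    assume *: "\<not> nu (Suc i) \<le> mu i"
    then have "i < ?n" using la0[of i] nula[of "Suc i"] by (cases "i < ?n") auto
    then show False using layer_ordinary_eq_0[OF nz that, of ?n mu nu] anti[OF that] ne * by simp
  qed
  show "is_partition nu \<and> hstrip la nu \<and> hstrip nu mu"
    using part 1 2 le by (auto simp: hstrip_def)
qed

text \<open>Hyper layers carry no strip condition. It suffices that the outer factor vanishes when
  its inner shape \<open>nu\<close> has an ascent.\<close>

theorem kernel2_commutes:
  assumes lam: "is_partition lam" "lam 0 = 0"
  shows "kernel_commutes (subparts lam) (kernel2 (len lam))"
proof (rule kernel_commutes_layer[OF lam admissible_cases(2)[OF generic], where C = "\<lambda>la mu. mu \<le> la" and c = "c_hyper (len lam)"])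
  let ?n = "len lam"
  let ?w = "rows.layer q (inverse t) (rows_at t ?n) ?n"
  have X: "is_partition p" "p \<le> lam" if "p \<in> subparts lam" for p using that by (auto simp: subparts_def)
  show "kernel2 ?n la mu = (if mu \<le> la then cocycle (c_hyper ?n) ?n la mu * ?w la mu else 0)"
    if "la \<in> subparts lam" "mu \<in> subparts lam" for la mu
    using hyper_layer_eq[OF X(1)[OF that(2)] order_refl, of la] subparts_out[OF lam X(2)[OF that(1)]]
    by (auto simp: kernel2_def)
  fix la mu nu assume la: "la \<in> subparts lam" and mu: "mu \<in> subparts lam" and le: "mu \<le> nu" "nu \<le> la"
    and ne: "?w la nu * ?w nu mu \<noteq> 0"
  have nula: "nu i \<le> la i" for i using le by (simp add: le_fun_def)
  have la0: "la (Suc i) = 0" if "?n \<le> i" for i using subparts_out[OF lam X(2)[OF la], of "Suc i"] that by simp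
  have "is_partition nu"
  proof (rule is_partitionI[where n = ?n])
    show "nu i = 0" if "?n < i" for i using nula[of i] subparts_out[OF lam X(2)[OF la], of i] that by simp
    show "nu (Suc i) \<le> nu i" if "1 \<le> i" for i
    proof (rule ccontr)
      assume *: "\<not> nu (Suc i) \<le> nu i"
      then have "i < ?n" using la0[of i] nula[of "Suc i"] by (cases "i < ?n") auto
      moreover have "nu (Suc i) \<le> la i" using partition_antimono[OF X(1)[OF la] that, of "Suc i"] nula[of "Suc i"] by simp
      ultimately show False using layer_hyper_eq_0[OF nz that, of ?n nu la] ne * by simp
    qed
  qed
  then show "is_partition nu \<and> nu \<le> la \<and> mu \<le> nu" using le by simp
qed

definition kernel1 :: "parts \<Rightarrow> parts \<Rightarrow> complex" where
  "kernel1 la mu = (if hstrip (conj_part la) (conj_part mu) then psi t q (conj_part la) (conj_part mu) else 0)"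

text \<open>Genericity is symmetric in \<open>q\<close> and \<open>t\<close>, so the ordinary case
  is available with the parameters interchanged. Transposition is a size-preserving bijection
  between the index sets of the two sums.\<close>

theorem kernel1_commutes:
  assumes lam: "is_partition lam" "lam 0 = 0"
  shows "kernel_commutes (subparts lam) kernel1"
proof -
  let ?lam' = "conj_part lam" and ?X = "subparts lam" and ?X' = "subparts (conj_part lam)"
  have "generic_parameters t q"
    using generic unfolding generic_parameters_def by (metis mult.commute)
  then interpret D: generic_qt t q by unfold_locales
  have lam': "is_partition ?lam'" "?lam' 0 = 0" using is_partition_conj[OF lam(1)] conj_part_0 by auto
  have in': "conj_part p \<in> ?X'" if "p \<in> ?X" for p
    using that conj_mono[OF _ lam(1)] is_partition_conj by (auto simp: subparts_def)
  have out': "conj_part p \<in> ?X" if "p \<in> ?X'" for p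
    using that conj_mono[OF _ lam'(1), of p] is_partition_conj by (auto simp: subparts_def conj_conj[OF lam])
  have p0: "p 0 = 0" if "p \<in> ?X" for p using that lam by (auto simp: subparts_def le_fun_def) (metis le_zero_eq)
  have p0': "p 0 = 0" if "p \<in> ?X'" for p using that lam' by (auto simp: subparts_def le_fun_def) (metis le_zero_eq)
  have part: "is_partition p" if "p \<in> ?X \<or> p \<in> ?X'" for p using that by (auto simp: subparts_def)
  have cc: "conj_part (conj_part p) = p" and psize': "psize (conj_part p) = psize p" if "p \<in> ?X \<or> p \<in> ?X'" for p
    using that part[OF that] p0 p0' conj_conj psize_conj by auto
  have conv: "(\<Sum>nu | nu \<in> ?X \<and> P (psize nu). kernel1 la nu * kernel1 nu mu) =
    (\<Sum>nu | nu \<in> ?X' \<and> P (psize nu). D.kernel0 (conj_part la) nu * D.kernel0 nu (conj_part mu))" for la mu P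
    by (rule sum.reindex_bij_witness[of _ conj_part conj_part])
      (auto simp: in' out' cc psize' kernel1_def D.kernel0_def)
  show ?thesis
    unfolding kernel_commutes_def
  proof (intro ballI allI)
    fix la mu r assume la: "la \<in> ?X" and mu: "mu \<in> ?X"
    have "is_partition la" "is_partition mu" using la mu by (auto simp: subparts_def)
    then show "(\<Sum>nu | nu \<in> ?X \<and> psize nu = psize mu + r. kernel1 la nu * kernel1 nu mu) =
     (\<Sum>nu | nu \<in> ?X \<and> psize nu + r = psize la. kernel1 la nu * kernel1 nu mu)"
      using D.kernel0_commutes[OF lam', unfolded kernel_commutes_def, rule_format, OF in'[OF la] in'[OF mu], of r]
      unfolding conv[where P = "\<lambda>s. s = psize mu + r" and la = la and mu = mu]
        conv[where P = "\<lambda>s. s + r = psize la" and la = la and mu = mu]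
      by (simp add: psize_conj)
  qed
qed

end

section \<open>Transfer operators and tableaux\<close>

lemma const_mult: "const (a * b) = const a * const b"
  by (simp add: const_def mult_single)

lemma const_add: "const (a + b) = const a + const b"
  by (simp add: const_def single_add)

lemma const_0: "const 0 = 0" and const_1: "const 1 = 1"
  by (simp_all add: const_def)

lemma const_sum: "const (sum f A) = (\<Sum>i\<in>A. const (f i))"
  by (induction A rule: infinite_finite_induct) (auto simp: const_add const_0)

text \<open>The value 0 outside \<open>X\<close> makes commutation an equality of operators on all
  functions, as permuting a fold requires.\<close>

definition transfer_op :: "parts set \<Rightarrow> (parts \<Rightarrow> parts \<Rightarrow> complex) \<Rightarrow> cpoly \<Rightarrow> (parts \<Rightarrow> cpoly) \<Rightarrow> parts \<Rightarrow> cpoly" where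
  "transfer_op X u x v la = (if la \<in> X then \<Sum>mu\<in>X. const (u la mu) * x ^ (psize la - psize mu) * v mu else 0)"

text \<open>Terms are grouped by the exponent \<open>r\<close> of \<open>y\<close>, which is the
  size of \<open>nu / mu\<close> on the left and of \<open>la / nu\<close> on the right. By
  \<open>size\<close>, terms in which a subtraction would be truncated have coefficient 0.\<close>

lemma kernel_commutes_generating:
  assumes comm: "kernel_commutes X u" and X: "finite X" "la \<in> X" "mu \<in> X"
    and size: "\<And>la mu. la \<in> X \<Longrightarrow> mu \<in> X \<Longrightarrow> u la mu \<noteq> 0 \<Longrightarrow> psize mu \<le> psize la"
  shows "(\<Sum>nu\<in>X. const (u la nu * u nu mu) * x ^ (psize la - psize nu) * y ^ (psize nu - psize mu)) =
    (\<Sum>nu\<in>X. const (u la nu * u nu mu) * y ^ (psize la - psize nu) * x ^ (psize nu - psize mu))"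
proof -
  let ?S = "{nu \<in> X. psize mu \<le> psize nu \<and> psize nu \<le> psize la}"
  let ?d = "psize la - psize mu"
  have red: "(\<Sum>nu\<in>X. const (u la nu * u nu mu) * f nu) = (\<Sum>nu\<in>?S. const (u la nu * u nu mu) * f nu)" for f
  proof (rule sum.mono_neutral_right)
    show "\<forall>nu\<in>X - ?S. const (u la nu * u nu mu) * f nu = 0"
    proof
      fix nu assume "nu \<in> X - ?S"
      then have "u la nu * u nu mu = 0" using size[OF X(2), of nu] size[of nu mu] X(3) by auto
      then show "const (u la nu * u nu mu) * f nu = 0" by (simp only: const_0 mult_zero_left)
    qed
  qed (use X in auto)
  have S: "{nu \<in> ?S. psize nu - psize mu = r} = {nu. nu \<in> X \<and> psize nu = psize mu + r}"
    "{nu \<in> ?S. psize la - psize nu = r} = {nu. nu \<in> X \<and> psize nu + r = psize la}" if "r \<le> ?d" "psize mu \<le> psize la" for r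
    using that by auto
  show ?thesis
  proof (cases "psize mu \<le> psize la")
    case True
    have 1: "(\<Sum>nu\<in>?S. const (u la nu * u nu mu) * (x ^ (psize la - psize nu) * y ^ (psize nu - psize mu))) =
      (\<Sum>r\<in>{..?d}. const (\<Sum>nu | nu \<in> X \<and> psize nu = psize mu + r. u la nu * u nu mu) * (y ^ r * x ^ (?d - r)))"
      (is "?l = _")
    proof -
      have "?l = (\<Sum>r\<in>{..?d}. \<Sum>nu\<in>{nu \<in> ?S. psize nu - psize mu = r}. const (u la nu * u nu mu) * (x ^ (psize la - psize nu) * y ^ (psize nu - psize mu)))"
        by (rule sum.group[symmetric]) (use X in auto)
      also have "\<dots> = (\<Sum>r\<in>{..?d}. \<Sum>nu\<in>{nu \<in> ?S. psize nu - psize mu = r}. const (u la nu * u nu mu) * (y ^ r * x ^ (?d - r)))"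
        by (intro sum.cong refl) (auto simp: mult.commute)
      also have "\<dots> = (\<Sum>r\<in>{..?d}. const (\<Sum>nu | nu \<in> X \<and> psize nu = psize mu + r. u la nu * u nu mu) * (y ^ r * x ^ (?d - r)))"
        by (rule sum.cong[OF refl]) (simp only: S(1) True atMost_iff const_sum sum_distrib_right)
      finally show ?thesis .
    qed
    have 2: "(\<Sum>nu\<in>?S. const (u la nu * u nu mu) * (y ^ (psize la - psize nu) * x ^ (psize nu - psize mu))) =
      (\<Sum>r\<in>{..?d}. const (\<Sum>nu | nu \<in> X \<and> psize nu + r = psize la. u la nu * u nu mu) * (y ^ r * x ^ (?d - r)))"
      (is "?l = _")
    proof -
      have "?l = (\<Sum>r\<in>{..?d}. \<Sum>nu\<in>{nu \<in> ?S. psize la - psize nu = r}. const (u la nu * u nu mu) * (y ^ (psize la - psize nu) * x ^ (psize nu - psize mu)))"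
        by (rule sum.group[symmetric]) (use X in auto)
      also have "\<dots> = (\<Sum>r\<in>{..?d}. \<Sum>nu\<in>{nu \<in> ?S. psize la - psize nu = r}. const (u la nu * u nu mu) * (y ^ r * x ^ (?d - r)))"
        by (intro sum.cong refl) auto
      also have "\<dots> = (\<Sum>r\<in>{..?d}. const (\<Sum>nu | nu \<in> X \<and> psize nu + r = psize la. u la nu * u nu mu) * (y ^ r * x ^ (?d - r)))"
        by (rule sum.cong[OF refl]) (simp only: S(2) True atMost_iff const_sum sum_distrib_right)
      finally show ?thesis .
    qed
    show ?thesis
      unfolding mult.assoc red 1 2 comm[unfolded kernel_commutes_def, rule_format, OF X(2,3)] ..
  next
    case False
    then have "?S = {}" by auto
    then show ?thesis unfolding mult.assoc red by (simp only: sum.empty)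
  qed
qed

lemma transfer_op_commute:
  assumes comm: "kernel_commutes X u" and X: "finite X"
    and size: "\<And>la mu. la \<in> X \<Longrightarrow> mu \<in> X \<Longrightarrow> u la mu \<noteq> 0 \<Longrightarrow> psize mu \<le> psize la"
  shows "transfer_op X u x \<circ> transfer_op X u y = transfer_op X u y \<circ> transfer_op X u x"
proof (rule ext, rule ext)
  fix v la
  have exp: "(transfer_op X u x \<circ> transfer_op X u y) v la = (\<Sum>mu\<in>X. 
     (\<Sum>nu\<in>X. const (u la nu * u nu mu) * x ^ (psize la - psize nu) * y ^ (psize nu - psize mu)) * v mu)"
    if "la \<in> X" for x y
  proof -
    have "(transfer_op X u x \<circ> transfer_op X u y) v la = (\<Sum>nu\<in>X. \<Sum>mu\<in>X.
       const (u la nu * u nu mu) * x ^ (psize la - psize nu) * y ^ (psize nu - psize mu) * v mu)"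
      using that by (simp add: transfer_op_def sum_distrib_left const_mult mult_ac)
    also have "\<dots> = (\<Sum>mu\<in>X. \<Sum>nu\<in>X.
       const (u la nu * u nu mu) * x ^ (psize la - psize nu) * y ^ (psize nu - psize mu) * v mu)"
      by (rule sum.swap)
    finally show ?thesis by (simp add: sum_distrib_right)
  qed
  show "(transfer_op X u x \<circ> transfer_op X u y) v la = (transfer_op X u y \<circ> transfer_op X u x) v la"
  proof (cases "la \<in> X")
    case True
    show ?thesis unfolding exp[OF True]
      by (intro sum.cong refl arg_cong2[where f = "(*)"] kernel_commutes_generating[OF comm X True _ size])
  qed (simp add: transfer_op_def)
qed

text \<open>The factor at the intermediate shape cancels, and \<open>G la / G mu\<close> is common
  to both sums.\<close>

lemma kernel_commutes_gauge:
  assumes "kernel_commutes X u" "\<And>p. G p \<noteq> (0 :: complex)"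
  shows "kernel_commutes X (\<lambda>la mu. u la mu * (G la / G mu))"
proof -
  have eq: "u la nu * (G la / G nu) * (u nu mu * (G nu / G mu)) = G la / G mu * (u la nu * u nu mu)" for la mu nu
    using assms(2) by simp
  show ?thesis unfolding kernel_commutes_def eq sum_distrib_left[symmetric]
    by (intro ballI allI arg_cong2[where f = "(*)"] refl) (rule assms(1)[unfolded kernel_commutes_def, rule_format])
qed

section \<open>Tableaux with entries at least \<open>k\<close>, and the removal of the boxes with
  entry \<open>k\<close>\<close>

definition tabs :: "nat \<Rightarrow> nat \<Rightarrow> nat \<Rightarrow> nat \<Rightarrow> parts \<Rightarrow> filling set" where
  "tabs N M K k lam = {T \<in> diagram lam \<rightarrow>\<^sub>E {k..K}.
        (\<forall>i j j'. (i, j) \<in> diagram lam \<and> (i, j') \<in> diagram lam \<and> j < j' \<longrightarrow>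
            T (i, j') \<le> T (i, j)) \<and>
        (\<forall>i i' j. (i, j) \<in> diagram lam \<and> (i', j) \<in> diagram lam \<and> i < i' \<longrightarrow>
            T (i', j) \<le> T (i, j)) \<and>
        (\<forall>i i' j. (i, j) \<in> diagram lam \<and> (i', j) \<in> diagram lam \<and> i < i' \<and>
            T (i, j) \<in> {1..N} \<and> T (i', j) \<in> {1..N} \<longrightarrow> T (i', j) < T (i, j)) \<and>
        (\<forall>i j j'. (i, j) \<in> diagram lam \<and> (i, j') \<in> diagram lam \<and> j < j' \<and>
            T (i, j) \<in> {N + 1..N + M} \<and> T (i, j') \<in> {N + 1..N + M} \<longrightarrow>
            T (i, j') < T (i, j))}"

lemma RSSYTT_eq_tabs: "RSSYTT N M L lam = tabs N M (N + M + L) 1 lam"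
  by (simp add: RSSYTT_def tabs_def)

text \<open>The shape condition on the boxes with entry \<open>k\<close>: a horizontal strip for
  ordinary, a vertical strip for super, and no further condition for hyper entries. In terms of
  boxes, transposition just exchanges the first two.\<close>

definition layer_strip :: "nat \<Rightarrow> nat \<Rightarrow> nat \<Rightarrow> parts \<Rightarrow> parts \<Rightarrow> bool" where
  "layer_strip N M k la mu \<longleftrightarrow> mu \<le> la \<and>
     (1 \<le> k \<and> k \<le> N \<longrightarrow> (\<forall>i\<ge>1. \<forall>j. (Suc i, j) \<in> diagram la \<longrightarrow> (i, j) \<in> diagram mu)) \<and>
     (N < k \<and> k \<le> N + M \<longrightarrow> (\<forall>i. \<forall>j\<ge>1. (i, Suc j) \<in> diagram la \<longrightarrow> (i, j) \<in> diagram mu))"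

lemma hstrip_iff:
  "hstrip la mu \<longleftrightarrow> mu \<le> la \<and> (\<forall>i\<ge>1. \<forall>j. (Suc i, j) \<in> diagram la \<longrightarrow> (i, j) \<in> diagram mu)"
proof -
  have "la (Suc i) \<le> mu i \<longleftrightarrow> (\<forall>j. (Suc i, j) \<in> diagram la \<longrightarrow> (i, j) \<in> diagram mu)" if "1 \<le> i" for i
    using that by (cases "la (Suc i) = 0") (auto simp: diagram_def dest: spec[of _ "la (Suc i)"])
  then show ?thesis by (auto simp: hstrip_def)
qed

lemma le_iff_diagram:
  assumes "mu 0 \<le> la 0" shows "mu \<le> la \<longleftrightarrow> diagram mu \<subseteq> diagram la"
proof
  assume *: "diagram mu \<subseteq> diagram la"
  show "mu \<le> la" unfolding le_fun_def
  proof
    fix i show "mu i \<le> la i"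
    proof (cases "i = 0 \<or> mu i = 0")
      case False
      then have "(i, mu i) \<in> diagram mu" by (simp add: diagram_def)
      then show ?thesis using * by (auto simp: diagram_def)
    qed (use assms in auto)
  qed
qed (rule diagram_mono)

lemma hstrip_conj_iff:
  assumes "is_partition la" "is_partition mu" "mu 0 = 0"
  shows "hstrip (conj_part la) (conj_part mu) \<longleftrightarrow>
    mu \<le> la \<and> (\<forall>i. \<forall>j\<ge>1. (i, Suc j) \<in> diagram la \<longrightarrow> (i, j) \<in> diagram mu)"
proof -
  have "(conj_part mu \<le> conj_part la) = (mu \<le> la)"
    using assms by (simp add: le_iff_diagram conj_part_0 diagram_conj image_subset_iff) (auto simp: image_iff)
  moreover have "(j, i) \<in> diagram (conj_part p) \<longleftrightarrow> (i, j) \<in> diagram p" if "is_partition p" for i j p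
    using that by (auto simp: diagram_conj)
  ultimately show ?thesis using assms unfolding hstrip_iff by auto
qed

lemma initial_segment:
  fixes S :: "nat set"
  assumes "finite S" "0 \<notin> S" "\<And>i j. j \<in> S \<Longrightarrow> 1 \<le> i \<Longrightarrow> i \<le> j \<Longrightarrow> i \<in> S"
  shows "S = {1..card S}"
proof (cases "S = {}")
  case False
  then have "Max S \<in> S" using assms(1) by simp
  have "S = {1..Max S}"
  proof
    show "S \<subseteq> {1..Max S}"
    proof
      fix x assume "x \<in> S"
      then show "x \<in> {1..Max S}" using assms(1,2) by (cases x) auto
    qed
  qed (use assms(3)[OF \<open>Max S \<in> S\<close>] in auto)
  moreover from this have "card S = Max S" by (metis card_atLeastAtMost diff_Suc_1)
  ultimately show ?thesis by simp
qed simp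

lemma row_finite: "finite {j. (i, j) \<in> diagram la \<and> P j}"
  by (rule finite_subset[of _ "{..la i}"]) (auto simp: diagram_def)

text \<open>Rows decrease weakly, so the entries at least \<open>k\<close> fill an initial piece of
  each row, and counting them determines their positions.\<close>

lemma diagram_shape_ge:
  assumes row: "\<And>i j j'. (i, j) \<in> diagram la \<Longrightarrow> (i, j') \<in> diagram la \<Longrightarrow> j < j' \<Longrightarrow> T (i, j') \<le> T (i, j)"
  shows "(i, j) \<in> diagram (shape_ge la T k) \<longleftrightarrow> (i, j) \<in> diagram la \<and> k \<le> T (i, j)"
proof -
  let ?S = "{j. (i, j) \<in> diagram la \<and> k \<le> T (i, j)}"
  have "?S = {1..card ?S}"
  proof (rule initial_segment)
    fix i' j assume "j \<in> ?S" "1 \<le> i'" "i' \<le> j"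
    then show "i' \<in> ?S" using row[of i i' j] by (cases "i' = j") (auto simp: diagram_def)
  qed (auto simp: row_finite, auto simp: diagram_def)
  then have "j \<in> ?S \<longleftrightarrow> 1 \<le> j \<and> j \<le> card ?S" by (metis (no_types, lifting) atLeastAtMost_iff)
  then show ?thesis unfolding shape_ge_def diagram_def by auto
qed

lemma shape_ge_0: "shape_ge la T k 0 = 0"
  by (simp add: shape_ge_def diagram_def)

lemma shape_ge_le: "la 0 = 0 \<Longrightarrow> shape_ge la T k \<le> la"
proof (unfold le_fun_def, rule allI)
  fix i
  have "card {j. (i, j) \<in> diagram la \<and> k \<le> T (i, j)} \<le> card {1..la i}"
    by (rule card_mono) (auto simp: diagram_def)
  then show "shape_ge la T k i \<le> la i" by (simp add: shape_ge_def)
qed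

lemma tabsD:
  assumes "T \<in> tabs N M K k la"
  shows "T \<in> diagram la \<rightarrow>\<^sub>E {k..K}"
    and "\<And>i j j'. (i, j) \<in> diagram la \<Longrightarrow> (i, j') \<in> diagram la \<Longrightarrow> j < j' \<Longrightarrow> T (i, j') \<le> T (i, j)"
    and "\<And>i i' j. (i, j) \<in> diagram la \<Longrightarrow> (i', j) \<in> diagram la \<Longrightarrow> i < i' \<Longrightarrow> T (i', j) \<le> T (i, j)"
    and "\<And>i i' j. (i, j) \<in> diagram la \<Longrightarrow> (i', j) \<in> diagram la \<Longrightarrow> i < i' \<Longrightarrow>
      T (i, j) \<in> {1..N} \<Longrightarrow> T (i', j) \<in> {1..N} \<Longrightarrow> T (i', j) < T (i, j)"
    and "\<And>i j j'. (i, j) \<in> diagram la \<Longrightarrow> (i, j') \<in> diagram la \<Longrightarrow> j < j' \<Longrightarrow>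
      T (i, j) \<in> {N + 1..N + M} \<Longrightarrow> T (i, j') \<in> {N + 1..N + M} \<Longrightarrow> T (i, j') < T (i, j)"
  using assms unfolding tabs_def by blast+

lemma shape_ge_partition:
  assumes la: "is_partition la" "la 0 = 0" and T: "T \<in> tabs N M K k la"
  shows "is_partition (shape_ge la T l)"
proof (rule is_partitionI[where n = "len la"])
  show "shape_ge la T l i = 0" if "len la < i" for i
    using le_funD[OF shape_ge_le[of la T l, OF la(2)], of i] partition_eq_0[OF la(1) that] by simp
  fix i :: nat assume i: "1 \<le> i"
  show "shape_ge la T l (Suc i) \<le> shape_ge la T l i"
    unfolding shape_ge_def
  proof (rule card_mono[OF row_finite], safe)
    fix j assume *: "(Suc i, j) \<in> diagram la" "l \<le> T (Suc i, j)"
    then show "(i, j) \<in> diagram la" using partition_antimono[OF la(1) i, of "Suc i"] i by (auto simp: diagram_def)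
    then show "l \<le> T (i, j)" using tabsD(3)[OF T _ *(1), of i] *(2) by simp
  qed
qed

definition extend :: "parts \<Rightarrow> parts \<Rightarrow> nat \<Rightarrow> filling \<Rightarrow> filling" where
  "extend la mu k T = (\<lambda>s\<in>diagram la. if s \<in> diagram mu then T s else k)"

lemma shape_ge_extend:
  assumes "mu \<le> la" "k < l"
  shows "shape_ge la (extend la mu k T) l = shape_ge mu T l"
  unfolding shape_ge_def
  by (intro ext arg_cong[where f = card]) (use assms diagram_mono[OF assms(1)] in \<open>auto simp: extend_def split: if_splits\<close>)

lemma shape_ge_all:
  assumes "la 0 = 0" "\<And>s. s \<in> diagram la \<Longrightarrow> k \<le> T s"
  shows "shape_ge la T k = la"
proof
  fix i
  have "{j. (i, j) \<in> diagram la \<and> k \<le> T (i, j)} = (if i = 0 then {} else {1..la i})"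
    using assms by (auto simp: diagram_def)
  then show "shape_ge la T k i = la i" using assms by (auto simp: shape_ge_def)
qed

lemma extend_in_tabs:
  assumes la: "is_partition la" and mu: "is_partition mu" and k: "1 \<le> k" "k \<le> K"
    and strip: "layer_strip N M k la mu" and T: "T \<in> tabs N M K (Suc k) mu"
  shows "extend la mu k T \<in> tabs N M K k la"
proof -
  let ?E = "extend la mu k T"
  have sub: "diagram mu \<subseteq> diagram la" using strip diagram_mono by (auto simp: layer_strip_def)
  have big: "k < T s" "T s \<le> K" if "s \<in> diagram mu" for s using tabsD(1)[OF T] that by (auto dest: PiE_mem)
  have E: "?E s = (if s \<in> diagram mu then T s else k)" if "s \<in> diagram la" for s using that by (simp add: extend_def)
  have rowc: "(i, j) \<in> diagram mu" if "(i, j') \<in> diagram mu" "(i, j) \<in> diagram la" "j < j'" for i j j'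
    using that by (auto simp: diagram_def)
  have colc: "(i, j) \<in> diagram mu" if "(i', j) \<in> diagram mu" "(i, j) \<in> diagram la" "i < i'" for i i' j
    using that partition_antimono[OF mu, of i i'] by (auto simp: diagram_def)
  have hs: "(i, j) \<in> diagram mu" if "k \<le> N" "(i, j) \<in> diagram la" "(i', j) \<in> diagram la" "i < i'" for i i' j
  proof -
    have "(Suc i, j) \<in> diagram la" using that partition_antimono[OF la, of "Suc i" i'] by (auto simp: diagram_def)
    then show ?thesis using strip that k by (auto simp: layer_strip_def diagram_def)
  qed
  have vs: "(i, j) \<in> diagram mu" if "N < k" "k \<le> N + M" "(i, j) \<in> diagram la" "(i, j') \<in> diagram la" "j < j'" for i j j'
  proof -
    have "(i, Suc j) \<in> diagram la" using that by (auto simp: diagram_def)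
    then show ?thesis using strip that k by (auto simp: layer_strip_def diagram_def)
  qed
  show ?thesis
    unfolding tabs_def
  proof (intro CollectI conjI allI impI)
    show "?E \<in> diagram la \<rightarrow>\<^sub>E {k..K}" using big k by (auto simp: extend_def less_imp_le)
  next
    fix i j j' assume a: "(i, j) \<in> diagram la \<and> (i, j') \<in> diagram la \<and> j < j'"
    show "?E (i, j') \<le> ?E (i, j)"
      using a rowc[of i j' j] big[of "(i, j)"] tabsD(2)[OF T, of i j j'] by (auto simp: E less_imp_le)
  next
    fix i i' j assume a: "(i, j) \<in> diagram la \<and> (i', j) \<in> diagram la \<and> i < i'"
    show "?E (i', j) \<le> ?E (i, j)"
      using a colc[of i' j i] big[of "(i, j)"] tabsD(3)[OF T, of i j i'] by (auto simp: E less_imp_le)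
  next
    fix i i' j assume a: "(i, j) \<in> diagram la \<and> (i', j) \<in> diagram la \<and> i < i' \<and> ?E (i, j) \<in> {1..N} \<and> ?E (i', j) \<in> {1..N}"
    show "?E (i', j) < ?E (i, j)"
    proof (cases "(i', j) \<in> diagram mu")
      case True
      moreover have "(i, j) \<in> diagram mu" using colc[OF True] a by auto
      ultimately show ?thesis using T a by (auto simp: E tabs_def)
    next
      case False
      then have "k \<le> N" using a by (auto simp: E)
      then have "(i, j) \<in> diagram mu" using hs a by blast
      then show ?thesis using False a big by (auto simp: E)
    qed
  next
    fix i j j' assume a: "(i, j) \<in> diagram la \<and> (i, j') \<in> diagram la \<and> j < j' \<and> ?E (i, j) \<in> {N + 1..N + M} \<and> ?E (i, j') \<in> {N + 1..N + M}"
    show "?E (i, j') < ?E (i, j)"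
    proof (cases "(i, j') \<in> diagram mu")
      case True
      moreover have "(i, j) \<in> diagram mu" using rowc[OF True] a by auto
      ultimately show ?thesis using T a by (auto simp: E tabs_def)
    next
      case False
      then have "N < k" "k \<le> N + M" using a by (auto simp: E)
      then have "(i, j) \<in> diagram mu" using vs a by blast
      then show ?thesis using False a big by (auto simp: E)
    qed
  qed
qed

lemma restrict_in_tabs:
  assumes T: "T \<in> tabs N M K k la"
  shows "restrict T (diagram (shape_ge la T (l))) \<in> tabs N M K (l) (shape_ge la T (l))"
proof -
  have d: "(i, j) \<in> diagram (shape_ge la T (l)) \<longleftrightarrow> (i, j) \<in> diagram la \<and> l \<le> T (i, j)" for i j
    by (rule diagram_shape_ge) (rule tabsD(2)[OF T])
  have T1: "T s \<le> K" if "s \<in> diagram la" for s using tabsD(1)[OF T] that by (auto dest: PiE_mem)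
  show ?thesis
    unfolding tabs_def
  proof (intro CollectI conjI)
    show "restrict T (diagram (shape_ge la T (l))) \<in> diagram (shape_ge la T (l)) \<rightarrow>\<^sub>E {l..K}"
      using T1 by (auto simp: d)
  qed (use T in \<open>auto simp: d tabs_def\<close>)
qed

lemma layer_strip_shape_ge:
  assumes la: "is_partition la" "la 0 = 0" and T: "T \<in> tabs N M K k la"
  shows "layer_strip N M k la (shape_ge la T (Suc k))"
proof -
  have d: "(i, j) \<in> diagram (shape_ge la T (Suc k)) \<longleftrightarrow> (i, j) \<in> diagram la \<and> Suc k \<le> T (i, j)" for i j
    by (rule diagram_shape_ge) (rule tabsD(2)[OF T])
  have T1: "k \<le> T s" if "s \<in> diagram la" for s using tabsD(1)[OF T] that by (auto dest: PiE_mem)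
  have "(i, j) \<in> diagram la \<and> Suc k \<le> T (i, j)" if "1 \<le> k" "k \<le> N" "1 \<le> i" "(Suc i, j) \<in> diagram la" for i j
  proof -
    have ij: "(i, j) \<in> diagram la" using that partition_antimono[OF la(1), of i "Suc i"] by (auto simp: diagram_def)
    have "T (Suc i, j) < T (i, j)" if "T (i, j) = k"
    proof -
      have "T (Suc i, j) = k" using tabsD(3)[OF T ij \<open>(Suc i, j) \<in> diagram la\<close>] T1[OF \<open>(Suc i, j) \<in> diagram la\<close>] that by simp
      then show ?thesis using tabsD(4)[OF T ij \<open>(Suc i, j) \<in> diagram la\<close>] \<open>1 \<le> k\<close> \<open>k \<le> N\<close> that by simp
    qed
    then show ?thesis using ij T1[OF ij] T1[OF \<open>(Suc i, j) \<in> diagram la\<close>] by (cases "T (i, j) = k") auto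
  qed
  moreover have "(i, j) \<in> diagram la \<and> Suc k \<le> T (i, j)" if "N < k" "k \<le> N + M" "1 \<le> j" "(i, Suc j) \<in> diagram la" for i j
  proof -
    have ij: "(i, j) \<in> diagram la" using that by (auto simp: diagram_def)
    have "T (i, Suc j) < T (i, j)" if "T (i, j) = k"
    proof -
      have "T (i, Suc j) = k" using tabsD(2)[OF T ij \<open>(i, Suc j) \<in> diagram la\<close>] T1[OF \<open>(i, Suc j) \<in> diagram la\<close>] that by simp
      then show ?thesis using tabsD(5)[OF T ij \<open>(i, Suc j) \<in> diagram la\<close>] \<open>N < k\<close> \<open>k \<le> N + M\<close> that by simp
    qed
    then show ?thesis using ij T1[OF ij] T1[OF \<open>(i, Suc j) \<in> diagram la\<close>] by (cases "T (i, j) = k") auto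
  qed
  ultimately show ?thesis unfolding layer_strip_def d using shape_ge_le[of la, OF la(2)] by blast
qed

text \<open>A tableau corresponds to the shape \<open>mu\<close> of its entries above
  \<open>k\<close> together with its restriction to \<open>mu\<close>; \<open>extend\<close> is the
  inverse, and the column and row conditions on entry \<open>k\<close> become
  \<open>layer_strip\<close>.\<close>

lemma sum_tabs_Suc:
  fixes F :: "filling \<Rightarrow> 'b :: comm_monoid_add"
  assumes la: "is_partition la" "la 0 = 0" and k: "1 \<le> k" "k \<le> K"
  shows "(\<Sum>T\<in>tabs N M K k la. F T) = 
     (\<Sum>mu | mu \<in> subparts la \<and> layer_strip N M k la mu. \<Sum>T\<in>tabs N M K (Suc k) mu. F (extend la mu k T))"
proof -
  let ?B = "{mu. mu \<in> subparts la \<and> layer_strip N M k la mu}"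
  have fin: "finite (tabs N M K (Suc k) mu)" if "mu \<in> ?B" for mu
    using that by (intro finite_subset[OF _ finite_PiE[OF finite_diagram, of mu "\<lambda>_. {Suc k..K}"]])
      (auto simp: tabs_def subparts_def)
  have finB: "finite ?B" using finite_subparts[OF la] by simp
  have part: "is_partition mu" "mu \<le> la" if "mu \<in> ?B" for mu using that by (auto simp: subparts_def)
  have "(\<Sum>T\<in>tabs N M K k la. F T) = (\<Sum>(mu, T)\<in>Sigma ?B (tabs N M K (Suc k)). F (extend la mu k T))"
  proof (rule sum.reindex_bij_witness[of _ "\<lambda>(mu, T). extend la mu k T"
       "\<lambda>T. (shape_ge la T (Suc k), restrict T (diagram (shape_ge la T (Suc k))))"])
    fix T assume T: "T \<in> tabs N M K k la"
    have d: "(i, j) \<in> diagram (shape_ge la T (Suc k)) \<longleftrightarrow> (i, j) \<in> diagram la \<and> Suc k \<le> T (i, j)" for i j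
      by (rule diagram_shape_ge) (rule tabsD(2)[OF T])
    have T1: "k \<le> T s" if "s \<in> diagram la" for s using tabsD(1)[OF T] that by (auto dest: PiE_mem)
    have "extend la (shape_ge la T (Suc k)) k (restrict T (diagram (shape_ge la T (Suc k)))) = T"
    proof
      fix s
      show "extend la (shape_ge la T (Suc k)) k (restrict T (diagram (shape_ge la T (Suc k)))) s = T s"
      proof (cases "s \<in> diagram la")
        case True
        then show ?thesis using d[of "fst s" "snd s"] T1[OF True] by (auto simp: extend_def)
      next
        case False
        then show ?thesis using PiE_arb[OF tabsD(1)[OF T] False] by (simp add: extend_def)
      qed
    qed
    then show *: "(case (shape_ge la T (Suc k), restrict T (diagram (shape_ge la T (Suc k)))) of (mu, T) \<Rightarrow> extend la mu k T) = T"
      by simp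
    show "(shape_ge la T (Suc k), restrict T (diagram (shape_ge la T (Suc k)))) \<in> Sigma ?B (tabs N M K (Suc k))"
      using restrict_in_tabs[OF T] layer_strip_shape_ge[OF la T] shape_ge_partition[OF la T] shape_ge_le[of la, OF la(2)]
      by (auto simp: subparts_def)
    show "(case (shape_ge la T (Suc k), restrict T (diagram (shape_ge la T (Suc k)))) of (mu, T) \<Rightarrow> F (extend la mu k T)) = F T"
      using * by simp
  next
    fix b assume "b \<in> Sigma ?B (tabs N M K (Suc k))"
    then obtain mu T where b: "b = (mu, T)" "mu \<in> ?B" "T \<in> tabs N M K (Suc k) mu" by auto
    show "(case b of (mu, T) \<Rightarrow> extend la mu k T) \<in> tabs N M K k la"
      using extend_in_tabs[OF la(1) part(1)[OF b(2)] k _ b(3)] b by simp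
    have mu0: "mu 0 = 0" using le_funD[OF part(2)[OF b(2)], of 0] la(2) by simp
    have shape: "shape_ge la (extend la mu k T) (Suc k) = mu"
      unfolding shape_ge_extend[OF part(2)[OF b(2)] lessI]
      by (rule shape_ge_all[of mu, OF mu0]) (use tabsD(1)[OF b(3)] in \<open>auto dest: PiE_mem\<close>)
    have "restrict (extend la mu k T) (diagram mu) = T"
    proof
      fix s show "restrict (extend la mu k T) (diagram mu) s = T s"
        using PiE_arb[OF tabsD(1)[OF b(3)], of s] diagram_mono[OF part(2)[OF b(2)]]
        by (cases "s \<in> diagram mu") (auto simp: extend_def)
    qed
    then show "(shape_ge la (case b of (mu, T) \<Rightarrow> extend la mu k T) (Suc k),
       restrict (case b of (mu, T) \<Rightarrow> extend la mu k T) (diagram (shape_ge la (case b of (mu, T) \<Rightarrow> extend la mu k T) (Suc k)))) = b"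
      using shape b(1) by simp
  qed
  also have "\<dots> = (\<Sum>mu\<in>?B. \<Sum>T\<in>tabs N M K (Suc k) mu. F (extend la mu k T))"
    using finB fin by (subst sum.Sigma) auto
  finally show ?thesis .
qed

section \<open>The quantum corner polynomial\<close>

definition tab_sum :: "nat \<Rightarrow> nat \<Rightarrow> nat \<Rightarrow> (nat \<Rightarrow> parts \<Rightarrow> parts \<Rightarrow> complex) \<Rightarrow> (nat \<Rightarrow> cpoly) \<Rightarrow> nat \<Rightarrow> parts \<Rightarrow> cpoly" where
  "tab_sum N M K U f k la = (\<Sum>T\<in>tabs N M K k la.
     const (\<Prod>l=k..K. U l (shape_ge la T l) (shape_ge la T (Suc l))) * (\<Prod>s\<in>diagram la. f (T s)))"

lemma tab_sum_rec:
  assumes lam: "is_partition lam" "lam 0 = 0" and la: "la \<in> subparts lam" and k: "1 \<le> k" "k \<le> K"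
    and U: "\<And>mu. mu \<in> subparts lam \<Longrightarrow> \<not> layer_strip N M k la mu \<Longrightarrow> U k la mu = 0"
  shows "tab_sum N M K U f k la = transfer_op (subparts lam) (U k) (f k) (tab_sum N M K U f (Suc k)) la"
proof -
  let ?B = "{mu. mu \<in> subparts la \<and> layer_strip N M k la mu}"
  have lap: "is_partition la" "la \<le> lam" using la by (auto simp: subparts_def)
  have la0: "la 0 = 0" using le_funD[OF lap(2), of 0] lam by simp
  have summand: "const (\<Prod>l=k..K. U l (shape_ge la (extend la mu k T) l) (shape_ge la (extend la mu k T) (Suc l))) *
      (\<Prod>s\<in>diagram la. f (extend la mu k T s)) =
    const (U k la mu) * f k ^ (psize la - psize mu) *
     (const (\<Prod>l=Suc k..K. U l (shape_ge mu T l) (shape_ge mu T (Suc l))) * (\<Prod>s\<in>diagram mu. f (T s)))"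
    if mu: "mu \<in> ?B" and T: "T \<in> tabs N M K (Suc k) mu" for mu T
  proof -
    let ?E = "extend la mu k T"
    have le: "mu \<le> la" using mu by (auto simp: subparts_def)
    have sub: "diagram mu \<subseteq> diagram la" by (rule diagram_mono[OF le])
    have mu0: "mu 0 = 0" using le_funD[OF le, of 0] la0 by simp
    have Tk: "Suc k \<le> T s" if "s \<in> diagram mu" for s using tabsD(1)[OF T] that by (auto dest: PiE_mem)
    have Ek: "shape_ge la ?E k = la"
    proof (rule shape_ge_all[of la, OF la0])
      show "k \<le> ?E s" if "s \<in> diagram la" for s using Tk[of s] that by (auto simp: extend_def)
    qed
    have Ek': "shape_ge la ?E (Suc k) = mu"
      unfolding shape_ge_extend[OF le lessI] by (rule shape_ge_all[of mu, OF mu0]) (rule Tk)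
    have "(\<Prod>l=k..K. U l (shape_ge la ?E l) (shape_ge la ?E (Suc l))) =
      U k la mu * (\<Prod>l=Suc k..K. U l (shape_ge la ?E l) (shape_ge la ?E (Suc l)))"
      using k by (simp add: prod.atLeast_Suc_atMost Ek Ek')
    also have "(\<Prod>l=Suc k..K. U l (shape_ge la ?E l) (shape_ge la ?E (Suc l))) =
      (\<Prod>l=Suc k..K. U l (shape_ge mu T l) (shape_ge mu T (Suc l)))"
      by (intro prod.cong refl) (simp add: shape_ge_extend[OF le])
    finally have 1: "(\<Prod>l=k..K. U l (shape_ge la ?E l) (shape_ge la ?E (Suc l))) = U k la mu * \<dots>" .
    have "(\<Prod>s\<in>diagram la. f (?E s)) = (\<Prod>s\<in>diagram la - diagram mu. f (?E s)) * (\<Prod>s\<in>diagram mu. f (?E s))"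
      by (rule prod.subset_diff[OF sub finite_diagram[OF lap(1)]])
    also have "(\<Prod>s\<in>diagram la - diagram mu. f (?E s)) = (\<Prod>s\<in>diagram la - diagram mu. f k)"
      by (rule prod.cong) (auto simp: extend_def)
    also have "\<dots> = f k ^ (psize la - psize mu)"
      using sub finite_diagram[OF lap(1)] by (simp add: psize_def card_Diff_subset finite_subset)
    also have "(\<Prod>s\<in>diagram mu. f (?E s)) = (\<Prod>s\<in>diagram mu. f (T s))"
      using sub by (intro prod.cong) (auto simp: extend_def)
    finally show ?thesis unfolding 1 const_mult by (simp only: mult_ac)
  qed
  have BX: "?B \<subseteq> subparts lam" using lap by (auto simp: subparts_def)
  have "tab_sum N M K U f k la = (\<Sum>mu\<in>?B. const (U k la mu) * f k ^ (psize la - psize mu) * tab_sum N M K U f (Suc k) mu)"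
    unfolding tab_sum_def sum_tabs_Suc[OF lap(1) la0 k] sum_distrib_left
    by (intro sum.cong refl summand)
  also have "\<dots> = (\<Sum>mu\<in>subparts lam. const (U k la mu) * f k ^ (psize la - psize mu) * tab_sum N M K U f (Suc k) mu)"
  proof (rule sum.mono_neutral_left[OF finite_subparts[OF lam] BX], rule ballI)
    fix mu assume mu: "mu \<in> subparts lam - ?B"
    then have "\<not> layer_strip N M k la mu" by (auto simp: subparts_def layer_strip_def)
    then show "const (U k la mu) * f k ^ (psize la - psize mu) * tab_sum N M K U f (Suc k) mu = 0"
      using U mu by (simp add: const_0)
  qed
  finally show ?thesis using la by (simp add: transfer_op_def)
qed

lemma transfer_op_cong: "(\<And>mu. mu \<in> X \<Longrightarrow> v mu = w mu) \<Longrightarrow> transfer_op X u x v = transfer_op X u x w"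
  by (auto simp: transfer_op_def fun_eq_iff intro: sum.cong)

text \<open>No entry is left, so only the empty diagram has a filling, the function that is
  \<open>undefined\<close> everywhere. This is the vector to which the transfer operators are
  applied.\<close>

lemma tab_sum_end: "tab_sum N M K U f (Suc K) la = (if diagram la = {} then 1 else 0)"
proof (cases "diagram la = {}")
  case True
  then have "tabs N M K (Suc K) la = {\<lambda>_. undefined}" by (auto simp: tabs_def)
  then show ?thesis using True by (simp add: tab_sum_def const_1)
next
  case False
  then have "tabs N M K (Suc K) la = {}" by (auto simp: tabs_def PiE_eq_empty_iff)
  then show ?thesis using False by (simp add: tab_sum_def)
qed

lemma tab_sum_foldr:
  assumes lam: "is_partition lam" "lam 0 = 0" and k: "1 \<le> k" "k \<le> Suc K" and la: "la \<in> subparts lam"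
    and U: "\<And>k la mu. 1 \<le> k \<Longrightarrow> k \<le> K \<Longrightarrow> la \<in> subparts lam \<Longrightarrow> mu \<in> subparts lam \<Longrightarrow> \<not> layer_strip N M k la mu \<Longrightarrow> U k la mu = 0"
  shows "tab_sum N M K U f k la =
     foldr (\<lambda>l. transfer_op (subparts lam) (U l) (f l)) [k..<Suc K] (\<lambda>la. if diagram la = {} then 1 else 0) la"
  using k(2,1) la
proof (induction k arbitrary: la rule: inc_induct)
  case base
  then show ?case by (simp add: tab_sum_end)
next
  case (step k)
  let ?X = "subparts lam"
  have "tab_sum N M K U f k la = transfer_op ?X (U k) (f k) (tab_sum N M K U f (Suc k)) la"
    by (rule tab_sum_rec[OF lam]) (use step U in auto)
  also have "transfer_op ?X (U k) (f k) (tab_sum N M K U f (Suc k)) = transfer_op ?X (U k) (f k)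
     (foldr (\<lambda>l. transfer_op ?X (U l) (f l)) [Suc k..<Suc K] (\<lambda>la. if diagram la = {} then 1 else 0))"
    by (rule transfer_op_cong) (use step in auto)
  finally show ?case unfolding upt_conv_Cons[OF step.hyps(2)] by simp
qed

text \<open>A composition of pairwise commuting operators depends only on their multiset, and
  \<open>\<sigma>\<close> merely rearranges the operators of the block.\<close>

lemma foldr_transfer_op_permute:
  assumes comm: "kernel_commutes X u" and X: "finite X"
    and size: "\<And>la mu. la \<in> X \<Longrightarrow> mu \<in> X \<Longrightarrow> u la mu \<noteq> 0 \<Longrightarrow> psize mu \<le> psize la"
    and \<sigma>: "inj \<sigma>" "\<sigma> ` {a..<b} = {a..<b}"
  shows "foldr (\<lambda>l. transfer_op X u (f (\<sigma> l))) [a..<b] = foldr (\<lambda>l. transfer_op X u (f l)) [a..<b]"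
proof -
  let ?g = "\<lambda>l. transfer_op X u (f l)"
  have "distinct (map \<sigma> [a..<b])" using \<sigma>(1) by (simp add: distinct_map inj_on_subset[OF \<sigma>(1)])
  then have "mset (map \<sigma> [a..<b]) = mset [a..<b]"
    using \<sigma>(2) by (subst set_eq_iff_mset_eq_distinct[symmetric]) auto
  then have ms: "mset (rev (map \<sigma> [a..<b])) = mset (rev [a..<b])" by simp
  have "foldr (\<lambda>l. transfer_op X u (f (\<sigma> l))) [a..<b] = fold ?g (rev (map \<sigma> [a..<b]))"
    unfolding foldr_conv_fold[symmetric] by (rule ext) (simp add: foldr_map o_def)
  also have "\<dots> = fold ?g (rev [a..<b])"
    by (rule fold_multiset_equiv[OF _ ms]) (rule transfer_op_commute[OF comm X size])
  finally show ?thesis by (simp add: foldr_conv_fold)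
qed

section \<open>Substitution of variables\<close>

definition subst_monomial :: "(nat \<Rightarrow> nat) \<Rightarrow> (nat \<Rightarrow>\<^sub>0 nat) \<Rightarrow> cpoly" where
  "subst_monomial \<sigma> m = (\<Prod>i \<in> Poly_Mapping.keys m. var (\<sigma> i) ^ Poly_Mapping.lookup m i)"

lemma subst_monomial_eq:
  "finite B \<Longrightarrow> Poly_Mapping.keys m \<subseteq> B \<Longrightarrow> subst_monomial \<sigma> m = (\<Prod>i\<in>B. var (\<sigma> i) ^ Poly_Mapping.lookup m i)"
  unfolding subst_monomial_def by (rule prod.mono_neutral_left) (auto simp: in_keys_iff)

lemma subst_monomial_add: "subst_monomial \<sigma> (m + m') = subst_monomial \<sigma> m * subst_monomial \<sigma> m'"
proof -
  let ?B = "Poly_Mapping.keys m \<union> Poly_Mapping.keys m'"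
  have "subst_monomial \<sigma> m'' = (\<Prod>i\<in>?B. var (\<sigma> i) ^ Poly_Mapping.lookup m'' i)" if "m'' \<in> {m, m', m + m'}" for m''
    by (rule subst_monomial_eq) (use that Poly_Mapping.keys_add[of m m'] in auto)
  then show ?thesis by (simp add: lookup_add power_add prod.distrib)
qed

lemma subst_vars_eq:
  "finite B \<Longrightarrow> Poly_Mapping.keys p \<subseteq> B \<Longrightarrow> subst_vars \<sigma> p = (\<Sum>m\<in>B. const (Poly_Mapping.lookup p m) * subst_monomial \<sigma> m)"
  unfolding subst_vars_def subst_monomial_def[symmetric]
  by (rule sum.mono_neutral_left) (auto simp: in_keys_iff const_0)

text \<open>Different tableaux can have the same monomial, so a sum over tableaux is not the
  expansion over keys that defines \<open>subst_vars\<close>; additivity bridges the two.\<close>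

lemma subst_vars_add: "subst_vars \<sigma> (p + r) = subst_vars \<sigma> p + subst_vars \<sigma> r"
proof -
  let ?B = "Poly_Mapping.keys p \<union> Poly_Mapping.keys r"
  have "subst_vars \<sigma> s = (\<Sum>m\<in>?B. const (Poly_Mapping.lookup s m) * subst_monomial \<sigma> m)" if "s \<in> {p, r, p + r}" for s
    by (rule subst_vars_eq) (use that Poly_Mapping.keys_add[of p r] in auto)
  then show ?thesis by (simp add: lookup_add const_add distrib_right sum.distrib)
qed

lemma subst_vars_sum: "subst_vars \<sigma> (\<Sum>i\<in>A. p i) = (\<Sum>i\<in>A. subst_vars \<sigma> (p i))"
proof (induction A rule: infinite_finite_induct)
  case (insert x F) then show ?case by (simp add: subst_vars_add)
qed (auto simp: subst_vars_def)

lemma subst_vars_single: "subst_vars \<sigma> (Poly_Mapping.single m c) = const c * subst_monomial \<sigma> m"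
  by (subst subst_vars_eq[of "{m}"]) auto

lemma const_times_prod_var:
  "finite D \<Longrightarrow> const c * (\<Prod>s\<in>D. var (g s)) = Poly_Mapping.single (\<Sum>s\<in>D. Poly_Mapping.single (g s) 1) c"
proof (induction D rule: finite_induct)
  case empty then show ?case by (simp add: const_def)
next
  case (insert x F)
  have "const c * (\<Prod>s\<in>insert x F. var (g s)) = var (g x) * (const c * (\<Prod>s\<in>F. var (g s)))"
    using insert.hyps by (simp add: mult_ac)
  also have "\<dots> = Poly_Mapping.single (\<Sum>s\<in>insert x F. Poly_Mapping.single (g s) 1) c"
    unfolding insert.IH using insert.hyps by (simp add: var_def mult_single)
  finally show ?case .
qed

lemma subst_monomial_sum:
  "finite D \<Longrightarrow> subst_monomial \<sigma> (\<Sum>s\<in>D. Poly_Mapping.single (g s) 1) = (\<Prod>s\<in>D. var (\<sigma> (g s)))"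
proof (induction D rule: finite_induct)
  case empty then show ?case by (simp add: subst_monomial_def)
next
  case (insert x F)
  have "subst_monomial \<sigma> (Poly_Mapping.single (g x) 1) = var (\<sigma> (g x))" by (simp add: subst_monomial_def)
  then show ?case using insert by (simp add: subst_monomial_add)
qed

lemma subst_vars_monomials:
  assumes "finite D"
  shows "subst_vars \<sigma> (\<Sum>T\<in>A. const (c T) * (\<Prod>s\<in>D. var (g T s))) = (\<Sum>T\<in>A. const (c T) * (\<Prod>s\<in>D. var (\<sigma> (g T s))))"
  by (simp only: subst_vars_sum const_times_prod_var[OF assms] subst_vars_single subst_monomial_sum[OF assms])

text \<open>This permits resetting the meaningless part \<open>lam 0\<close> to 0.\<close>

lemma QC_cong_diagram:
  assumes "diagram lam = diagram lam'" shows "QC N M L lam q t = QC N M L lam' q t"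
proof -
  have eq: "shape_ge lam = shape_ge lam'" "theta lam = theta lam'"
    using assms by (auto simp: shape_ge_def theta_def fun_eq_iff)
  have "R_weight N M L q t lam T = R_weight N M L q t lam' T" for T
    unfolding R_weight_def A2_def psi_T0_def psi_T1'_def eq ..
  moreover have "RSSYTT N M L lam = RSSYTT N M L lam'" using assms by (simp add: RSSYTT_def)
  ultimately show ?thesis using assms by (simp add: QC_def)
qed

lemma theta_eq: "theta lam T i d = shape_ge lam T d i - shape_ge lam T (Suc d) i"
proof -
  have "{j. (i, j) \<in> diagram lam \<and> T (i, j) = d} =
    {j. (i, j) \<in> diagram lam \<and> d \<le> T (i, j)} - {j. (i, j) \<in> diagram lam \<and> Suc d \<le> T (i, j)}" by auto
  then show ?thesis unfolding theta_def shape_ge_def by (simp add: card_Diff_subset row_finite Collect_mono_iff)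
qed

lemma shape_ge_antimono: "k \<le> l \<Longrightarrow> shape_ge la T l \<le> shape_ge la T k"
  unfolding shape_ge_def le_fun_def by (intro allI card_mono row_finite) auto

section \<open>The weight of a tableau as a product over its layers\<close>

context generic_qt
begin

definition G1 :: "parts \<Rightarrow> complex" where
  "G1 p = H p q (inverse t) / H (conj_part p) (inverse t) q"

definition G2 :: "parts \<Rightarrow> complex" where
  "G2 p = (\<Prod>s \<in> diagram p. (inverse t ^ (leg p s + 1) - q ^ arm p s) / (q ^ (arm p s + 1) - inverse t ^ leg p s)) *
         ((inverse q * t - 1) / (inverse t - 1)) ^ card (diagram p)"

lemma difference_nz: "0 < a \<or> 0 < b \<Longrightarrow> q ^ a - inverse t ^ b \<noteq> 0" "0 < a \<or> 0 < b \<Longrightarrow> inverse t ^ b - q ^ a \<noteq> 0"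
proof -
  assume ab: "0 < a \<or> 0 < b"
  have "q ^ a * t ^ b \<noteq> 1" using powi_ne_1[of "int a" "int b"] ab by simp
  then have "q ^ a \<noteq> inverse t ^ b" using nz by (simp add: field_simps)
  then show "q ^ a - inverse t ^ b \<noteq> 0" "inverse t ^ b - q ^ a \<noteq> 0" by auto
qed

lemma prod_nz: "(\<And>i. i \<in> A \<Longrightarrow> f i \<noteq> (0::complex)) \<Longrightarrow> prod f A \<noteq> 0"
  by (cases "finite A") auto

text \<open>Every factor has a positive exponent \<open>arm + 1\<close>, so genericity applies. The
  quotients of \<open>G1\<close> over the layers require this.\<close>

lemma G1_nz: "G1 p \<noteq> 0"
proof -
  have "H p q (inverse t) \<noteq> 0" unfolding H_def by (intro prod_nz difference_nz) auto
  moreover have "H (conj_part p) (inverse t) q \<noteq> 0" unfolding H_def by (intro prod_nz difference_nz) auto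
  ultimately show ?thesis by (simp add: G1_def)
qed

lemma G2_nz: "G2 p \<noteq> 0"
proof -
  have "q \<noteq> t" using powi_ne_1[of 1 "-1"] nz by (auto simp: power_int_minus)
  then have 1: "inverse q * t - 1 \<noteq> 0" using nz by (simp add: field_simps)
  have 2: "inverse t - 1 \<noteq> 0" using difference_nz(2)[of 0 1] by simp
  have "(\<Prod>s \<in> diagram p. (inverse t ^ (leg p s + 1) - q ^ arm p s) / (q ^ (arm p s + 1) - inverse t ^ leg p s)) \<noteq> 0"
    using difference_nz by (intro prod_nz) (simp del: power_Suc)
  then show ?thesis using 1 2 by (simp add: G2_def)
qed

lemma G_empty: "diagram p = {} \<Longrightarrow> G1 p = 1" "diagram p = {} \<Longrightarrow> G2 p = 1"
proof -
  assume p: "diagram p = {}"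
  then have "diagram (conj_part p) = {}" by (auto simp: diagram_def[of "conj_part p"] conj_part_def)
  then show "G1 p = 1" "G2 p = 1" using p by (simp_all add: G1_def G2_def H_def)
qed

text \<open>
  The boundary factors \<open>G1\<close> at \<open>sh(T\<^sub>1 \<squnion> T\<^sub>2)\<close> and \<open>G2\<close> at \<open>sh(T\<^sub>2)\<close> are written as telescoping
  products over the super and hyper layers.
\<close>

definition layer_kernel :: "nat \<Rightarrow> nat \<Rightarrow> nat \<Rightarrow> nat \<Rightarrow> parts \<Rightarrow> parts \<Rightarrow> complex" where
  "layer_kernel N M n l = (if l \<le> N then kernel0
     else if l \<le> N + M then (\<lambda>la mu. kernel1 la mu * (G1 la / G1 mu))
     else (\<lambda>la mu. kernel2 n la mu * (G1 la * G2 la / (G1 mu * G2 mu))))"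

lemma layer_kernel_strip:
  assumes lam: "is_partition lam" "lam 0 = 0" and "la \<in> subparts lam" "mu \<in> subparts lam" and "1 \<le> l"
    and "\<not> layer_strip N M l la mu"
  shows "layer_kernel N M n l la mu = 0"
proof -
  have "is_partition la" "is_partition mu" "mu 0 = 0"
    using assms le_funD[of mu lam 0] by (auto simp: subparts_def)
  note hc = hstrip_conj_iff[OF this]
  consider "l \<le> N" | "N < l" "l \<le> N + M" | "N + M < l" by linarith
  then show ?thesis
  proof cases
    case 1 then show ?thesis
      using assms(5,6) by (auto simp: layer_kernel_def kernel0_def hstrip_iff layer_strip_def)
  next
    case 2 then show ?thesis
      using assms(5,6) by (auto simp: layer_kernel_def kernel1_def hc layer_strip_def)
  next
    case 3 then show ?thesis
      using assms(5,6) by (auto simp: layer_kernel_def kernel2_def layer_strip_def)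
  qed
qed

lemma layer_kernel_commutes:
  assumes "is_partition lam" "lam 0 = 0"
  shows "kernel_commutes (subparts lam) (layer_kernel N M (len lam) l)"
proof -
  have "G1 p * G2 p \<noteq> 0" for p using G1_nz G2_nz by simp
  then show ?thesis
    unfolding layer_kernel_def
    using kernel0_commutes[OF assms] kernel_commutes_gauge[OF kernel1_commutes[OF assms] G1_nz]
      kernel_commutes_gauge[OF kernel2_commutes[OF assms], of "\<lambda>p. G1 p * G2 p"] by auto
qed

lemma R_weight_eq_prod:
  assumes lam: "is_partition lam" "lam 0 = 0" and T: "T \<in> tabs N M (N + M + L) 1 lam"
  shows "R_weight N M L q t lam T =
    (\<Prod>l=1..N + M + L. layer_kernel N M (len lam) l (shape_ge lam T l) (shape_ge lam T (Suc l)))"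
proof -
  let ?S = "shape_ge lam T" and ?K = "N + M + L" and ?n = "len lam"
  let ?r = "len (?S (N + M + 1))"
  have part: "is_partition (?S l)" for l by (rule shape_ge_partition[OF lam T])
  have le: "?S l \<le> lam" for l by (rule shape_ge_le[of lam, OF lam(2)])
  have S0: "?S l 0 = 0" for l by (rule shape_ge_0)
  have anti: "?S (Suc l) \<le> ?S l" for l by (rule shape_ge_antimono) simp
  have X: "?S l \<in> subparts lam" for l using part le by (simp add: subparts_def)
  have Send: "diagram (?S (Suc ?K)) = {}"
  proof -
    have "(i, j) \<notin> diagram (?S (Suc ?K))" for i j
    proof -
      have "(i, j) \<in> diagram (?S (Suc ?K)) \<longleftrightarrow> (i, j) \<in> diagram lam \<and> Suc ?K \<le> T (i, j)"
        by (rule diagram_shape_ge) (rule tabsD(2)[OF T])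
      then show ?thesis using PiE_mem[OF tabsD(1)[OF T], of "(i, j)"] by auto
    qed
    then show ?thesis by auto
  qed
  have strip: "layer_strip N M l (?S l) (?S (Suc l))" if "1 \<le> l" for l
  proof -
    \<comment> \<open>The strip condition was shown for the smallest admissible entry. After
      restriction to the boxes with entries at least \<open>l\<close>, that entry is
      \<open>l\<close>.\<close>
    let ?T = "restrict T (diagram (?S l))"
    have "layer_strip N M l (?S l) (shape_ge (?S l) ?T (Suc l))"
      by (rule layer_strip_shape_ge[OF part S0 restrict_in_tabs[OF T]])
    moreover have "shape_ge (?S l) ?T (Suc l) = ?S (Suc l)"
    proof -
      have "(i, j) \<in> diagram (?S l) \<longleftrightarrow> (i, j) \<in> diagram lam \<and> l \<le> T (i, j)" for i j
        by (rule diagram_shape_ge) (rule tabsD(2)[OF T])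
      then show ?thesis unfolding shape_ge_def[of _ ?T] shape_ge_def[of lam T "Suc l"]
        by (intro ext arg_cong[where f = card]) auto
    qed
    ultimately show ?thesis by simp
  qed
  have psi0: "psi_T0 N q t lam T = (\<Prod>l=1..N. kernel0 (?S l) (?S (Suc l)))"
    unfolding psi_T0_def using strip by (intro prod.cong refl) (auto simp: kernel0_def hstrip_iff layer_strip_def)
  have psi1: "psi_T1' N M t q lam T = (\<Prod>l=N+1..N+M. kernel1 (?S l) (?S (Suc l)))"
    unfolding psi_T1'_def using strip
    by (intro prod.cong refl) (auto simp: kernel1_def hstrip_conj_iff[OF part part S0] layer_strip_def)
  have A2: "A2 N M L q t lam T = (\<Prod>l=N+M+1..?K. kernel2 ?n (?S l) (?S (Suc l)))"
  proof -
    have "A2 N M L q t lam T = (\<Prod>d=N+M+1..?K. hyper_layer (?S d) (?S (Suc d)) ?r)"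
      unfolding A2_def Let_def theta_eq hyper_layer_def prod.distrib Suc_eq_plus1
      by (intro arg_cong2[where f = "(*)"] refl prod.swap)
    also have "\<dots> = (\<Prod>l=N+M+1..?K. kernel2 ?n (?S l) (?S (Suc l)))"
    proof (rule prod.cong[OF refl])
      fix d assume d: "d \<in> {N+M+1..?K}"
      have "?S d i = 0" if "i \<notin> {1..?r}" for i
      proof -
        have "?S (N+M+1) i = 0" using partition_eq_0[OF part, of "N+M+1" i] that S0 by (cases "i = 0") auto
        moreover have "?S d \<le> ?S (N+M+1)" by (rule shape_ge_antimono) (use d in simp)
        ultimately show ?thesis using le_funD[of "?S d" "?S (N+M+1)" i] by simp
      qed
      \<comment> \<open>The number of rows is changed from \<open>?r\<close>, which depends on
        \<open>T\<close>, to \<open>?n\<close>, which does not: the kernel must be the same for all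
        tableaux.\<close>
      then have "hyper_layer (?S d) (?S (Suc d)) ?r = cocycle (c_hyper ?n) ?n (?S d) (?S (Suc d)) *
          rows.layer q (inverse t) (rows_at t ?n) ?n (?S d) (?S (Suc d))"
        using subparts_len[OF lam(1) X] by (intro hyper_layer_eq part anti) auto
      also have "\<dots> = hyper_layer (?S d) (?S (Suc d)) ?n"
        by (rule hyper_layer_eq[symmetric, OF part order_refl anti]) (rule subparts_out[OF lam le])
      finally show "hyper_layer (?S d) (?S (Suc d)) ?r = kernel2 ?n (?S d) (?S (Suc d))"
        using anti by (simp add: kernel2_def)
    qed
    finally show ?thesis .
  qed
  \<comment> \<open>\<open>G1\<close> telescopes over the super layers and on through the hyper
    layers: the leftover denominator at \<open>N + M + 1\<close> cancels against the second product,
    which ends at the empty shape, where both boundary factors are 1.\<close>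
  have tel1: "(\<Prod>l=N+1..N+M. G1 (?S l) / G1 (?S (Suc l))) = G1 (?S (N+1)) / G1 (?S (N+M+1))"
    using prod_telescope_quot(2)[of "N+1" "N+M+1" "\<lambda>l. G1 (?S l)"] G1_nz by (simp add: atLeastLessThanSuc_atLeastAtMost)
  have tel2: "(\<Prod>l=N+M+1..?K. G1 (?S l) * G2 (?S l) / (G1 (?S (Suc l)) * G2 (?S (Suc l)))) = G1 (?S (N+M+1)) * G2 (?S (N+M+1))"
    using prod_telescope_quot(2)[of "N+M+1" "?K+1" "\<lambda>l. G1 (?S l) * G2 (?S l)"] G1_nz G2_nz G_empty[OF Send]
    by (simp add: atLeastLessThanSuc_atLeastAtMost)
  have split: "(\<Prod>l=1..?K. h l) = (\<Prod>l=1..N. h l) * (\<Prod>l=N+1..N+M. h l) * (\<Prod>l=N+M+1..?K. h l)" for h :: "nat \<Rightarrow> complex"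
    using prod.ub_add_nat[of 1 N h M] prod.ub_add_nat[of 1 "N + M" h L] by simp
  have "R_weight N M L q t lam T = (\<Prod>l=N+M+1..?K. kernel2 ?n (?S l) (?S (Suc l))) *
     (\<Prod>l=N+1..N+M. kernel1 (?S l) (?S (Suc l))) * (\<Prod>l=1..N. kernel0 (?S l) (?S (Suc l))) * G1 (?S (N+1)) * G2 (?S (N+M+1))"
    unfolding R_weight_def Let_def A2 psi0 psi1 G1_def G2_def by (simp only: mult.assoc)
  also have "\<dots> = (\<Prod>l=1..N. kernel0 (?S l) (?S (Suc l))) *
    (\<Prod>l=N+1..N+M. kernel1 (?S l) (?S (Suc l)) * (G1 (?S l) / G1 (?S (Suc l)))) *
    (\<Prod>l=N+M+1..?K. kernel2 ?n (?S l) (?S (Suc l)) * (G1 (?S l) * G2 (?S l) / (G1 (?S (Suc l)) * G2 (?S (Suc l)))))"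
    unfolding prod.distrib[of "\<lambda>l. kernel1 (?S l) (?S (Suc l))"] prod.distrib[of "\<lambda>l. kernel2 ?n (?S l) (?S (Suc l))"] tel1 tel2
    using G1_nz by simp
  also have "\<dots> = (\<Prod>l=1..?K. layer_kernel N M ?n l (?S l) (?S (Suc l)))"
    unfolding split by (intro arg_cong2[where f = "(*)"] prod.cong refl) (auto simp: layer_kernel_def)
  finally show ?thesis .
qed

text \<open>With arbitrary polynomials in place of the variables, permuting the variables is
  composing \<open>f\<close> with \<open>\<sigma>\<close>, and the weights stay untouched.\<close>

definition QC_at :: "nat \<Rightarrow> nat \<Rightarrow> nat \<Rightarrow> parts \<Rightarrow> (nat \<Rightarrow> cpoly) \<Rightarrow> cpoly" where
  "QC_at N M L lam f = (\<Sum>T \<in> RSSYTT N M L lam. const (R_weight N M L q t lam T) * (\<Prod>s \<in> diagram lam. f (T s)))"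

lemma QC_at_foldr:
  assumes lam: "is_partition lam" "lam 0 = 0"
  shows "QC_at N M L lam f =
     foldr (\<lambda>l. transfer_op (subparts lam) (layer_kernel N M (len lam) l) (f l)) [1..<Suc (N + M + L)]
       (\<lambda>la. if diagram la = {} then 1 else 0) lam"
proof -
  have "QC_at N M L lam f = tab_sum N M (N + M + L) (layer_kernel N M (len lam)) f 1 lam"
    unfolding QC_at_def tab_sum_def RSSYTT_eq_tabs
    by (intro sum.cong refl arg_cong2[where f = "(*)"] arg_cong[where f = const] R_weight_eq_prod lam)
  also have "\<dots> = foldr (\<lambda>l. transfer_op (subparts lam) (layer_kernel N M (len lam) l) (f l)) [1..<Suc (N + M + L)]
       (\<lambda>la. if diagram la = {} then 1 else 0) lam"
    by (rule tab_sum_foldr[OF lam]) (use layer_kernel_strip[OF lam] lam in \<open>auto simp: subparts_def\<close>)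
  finally show ?thesis .
qed

lemma QC_at_permute:
  assumes lam: "is_partition lam" "lam 0 = 0" and inj: "inj \<sigma>"
    and blocks: "\<sigma> ` {1..N} = {1..N}" "\<sigma> ` {N + 1..N + M} = {N + 1..N + M}"
      "\<sigma> ` {N + M + 1..N + M + L} = {N + M + 1..N + M + L}"
  shows "QC_at N M L lam (\<lambda>l. f (\<sigma> l)) = QC_at N M L lam f"
proof -
  let ?X = "subparts lam" and ?U = "layer_kernel N M (len lam)"
  have block: "foldr (\<lambda>l. transfer_op ?X (?U l) (f (\<sigma> l))) [a..<b] = foldr (\<lambda>l. transfer_op ?X (?U l) (f l)) [a..<b]"
    if \<sigma>: "\<sigma> ` {a..<b} = {a..<b}" and const: "\<And>l. l \<in> {a..<b} \<Longrightarrow> ?U l = ?U a" and a: "1 \<le> a" for a b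
  proof -
    have size: "psize mu \<le> psize la" if "la \<in> ?X" "mu \<in> ?X" "?U a la mu \<noteq> 0" for la mu
    proof -
      have "mu \<le> la" using layer_kernel_strip[OF lam that(1,2) a] that(3) by (auto simp: layer_strip_def)
      then show ?thesis using that(1) by (intro psize_mono) (auto simp: subparts_def)
    qed
    have eq: "foldr (\<lambda>l. transfer_op ?X (?U l) (h l)) [a..<b] = foldr (\<lambda>l. transfer_op ?X (?U a) (h l)) [a..<b]" for h
    proof (rule ext, rule foldr_cong[OF refl refl])
      fix l v assume "l \<in> set [a..<b]"
      then have "?U l = ?U a" by (intro const) simp
      then show "transfer_op ?X (?U l) (h l) v = transfer_op ?X (?U a) (h l) v" by simp
    qed
    have "foldr (\<lambda>l. transfer_op ?X (?U a) (f (\<sigma> l))) [a..<b] = foldr (\<lambda>l. transfer_op ?X (?U a) (f l)) [a..<b]"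
      by (rule foldr_transfer_op_permute[OF layer_kernel_commutes[OF lam] finite_subparts[OF lam] _ inj \<sigma>]) (rule size)
    then show ?thesis by (rule trans[OF eq[of "\<lambda>l. f (\<sigma> l)"] trans[OF _ eq[of f, symmetric]]])
  qed
  have split: "[1..<Suc (N + M + L)] = [1..<Suc N] @ [Suc N..<Suc (N + M)] @ [Suc (N + M)..<Suc (N + M + L)]"
    using upt_add_eq_append[of 1 "Suc N" "M + L"] upt_add_eq_append[of "Suc N" "Suc (N + M)" L]
    by (simp add: add.assoc del: upt_Suc)
  have b1: "\<sigma> ` {1..<Suc N} = {1..<Suc N}" and b2: "\<sigma> ` {Suc N..<Suc (N + M)} = {Suc N..<Suc (N + M)}"
    and b3: "\<sigma> ` {Suc (N + M)..<Suc (N + M + L)} = {Suc (N + M)..<Suc (N + M + L)}"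
    using blocks by (simp_all add: atLeastLessThanSuc_atLeastAtMost)
  have "foldr (\<lambda>l. transfer_op ?X (?U l) (f (\<sigma> l))) [1..<Suc N] = foldr (\<lambda>l. transfer_op ?X (?U l) (f l)) [1..<Suc N]"
    by (rule block[OF b1]) (auto simp: layer_kernel_def)
  moreover have "foldr (\<lambda>l. transfer_op ?X (?U l) (f (\<sigma> l))) [Suc N..<Suc (N + M)] =
      foldr (\<lambda>l. transfer_op ?X (?U l) (f l)) [Suc N..<Suc (N + M)]"
    by (rule block[OF b2]) (auto simp: layer_kernel_def)
  moreover have "foldr (\<lambda>l. transfer_op ?X (?U l) (f (\<sigma> l))) [Suc (N + M)..<Suc (N + M + L)] =
      foldr (\<lambda>l. transfer_op ?X (?U l) (f l)) [Suc (N + M)..<Suc (N + M + L)]"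
    by (rule block[OF b3]) (auto simp: layer_kernel_def)
  ultimately show ?thesis
    unfolding QC_at_foldr[OF lam] split foldr_append by (simp only: o_def)
qed

end

theorem theorem5p2:
  fixes q t :: complex and N M L :: nat and lam :: "nat \<Rightarrow> nat"
  assumes "generic_parameters q t"
    and "(N, M, L) \<noteq> (0, 0, 0)"
    and "is_partition lam"
  shows "partially_symmetric {{1..N}, {N + 1..N + M}, {N + M + 1..N + M + L}}
           (QC N M L lam q t)"
  unfolding partially_symmetric_def
proof (intro allI impI, elim conjE)
  fix \<sigma> assume perm: "\<sigma> permutes \<Union>{{1..N}, {N + 1..N + M}, {N + M + 1..N + M + L}}"
    and blocks: "\<forall>I\<in>{{1..N}, {N + 1..N + M}, {N + M + 1..N + M + L}}. \<sigma> ` I = I"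
  interpret generic_qt q t by unfold_locales (rule assms(1))
  \<comment> \<open>Transposition and the finiteness of \<open>subparts\<close> need a vanishing
    0-th part, which \<open>is_partition\<close> does not provide.\<close>
  define lam0 where "lam0 = lam(0 := 0)"
  have lam0: "is_partition lam0" "lam0 0 = 0"
  proof -
    have "{i. 1 \<le> i \<and> lam0 i \<noteq> 0} = {i. 1 \<le> i \<and> lam i \<noteq> 0}" by (auto simp: lam0_def)
    then show "is_partition lam0" using assms(3) by (auto simp: is_partition_def lam0_def)
  qed (simp add: lam0_def)
  have "diagram lam = diagram lam0" by (auto simp: diagram_def lam0_def)
  then have QC: "QC N M L lam q t = QC_at N M L lam0 var"
    unfolding QC_at_def QC_def[symmetric] by (rule QC_cong_diagram)
  have "subst_vars \<sigma> (QC_at N M L lam0 var) = QC_at N M L lam0 (\<lambda>l. var (\<sigma> l))"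
    unfolding QC_at_def by (rule subst_vars_monomials[OF finite_diagram[OF lam0(1)]])
  also have "\<dots> = QC_at N M L lam0 var"
    by (rule QC_at_permute[OF lam0 permutes_inj[OF perm]]) (use blocks in auto)
  finally show "subst_vars \<sigma> (QC N M L lam q t) = QC N M L lam q t" unfolding QC .
qed

end
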